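(* Let $\Phi$ be the random dynamical system on $M=\mathbb{R}^N/\mathbb{Z}\cdot 2\pi\mathbf{e}$ obtained from the unidirectionally coupled stochastic system with coupling coefficient $k>0$ (see context). There exists a global random attractor $\mathcal{A}\colon\Omega\to2^M$ of $\Phi$ such that, for any $M$-valued tempered random set $D$ and any $\omega\in\Omega$, $$\operatorname{dist}\big(\Phi(t,D(\theta_{-t}\omega),\theta_{-t}\omega),\mathcal{A}(\omega)\big)\to0\quad\text{as }t\to\infty.$$ Moreover, if (with $N$, $\alpha_i$, $\epsilon_i$ fixed) the coupling coefficient $k$ is sufficiently large, then for each $\omega\in\Omega$, $\mathcal{A}(\omega)$ is a one-dimensional $C^1$-smooth closed curve.
   Context: **Stochastic system.** Let $N\ge 2$, $k>0$, $\alpha_i\in\mathbb{R}$, $\epsilon_i>0$ ($1\le i\le N$). Let $L$ be the $N\times N$ matrix with $L_{11}=0$, $L_{ii}=-1$ and $L_{i,i-1}=1$ for $2\le i\le N$, all other entries $0$. The stochastic system is $\mathrm{d}\psi=kL\psi\,\mathrm{d}t+(\alpha_i-\sin\psi_i)_{i=1}^N\,\mathrm{d}t+(\epsilon_i\,\mathrm{d}W_i(t))_{i=1}^N$, with $(W_i)_{i=1}^N$ a standard $N$-dimensional two-sided Brownian motion. **Probability space.** $\bar\Omega=\{\omega=(\omega_1,\dots,\omega_N)\colon\mathbb{R}\to\mathbb{R}^N \text{ continuous},\ \omega(0)=0\}$ with the compact-open topology, its Borel $\sigma$-algebra $\bar{\mathcal{F}}$, the Wiener measure $\mathbb{P}$,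 and the shift $\theta_t\omega(\cdot)=\omega(\cdot+t)-\omega(t)$. Let $\Omega\subset\bar\Omega$ be a fixed $\theta_t$-invariant set with $\mathbb{P}(\Omega)=1$ such that, for every $\omega\in\Omega$ and $1\le i\le N$, $z_i(\omega)=-\epsilon_i\int_{-\infty}^0e^{\tau}\omega_i(\tau)\,\mathrm{d}\tau$ exists, $t\mapsto z_i(\theta_t\omega)$ is continuous (it is the stationary solution of $\mathrm{d}z_i+z_i\,\mathrm{d}t=\epsilon_i\,\mathrm{d}W_i$), and $|z_i(\theta_t\omega)|/t\to0$ as $t\to\pm\infty$. Put $\mathcal{F}=\{F\cap\Omega\mid F\in\bar{\mathcal{F}}\}$. **The random system $\phi$ on $\mathbb{R}^N$.** $\phi(t,\phi_0,\omega)$ ($t\in\mathbb{R}$) is the solution with $\phi(0,\phi_0,\omega)=\phi_0$ of $$\frac{\mathrm{d}\phi}{\mathrm{d}t}=kL\phi+\big(\alpha_i-\sin(\phi_i+z_i(\theta_t\omega))+H_i(\theta_t\omega)\big)_{i=1}^N,$$ where $H_1=z_1$ and $H_i=k(z_{i-1}-z_i)+z_i$ for $2\le i\le N$. (It results from $\phi=\psi-z$.) **The random system $\Phi$ on $M$.** $\mathbf{e}=(1,\dots,1)^\top$, $M=\mathbb{R}^N/\mathbb{Z}\cdot2\pi\mathbf{e}$ (diffeomorphic to $\mathbb{S}^1\times\mathbb{R}^{N-1}$) with metric $d_M(x_1\bmod2\pi\mathbf{e},\,x_2\bmod2\pi\mathbf{e})=\inf_{n\in\mathbb{Z}}\|x_1-x_2-2\pi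 n\mathbf{e}\|$. Since $\phi(t,\phi_0+2\pi\mathbf{e},\omega)=\phi(t,\phi_0,\omega)+2\pi\mathbf{e}$, the formula $\Phi(t,\phi_0\bmod2\pi\mathbf{e},\omega)=\phi(t,\phi_0,\omega)\bmod2\pi\mathbf{e}$ defines a $C^1$-random dynamical system on $M$ over $(\Omega,\mathcal{F},\mathbb{P},(\theta_t))$. **Random sets and attractors.** $\operatorname{dist}(B_1,B_2)=\sup_{x\in B_1}\inf_{y\in B_2}d_M(x,y)$. A random set is a map $B\colon\Omega\to2^M$ with nonempty values such that $\omega\mapsto d_M(x,B(\omega))$ is measurable for all $x\in M$; it is a random compact set if all $B(\omega)$ are compact. It is tempered if there are $q\in M$ and a random variable $r\ge0$ with $B(\omega)\subset\{x\mid d_M(x,q)\le r(\omega)\}$ and $\sup_{t\in\mathbb{R}}e^{-\lambda|t|}r(\theta_t\omega)<\infty$ for all $\lambda>0$, $\omega\in\Omega$. A global random attractor of $\Phi$ is a tempered random compact set $\mathcal{A}$ with $\Phi(t,\mathcal{A}(\omega),\omega)=\mathcal{A}(\theta_t\omega)$ for all $t\in\mathbb{R}$, $\omega\in\Omega$, which attracts every tempered random set $D$, i.e. satisfies the convergence displayed in the claim. **Closed curve.** A one-dimensional $C^1$-smooth closed curve on $M$ is a one-dimensional $C^1$-submanifold of $M$ homeomorphic to $\mathbb{S}^1$. *)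

theory Defs
  imports "HOL-Probability.Probability"
begin

text \<open>
  The index set of the chain is an arbitrary finite linear order \<open>'n\<close>; it is isomorphic to
  \<open>1 < 2 < \<dots> < N\<close> with \<open>N = CARD('n)\<close>.  Vectors of \<open>\<real>\<^sup>N\<close> are elements of \<open>real ^ 'n\<close>, and
  \<open>vec c\<close> is the vector \<open>(c, \<dots>, c)\<close>.
\<close>

type_synonym 'n rvec = "real ^ 'n"

abbreviation idx1 :: "'n::{finite,linorder}" where
  "idx1 \<equiv> Min UNIV"

definition idx_pred :: "'n::{finite,linorder} \<Rightarrow> 'n" where
  "idx_pred i = Max {j. j < i}"  \<comment> \<open>meaningful only for \<open>i \<noteq> idx1\<close>\<close>

definition chain_matrix :: "((real, 'n) vec, 'n::{finite,linorder}) vec" where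
  "chain_matrix =
     (\<chi> i j. if i = idx1 then 0 else if j = i then - 1 else if j = idx_pred i then 1 else 0)"


section \<open>Canonical path space\<close>

type_synonym 'n path = "real \<Rightarrow> real ^ 'n"

definition wiener_paths :: "'n::finite path set" where
  "wiener_paths = {\<omega>. continuous_on UNIV \<omega> \<and> \<omega> 0 = 0}"

definition compact_open_topology :: "'n::finite path topology" where
  "compact_open_topology =
     topology_generated_by {{\<omega> \<in> wiener_paths. \<omega> ` K \<subseteq> U} | K U. compact K \<and> open U}"

definition path_borel :: "'n::finite path measure" where
  "path_borel = sigma wiener_paths {U. openin compact_open_topology U}"

text \<open>
  The Wiener measure is the unique probability measure on the Borel sets of the path space under
  which the coordinate process is a standard two-sided Brownian motion in \<open>\<real>\<^sup>N\<close>: the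
  components of the increments over successive intervals are all independent, and those over
  \<open>[s, t]\<close> are centred normal with variance \<open>t - s\<close>.
\<close>

definition wiener_measure :: "'n::finite path measure \<Rightarrow> bool" where
  "wiener_measure P \<longleftrightarrow>
     prob_space P \<and> sets P = sets path_borel \<and>
     (\<forall>s t i. s < t \<longrightarrow>
        distributed P lborel (\<lambda>\<omega>. \<omega> t $ i - \<omega> s $ i) (normal_density 0 (sqrt (t - s)))) \<and>
     (\<forall>(\<tau> :: nat \<Rightarrow> real) m. strict_mono \<tau> \<longrightarrow>
        prob_space.indep_vars P (\<lambda>_. borel)
          (\<lambda>(j, i) \<omega>. \<omega> (\<tau> (Suc j)) $ i - \<omega> (\<tau> j) $ i) ({..<m} \<times> UNIV))"

definition wiener_shift :: "real \<Rightarrow> 'n::finite path \<Rightarrow> 'n path" where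
  "wiener_shift t \<omega> = (\<lambda>s. \<omega> (s + t) - \<omega> t)"

text \<open>
  The integral is the Henstock--Kurzweil integral, which covers both the Lebesgue and the improper
  Riemann reading of \<open>\<integral>\<^bsub>-\<infinity>\<^esub>\<^sup>0\<close>.
\<close>

definition ou :: "real ^ 'n \<Rightarrow> 'n \<Rightarrow> 'n::finite path \<Rightarrow> real" where
  "ou \<epsilon> i \<omega> = - (\<epsilon> $ i) * integral {..0} (\<lambda>\<tau>. exp \<tau> * \<omega> \<tau> $ i)"

definition admissible_paths ::
    "'n::finite path measure \<Rightarrow> real ^ 'n \<Rightarrow> 'n path set \<Rightarrow> bool" where
  "admissible_paths P \<epsilon> \<Omega> \<longleftrightarrow>
     \<Omega> \<in> sets P \<and> measure P \<Omega> = 1 \<and> (\<forall>t. wiener_shift t ` \<Omega> = \<Omega>) \<and>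
     (\<forall>\<omega>\<in>\<Omega>. \<forall>i.
        (\<lambda>\<tau>. exp \<tau> * \<omega> \<tau> $ i) integrable_on {..0} \<and>
        continuous_on UNIV (\<lambda>t. ou \<epsilon> i (wiener_shift t \<omega>)) \<and>
        ((\<lambda>t. \<bar>ou \<epsilon> i (wiener_shift t \<omega>)\<bar> / t) \<longlongrightarrow> 0) at_top \<and>
        ((\<lambda>t. \<bar>ou \<epsilon> i (wiener_shift t \<omega>)\<bar> / t) \<longlongrightarrow> 0) at_bot)"


section \<open>The random system on \<open>\<real>\<^sup>N\<close>\<close>

definition forcing :: "real \<Rightarrow> 'n rvec \<Rightarrow> 'n::{finite,linorder} path \<Rightarrow> 'n rvec" where
  "forcing k \<epsilon> \<omega> =
     (\<chi> i. if i = idx1 then ou \<epsilon> i \<omega>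
          else k * (ou \<epsilon> (idx_pred i) \<omega> - ou \<epsilon> i \<omega>) + ou \<epsilon> i \<omega>)"

definition vfield ::
    "real \<Rightarrow> 'n rvec \<Rightarrow> 'n rvec \<Rightarrow> 'n::{finite,linorder} path \<Rightarrow> 'n rvec \<Rightarrow> 'n rvec" where
  "vfield k \<alpha> \<epsilon> \<omega> x =
     k *\<^sub>R (chain_matrix *v x) +
     (\<chi> i. \<alpha> $ i - sin (x $ i + ou \<epsilon> i \<omega>) + forcing k \<epsilon> \<omega> $ i)"

definition phi ::
    "real \<Rightarrow> 'n rvec \<Rightarrow> 'n rvec \<Rightarrow> real \<Rightarrow> 'n rvec \<Rightarrow> 'n::{finite,linorder} path \<Rightarrow> 'n rvec"
  where
  "phi k \<alpha> \<epsilon> t x0 \<omega> =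
     (THE x. x 0 = x0 \<and>
        (\<forall>s. (x has_vector_derivative vfield k \<alpha> \<epsilon> (wiener_shift s \<omega>) (x s)) (at s))) t"


section \<open>The phase space \<open>M = \<real>\<^sup>N / \<int> 2 \<pi> e\<close>\<close>

definition deck_rel :: "real ^ 'n \<Rightarrow> real ^ 'n::finite \<Rightarrow> bool" where
  "deck_rel x y \<longleftrightarrow> (\<exists>m::int. x - y = vec (2 * pi * of_int m))"

lemma equivp_deck_rel: "equivp deck_rel"
proof (rule equivpI)
  show "reflp deck_rel"
    by (auto simp: reflp_def deck_rel_def vec_eq_iff intro!: exI[of _ 0])
  show "symp deck_rel"
  proof (rule sympI)
    fix x y :: "real ^ 'n" assume "deck_rel x y"
    then obtain m :: int where "x - y = vec (2 * pi * of_int m)"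
      by (auto simp: deck_rel_def)
    then have "y - x = vec (2 * pi * of_int (- m))"
      by (auto simp: vec_eq_iff algebra_simps)
    then show "deck_rel y x"
      unfolding deck_rel_def by blast
  qed
  show "transp deck_rel"
  proof (rule transpI)
    fix x y z :: "real ^ 'n" assume "deck_rel x y" "deck_rel y z"
    then obtain m n :: int
      where "x - y = vec (2 * pi * of_int m)" "y - z = vec (2 * pi * of_int n)"
      by (auto simp: deck_rel_def)
    then have "x - z = vec (2 * pi * of_int (m + n))"
      by (auto simp: vec_eq_iff algebra_simps)
    then show "deck_rel x z"
      unfolding deck_rel_def by blast
  qed
qed

quotient_type 'n phase = "real ^ 'n::finite" / deck_rel
  morphisms rep_phase proj
  by (rule equivp_deck_rel)

lemma proj_rep_phase [simp]: "proj (rep_phase p) = p"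
  by (rule Quotient3_abs_rep[OF Quotient3_phase])

lemma proj_eq_iff: "proj x = proj y \<longleftrightarrow> (\<exists>m::int. x - y = vec (2 * pi * of_int m))"
  using phase.abs_eq_iff[of x y] by (simp add: deck_rel_def)

definition dist_mod :: "real ^ 'n \<Rightarrow> real ^ 'n::finite \<Rightarrow> real" where
  "dist_mod x y = (INF m::int. norm (x - y - vec (2 * pi * of_int m)))"

lemma dist_mod_bdd: "bdd_below (range (\<lambda>m::int. norm (x - y - vec (2 * pi * of_int m))))"
  by (rule bdd_belowI[of _ 0]) auto

lemma dist_mod_le: "dist_mod x y \<le> norm (x - y - vec (2 * pi * of_int m))"
  unfolding dist_mod_def by (rule cINF_lower[OF dist_mod_bdd]) auto

lemma dist_mod_geI: "(\<And>m. c \<le> norm (x - y - vec (2 * pi * of_int m))) \<Longrightarrow> c \<le> dist_mod x y"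
  unfolding dist_mod_def by (rule cINF_greatest) auto

lemma dist_mod_nonneg: "0 \<le> dist_mod x y"
  by (rule dist_mod_geI) auto

lemma dist_mod_less:
  assumes "dist_mod x y < c"
  obtains m :: int where "norm (x - y - vec (2 * pi * of_int m)) < c"
  using assms dist_mod_geI[of c x y] by (meson not_less)

lemma dist_mod_eq_0_iff: "dist_mod x y = 0 \<longleftrightarrow> deck_rel x y"
proof
  assume "deck_rel x y"
  then obtain m :: int where "x - y = vec (2 * pi * of_int m)"
    by (auto simp: deck_rel_def)
  then show "dist_mod x y = 0"
    using dist_mod_le[of x y m] dist_mod_nonneg[of x y] by simp
next
  assume 0: "dist_mod x y = 0"
  obtain m :: int where m: "norm (x - y - vec (2 * pi * of_int m)) < 1"
    using dist_mod_less[of x y 1] 0 by auto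
  let ?c = "norm (x - y - vec (2 * pi * of_int m))"
  have "?c = 0"
  proof (rule ccontr)
    assume "?c \<noteq> 0"
    then have "?c > 0" by simp
    then obtain n :: int where n: "norm (x - y - vec (2 * pi * of_int n)) < ?c"
      using dist_mod_less[of x y ?c] 0 by auto
    then have ne: "n \<noteq> m" by auto
    have "\<bar>2 * pi * of_int n - 2 * pi * of_int m\<bar> =
        \<bar>((x - y - vec (2 * pi * of_int m)) - (x - y - vec (2 * pi * of_int n))) $ undefined\<bar>"
      by simp
    also have "\<dots> \<le> norm ((x - y - vec (2 * pi * of_int m)) - (x - y - vec (2 * pi * of_int n)))"
      by (rule component_le_norm_cart)
    also have "\<dots> \<le> ?c + norm (x - y - vec (2 * pi * of_int n))"
      by (rule norm_triangle_ineq4)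
    also have "\<dots> < 2"
      using m n by linarith
    finally have "\<bar>2 * pi * (of_int (n - m) :: real)\<bar> < 2"
      by (simp add: algebra_simps)
    then have "2 * pi * \<bar>of_int (n - m) :: real\<bar> < 2"
      by (simp add: abs_mult)
    moreover have "1 \<le> \<bar>of_int (n - m) :: real\<bar>"
      using ne by linarith
    then have "2 * pi * 1 \<le> 2 * pi * \<bar>of_int (n - m) :: real\<bar>"
      by (intro mult_left_mono) auto
    ultimately show False
      using pi_gt3 by linarith
  qed
  then show "deck_rel x y"
    by (auto simp: deck_rel_def)
qed

lemma dist_mod_commute: "dist_mod x y = dist_mod y x"
proof -
  have "dist_mod y x \<le> dist_mod x y" for x y :: "real ^ 'a"
  proof (rule dist_mod_geI)
    fix m :: int
    have "y - x - vec (2 * pi * of_int (- m)) = - (x - y - vec (2 * pi * of_int m))"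
      by (simp add: vec_eq_iff)
    then have "norm (y - x - vec (2 * pi * of_int (- m))) = norm (x - y - vec (2 * pi * of_int m))"
      by (metis norm_minus_cancel)
    then show "dist_mod y x \<le> norm (x - y - vec (2 * pi * of_int m))"
      using dist_mod_le[of y x "- m"] by linarith
  qed
  then show ?thesis
    by (meson order_antisym)
qed

lemma dist_mod_triangle: "dist_mod x z \<le> dist_mod x y + dist_mod y z"
proof (rule field_le_epsilon)
  fix e :: real assume e: "e > 0"
  obtain m where m: "norm (x - y - vec (2 * pi * of_int m)) < dist_mod x y + e / 2"
    using dist_mod_less[of x y "dist_mod x y + e / 2"] e by auto
  obtain n where n: "norm (y - z - vec (2 * pi * of_int n)) < dist_mod y z + e / 2"
    using dist_mod_less[of y z "dist_mod y z + e / 2"] e by auto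
  have "x - z - vec (2 * pi * of_int (m + n)) =
      (x - y - vec (2 * pi * of_int m)) + (y - z - vec (2 * pi * of_int n))"
    by (simp add: vec_eq_iff algebra_simps)
  then have "norm (x - z - vec (2 * pi * of_int (m + n))) \<le>
      norm (x - y - vec (2 * pi * of_int m)) + norm (y - z - vec (2 * pi * of_int n))"
    by (metis norm_triangle_ineq)
  then show "dist_mod x z \<le> dist_mod x y + dist_mod y z + e"
    using m n dist_mod_le[of x z "m + n"] by linarith
qed

lemma dist_mod_cong:
  assumes "deck_rel x x'" "deck_rel y y'"
  shows "dist_mod x y = dist_mod x' y'"
proof -
  have "dist_mod x x' = 0" "dist_mod x' x = 0" "dist_mod y y' = 0" "dist_mod y' y = 0"
    using assms dist_mod_eq_0_iff dist_mod_commute by metis+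
  then show ?thesis
    using dist_mod_triangle[of x y x'] dist_mod_triangle[of x' y y']
      dist_mod_triangle[of x' y' x] dist_mod_triangle[of x y' y] by linarith
qed

instantiation phase :: (finite) metric_space
begin

lift_definition dist_phase :: "'a phase \<Rightarrow> 'a phase \<Rightarrow> real" is dist_mod
  by (rule dist_mod_cong)

definition uniformity_phase :: "('a phase \<times> 'a phase) filter" where
  "uniformity_phase = (INF e\<in>{0<..}. principal {(p, q). dist p q < e})"

definition open_phase :: "'a phase set \<Rightarrow> bool" where
  "open_phase U \<longleftrightarrow> (\<forall>p\<in>U. \<forall>\<^sub>F (p', q) in uniformity. p' = p \<longrightarrow> q \<in> U)"

instance
proof
  fix p q r :: "'a phase"
  show "dist p q = 0 \<longleftrightarrow> p = q"
    by transfer (rule dist_mod_eq_0_iff)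
  show "dist p q \<le> dist p r + dist q r"
    by transfer (metis dist_mod_triangle dist_mod_commute)
qed (fact uniformity_phase_def open_phase_def)+

end

lemma dist_proj: "dist (proj x) (proj y) = (INF m::int. norm (x - y - vec (2 * pi * of_int m)))"
  by transfer (simp add: dist_mod_def)


section \<open>The random system on \<open>M\<close>\<close>

text \<open>
  The result does not depend on the representative, since \<open>phi\<close> commutes with translation
  by \<open>2 \<pi> e\<close>.
\<close>

definition Phi ::
    "real \<Rightarrow> 'n rvec \<Rightarrow> 'n rvec \<Rightarrow> real \<Rightarrow> 'n phase \<Rightarrow> 'n::{finite,linorder} path \<Rightarrow> 'n phase"
  where
  "Phi k \<alpha> \<epsilon> t p \<omega> = proj (phi k \<alpha> \<epsilon> t (rep_phase p) \<omega>)"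


section \<open>Random sets and attractors\<close>

text \<open>
  In this section \<open>P\<close> is the Wiener measure and \<open>restrict_space P \<Omega>\<close> carries the trace
  \<open>\<sigma>\<close>-algebra \<open>{F \<inter> \<Omega> | F}\<close>.  The semidistance takes values in the extended nonnegative
  reals, so that
  no convention for unbounded sets is needed.
\<close>

definition semidist :: "'a::metric_space set \<Rightarrow> 'a set \<Rightarrow> ennreal" where
  "semidist B1 B2 = (SUP x\<in>B1. INF y\<in>B2. ennreal (dist x y))"

definition random_set ::
    "'n::finite path measure \<Rightarrow> 'n path set \<Rightarrow> ('n path \<Rightarrow> 'n phase set) \<Rightarrow> bool" where
  "random_set P \<Omega> B \<longleftrightarrow>
     (\<forall>\<omega>\<in>\<Omega>. B \<omega> \<noteq> {}) \<and>
     (\<forall>p. (\<lambda>\<omega>. infdist p (B \<omega>)) \<in> borel_measurable (restrict_space P \<Omega>))"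

definition tempered ::
    "'n::finite path measure \<Rightarrow> 'n path set \<Rightarrow> ('n path \<Rightarrow> 'n phase set) \<Rightarrow> bool" where
  "tempered P \<Omega> B \<longleftrightarrow>
     (\<exists>q r. r \<in> borel_measurable (restrict_space P \<Omega>) \<and>
        (\<forall>\<omega>\<in>\<Omega>. 0 \<le> r \<omega> \<and> B \<omega> \<subseteq> cball q (r \<omega>)) \<and>
        (\<forall>c>0. \<forall>\<omega>\<in>\<Omega>. bdd_above (range (\<lambda>t. exp (- c * \<bar>t\<bar>) * r (wiener_shift t \<omega>)))))"

definition attracts ::
    "'n path set \<Rightarrow> (real \<Rightarrow> 'n phase \<Rightarrow> 'n path \<Rightarrow> 'n phase) \<Rightarrow>
      ('n path \<Rightarrow> 'n phase set) \<Rightarrow> ('n::finite path \<Rightarrow> 'n phase set) \<Rightarrow> bool" where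
  "attracts \<Omega> F A D \<longleftrightarrow>
     (\<forall>\<omega>\<in>\<Omega>.
        ((\<lambda>t. semidist ((\<lambda>p. F t p (wiener_shift (- t) \<omega>)) ` D (wiener_shift (- t) \<omega>)) (A \<omega>)) \<longlongrightarrow> 0) at_top)"

definition global_random_attractor ::
    "'n path measure \<Rightarrow> 'n path set \<Rightarrow> (real \<Rightarrow> 'n phase \<Rightarrow> 'n path \<Rightarrow> 'n phase) \<Rightarrow>
      ('n::finite path \<Rightarrow> 'n phase set) \<Rightarrow> bool" where
  "global_random_attractor P \<Omega> F A \<longleftrightarrow>
     random_set P \<Omega> A \<and> (\<forall>\<omega>\<in>\<Omega>. compact (A \<omega>)) \<and> tempered P \<Omega> A \<and>
     (\<forall>t. \<forall>\<omega>\<in>\<Omega>. (\<lambda>p. F t p \<omega>) ` A \<omega> = A (wiener_shift t \<omega>)) \<and>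
     (\<forall>D. random_set P \<Omega> D \<and> tempered P \<Omega> D \<longrightarrow> attracts \<Omega> F A D)"


section \<open>Closed curves\<close>

definition C1_on ::
    "('a::real_normed_vector \<Rightarrow> 'b::real_normed_vector) \<Rightarrow> 'a set \<Rightarrow> bool" where
  "C1_on f S \<longleftrightarrow>
     (\<exists>f'. (\<forall>x\<in>S. (f has_derivative blinfun_apply (f' x)) (at x)) \<and> continuous_on S f')"

text \<open>
  The smooth structure on \<open>M\<close> is the one for which \<open>proj\<close> is a local diffeomorphism: the local
  inverses of \<open>proj\<close>, taken on \<open>proj ` V\<close> for open \<open>V\<close> on which \<open>proj\<close> is injective, are the
  charts.  A one-dimensional \<open>C\<^sup>1\<close>-submanifold is a set which near each of its points is mapped
  onto an open piece of a coordinate line by a \<open>C\<^sup>1\<close>-diffeomorphism \<open>h\<close> applied in such a chart.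
\<close>

definition C1_submanifold_1 :: "'n::{finite,linorder} phase set \<Rightarrow> bool" where
  "C1_submanifold_1 S \<longleftrightarrow>
     (\<forall>x. proj x \<in> S \<longrightarrow>
        (\<exists>V (W :: 'n rvec set) h g. open V \<and> x \<in> V \<and> inj_on proj V \<and> open W \<and>
           homeomorphism V W h g \<and> C1_on h V \<and> C1_on g W \<and>
           h ` (V \<inter> proj -` S) = W \<inter> {y. \<forall>i. i \<noteq> idx1 \<longrightarrow> y $ i = 0}))"

definition C1_closed_curve :: "'n::{finite,linorder} phase set \<Rightarrow> bool" where
  "C1_closed_curve S \<longleftrightarrow> C1_submanifold_1 S \<and> S homeomorphic sphere (0::complex) 1"

end

theory Submission
  imports Defs "HOL-Real_Asymp.Real_Asymp"
begin

text \<open>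
  The differences \<open>gap x i\<close> of neighbouring components obey a dissipative system: a geometrically
  weighted sum of their squares, the energy, satisfies \<open>E' \<le> - 2 \<kappa> E + \<kappa> source(\<theta>\<^sub>t \<omega>)\<close> with \<open>\<kappa> = k / 4\<close>.
  Hence \<open>{E \<le> \<rho>(\<omega>)}\<close> with \<open>\<rho>(\<omega>) = sup\<^sub>u exp (- \<kappa> u) source(\<theta>\<^bsub>-u\<^esub> \<omega>)\<close> is forward invariant, absorbs every tempered set and
  is compact modulo \<open>2 \<pi> e\<close>; the attractor consists of the points whose whole orbit stays in these sets.

  For \<open>k > 3\<close>, take two orbits on the attractor and let \<open>D\<^sub>i\<close> be the difference of their \<open>i\<close>-th
  components.  Then \<open>D\<^sub>i' = - (k + c\<^sub>i) D\<^sub>i + k D\<^bsub>i-1\<^esub>\<close> for \<open>i \<noteq> 1\<close> and \<open>D\<^sub>1' = - c\<^sub>1 D\<^sub>1\<close>, where \<open>\<bar>c\<^sub>i\<bar> \<le> 1\<close>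
  is a slope of the sine.  Since \<open>D\<close> grows slowly backwards in time, \<open>D\<^sub>1\<close> controls all \<open>D\<^sub>i\<close>, so the attractor is a
  Lipschitz graph over the first component.  The same argument applied to the differences of the quotients
  \<open>D\<^sub>i / D\<^sub>1(0)\<close> for two pairs of orbits shows that the slopes of this graph are Lipschitz, hence the graph is \<open>C\<^sup>1\<close>.
\<close>

section \<open>Ordinary differential equations with globally Lipschitz right-hand side\<close>

text \<open>The coupling annihilates the direction of \<open>vec 1\<close> and the sine is merely
  bounded, so nothing is dissipated along this direction: only the gaps can be absorbed, and
  compactness has to come from the quotient by deck translations. The supremum \<open>\<rho>\<close>
  is discounted at rate \<kappa> while the energy decays at rate 2 \<kappa>; the difference of the
  rates leaves room for the initial energy, so one radius serves both for invariance and for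
  absorption. Smoothness is not obtained by differentiating the flow. Orbits are compared backward
  in time, where the homogeneous equation of every component after the first expands at rate at
  least k - 1, while differences on the attractor grow only like exp (- t). The equation for
  differences of quotients contains products of two such factors, so k - 1 must exceed 2; this is
  the origin of k > 3. The flow is built by explicit Picard iteration because measurability of the
  attractor in \<omega> has to be read off from it.\<close>

lemma lipschitz_flow_bound:
  fixes x y :: "real \<Rightarrow> 'a::real_inner"
  assumes dx: "\<And>t. (x has_vector_derivative F t (x t)) (at t)"
    and dy: "\<And>t. (y has_vector_derivative F t (y t)) (at t)"
    and lip: "\<And>t u v. norm (F t u - F t v) \<le> K * norm (u - v)"
  shows "norm (x t - y t) \<le> exp (K * \<bar>t\<bar>) * norm (x 0 - y 0)"
proof -
  \<comment> \<open>The squared distance is differentiable also where the two solutions meet. Its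
    derivative is at most 2 K times itself in modulus, which settles both time directions.\<close>
  define u where "u t = (x t - y t) \<bullet> (x t - y t)" for t
  define u' where "u' t = 2 * ((x t - y t) \<bullet> (F t (x t) - F t (y t)))" for t
  have du: "(u has_real_derivative u' t) (at t)" for t
  proof -
    have "((\<lambda>t. x t - y t) has_derivative (\<lambda>h. h *\<^sub>R (F t (x t) - F t (y t)))) (at t)"
      using has_vector_derivative_diff[OF dx dy] by (simp add: has_vector_derivative_def)
    from has_derivative_inner[OF this this] show ?thesis
      unfolding u_def u'_def has_field_derivative_def
      by (rule has_derivative_eq_rhs) (auto simp: inner_commute algebra_simps)
  qed
  have u'_le: "\<bar>u' t\<bar> \<le> 2 * K * u t" for t
  proof -
    have "\<bar>(x t - y t) \<bullet> (F t (x t) - F t (y t))\<bar> \<le> norm (x t - y t) * norm (F t (x t) - F t (y t))"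
      by (rule Cauchy_Schwarz_ineq2)
    also have "\<dots> \<le> norm (x t - y t) * (K * norm (x t - y t))"
      by (intro mult_left_mono lip) auto
    finally show ?thesis
      by (simp add: u_def u'_def dot_square_norm power2_eq_square algebra_simps)
  qed
  have le: "u t \<le> exp (2 * K * \<bar>t\<bar>) * u 0"
  proof (cases "t \<ge> 0")
    case True
    have "exp (- 2 * K * t) * u t \<le> exp (- 2 * K * 0) * u 0"
    proof (rule DERIV_nonpos_imp_nonincreasing[OF True])
      fix s :: real
      have "((\<lambda>t. exp (- 2 * K * t) * u t) has_real_derivative
          exp (- 2 * K * s) * (u' s - 2 * K * u s)) (at s)"
        by (rule derivative_eq_intros du refl)+ (simp add: algebra_simps)
      moreover have "exp (- 2 * K * s) * (u' s - 2 * K * u s) \<le> 0"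
        using u'_le[of s] by (intro mult_nonneg_nonpos) auto
      ultimately show "\<exists>y. ((\<lambda>t. exp (- 2 * K * t) * u t) has_real_derivative y) (at s) \<and> y \<le> 0"
        by blast
    qed
    then show ?thesis
      using True by (simp add: exp_minus field_simps)
  next
    case False
    have "exp (2 * K * t) * u t \<le> exp (2 * K * 0) * u 0"
    proof (rule DERIV_nonneg_imp_nondecreasing[where f = "\<lambda>t. exp (2 * K * t) * u t"])
      fix s :: real
      have "((\<lambda>t. exp (2 * K * t) * u t) has_real_derivative
          exp (2 * K * s) * (u' s + 2 * K * u s)) (at s)"
        by (rule derivative_eq_intros du refl)+ (simp add: algebra_simps)
      moreover have "exp (2 * K * s) * (u' s + 2 * K * u s) \<ge> 0"
        using u'_le[of s] by (intro mult_nonneg_nonneg) auto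
      ultimately show "\<exists>y. ((\<lambda>t. exp (2 * K * t) * u t) has_real_derivative y) (at s) \<and> 0 \<le> y"
        by blast
    qed (use False in auto)
    then show ?thesis
      using False by (simp add: exp_minus field_simps)
  qed
  have "(norm (x t - y t))\<^sup>2 \<le> (exp (K * \<bar>t\<bar>) * norm (x 0 - y 0))\<^sup>2"
    using le by (simp add: u_def dot_square_norm power_mult_distrib exp_double[symmetric] algebra_simps)
  then show ?thesis
    by (rule power2_le_imp_le) auto
qed

lemma norm_le_exp_of_vector_derivative:
  fixes f :: "real \<Rightarrow> 'a::real_normed_vector"
  assumes df: "\<And>t. (f has_vector_derivative f' t) (at t)" and f0: "f 0 = 0"
    and bnd: "\<And>t. \<bar>t\<bar> \<le> T \<Longrightarrow> norm (f' t) \<le> c * L * exp (L * \<bar>t\<bar>)"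
    and t: "\<bar>t\<bar> \<le> T" and c: "0 \<le> c"
  shows "norm (f t) \<le> c * exp (L * \<bar>t\<bar>)"
proof -
  have *: "norm (g t) \<le> c * exp (L * t)"
    if dg: "\<And>t. (g has_vector_derivative g' t) (at t)" and g0: "g 0 = 0"
      and b: "\<And>t. 0 \<le> t \<Longrightarrow> t \<le> T \<Longrightarrow> norm (g' t) \<le> c * L * exp (L * t)" and t: "0 \<le> t" "t \<le> T"
    for g g' :: "real \<Rightarrow> 'a" and t
  proof (cases "t = 0")
    case True
    then show ?thesis using g0 c by simp
  next
    case False
    have "norm (g t - g 0) \<le> c * exp (L * t) - c * exp (L * 0)"
    proof (rule differentiable_bound_general[where f' = g' and \<phi>' = "\<lambda>t. c * L * exp (L * t)"])
      show "continuous_on {0..t} g"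
        by (intro continuous_at_imp_continuous_on ballI has_vector_derivative_continuous[OF dg])
      show "continuous_on {0..t} (\<lambda>t. c * exp (L * t))"
        by (intro continuous_intros)
      show "((\<lambda>t. c * exp (L * t)) has_vector_derivative c * L * exp (L * x)) (at x)" for x
        unfolding has_real_derivative_iff_has_vector_derivative[symmetric]
        by (rule derivative_eq_intros refl)+ simp
    qed (use False t dg b in auto)
    then show ?thesis using g0 c by simp
  qed
  show ?thesis
  proof (cases "t \<ge> 0")
    case True
    have "norm (f t) \<le> c * exp (L * t)"
    proof (rule *[OF df f0])
      show "norm (f' s) \<le> c * L * exp (L * s)" if "0 \<le> s" "s \<le> T" for s
        using bnd[of s] that by simp
    qed (use True t in auto)
    then show ?thesis using True by simp
  next
    case False
    have "((\<lambda>t. f (- t)) has_vector_derivative - f' (- t)) (at t)" for t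
    proof -
      have "((\<lambda>t :: real. - t) has_vector_derivative - 1) (at t)"
        by (auto intro!: derivative_eq_intros)
      from vector_diff_chain_at[OF this df] show ?thesis
        by (simp add: o_def)
    qed
    then have "norm (f (- (- t))) \<le> c * exp (L * - t)"
    proof (rule *)
      show "norm (- f' (- s)) \<le> c * L * exp (L * s)" if "0 \<le> s" "s \<le> T" for s
        using bnd[of "- s"] that by simp
    qed (use False t f0 in auto)
    then show ?thesis using False by simp
  qed
qed

text \<open>The iterates are kept explicit, instead of being hidden in a fixed point theorem,
  because each of them is later shown to depend measurably on the path. The oriented integral covers
  negative times as well.\<close>

primrec picard :: "(real \<Rightarrow> 'a::euclidean_space \<Rightarrow> 'a) \<Rightarrow> 'a \<Rightarrow> nat \<Rightarrow> real \<Rightarrow> 'a" where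
  "picard F x0 0 = (\<lambda>_. x0)"
| "picard F x0 (Suc n) = (\<lambda>t. x0 + (LBINT s=ereal 0..ereal t. F s (picard F x0 n s)))"

lemma LBINT_has_vector_derivative:
  fixes f :: "real \<Rightarrow> 'a::euclidean_space"
  assumes "continuous_on UNIV f"
  shows "((\<lambda>t. LBINT s=ereal 0..ereal t. f s) has_vector_derivative f t) (at t)"
proof -
  let ?c = "\<bar>t\<bar> + 1"
  have "((\<lambda>u. LBINT y=ereal 0..ereal u. f y) has_vector_derivative f t) (at t within {- ?c..?c})"
    by (rule interval_integral_FTC2) (auto intro: continuous_on_subset[OF assms])
  moreover have "at t within {- ?c..?c} = at t"
    by (rule at_within_interior) (auto simp: interior_atLeastAtMost_real)
  ultimately show ?thesis by simp
qed

locale lipschitz_field =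
  fixes F :: "real \<Rightarrow> 'a::euclidean_space \<Rightarrow> 'a" and K :: real
  assumes cont: "continuous_on UNIV (\<lambda>(t, x). F t x)"
    and lip: "norm (F t u - F t v) \<le> K * norm (u - v)"
    and K_pos: "K > 0"
begin

lemma continuous_along:
  assumes "continuous_on UNIV x" shows "continuous_on UNIV (\<lambda>t. F t (x t))"
proof -
  have "continuous_on UNIV (\<lambda>t. (t, x t))"
    using assms by (intro continuous_intros)
  then show ?thesis
    using continuous_on_compose2[OF cont, of UNIV "\<lambda>t. (t, x t)"] by simp
qed

lemma continuous_picard: "continuous_on UNIV (picard F x0 n)"
proof (induction n)
  case (Suc n)
  have "continuous_on UNIV (\<lambda>t. LBINT s=ereal 0..ereal t. F s (picard F x0 n s))"
    by (intro continuous_at_imp_continuous_on ballI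
        has_vector_derivative_continuous[OF LBINT_has_vector_derivative] continuous_along Suc)
  then show ?case by (auto intro!: continuous_intros)
qed auto

lemma picard_derivative:
  "(picard F x0 (Suc n) has_vector_derivative F t (picard F x0 n t)) (at t)"
  using LBINT_has_vector_derivative[OF continuous_along[OF continuous_picard[of x0 n]], of t]
  by (auto intro!: derivative_eq_intros)

lemma picard_0: "picard F x0 n 0 = x0"
  by (cases n) (auto simp: interval_integral_endpoints_same)

text \<open>The weight exp (2 K |t|) gains a factor 1/2 in every step (Bielecki's norm), so every
  interval [-T, T] is reached without a smallness condition. Only M depends on T, through the first
  step.\<close>

lemma picard_step:
  obtains M where "0 \<le> M" "\<And>n t. \<bar>t\<bar> \<le> T \<Longrightarrow>
    norm (picard F x0 (Suc n) t - picard F x0 n t) \<le> M * (1/2) ^ n * exp (2 * K * \<bar>t\<bar>)"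
proof -
  have "compact ((\<lambda>t. picard F x0 (Suc 0) t - x0) ` {- T..T})"
    by (intro compact_continuous_image continuous_intros continuous_on_subset[OF continuous_picard]) auto
  then have "\<exists>M. \<forall>t\<in>{- T..T}. norm (picard F x0 (Suc 0) t - x0) \<le> M"
    by (auto dest!: compact_imp_bounded simp: bounded_iff simp del: picard.simps)
  then obtain M where M0: "\<And>t. t \<in> {- T..T} \<Longrightarrow> norm (picard F x0 (Suc 0) t - x0) \<le> M"
    by blast
  define M' where "M' = max M 0"
  have "norm (picard F x0 (Suc n) t - picard F x0 n t) \<le> M' * (1/2) ^ n * exp (2 * K * \<bar>t\<bar>)"
    if "\<bar>t\<bar> \<le> T" for n t
    using that
  proof (induction n arbitrary: t)
    case 0
    have "norm (picard F x0 (Suc 0) t - x0) \<le> M' * 1"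
      using M0[of t] 0 by (auto simp: M'_def abs_le_iff simp del: picard.simps)
    also have "\<dots> \<le> M' * exp (2 * K * \<bar>t\<bar>)"
      using K_pos by (intro mult_left_mono) (auto simp: M'_def)
    finally show ?case by simp
  next
    case (Suc n)
    have "norm (picard F x0 (Suc (Suc n)) t - picard F x0 (Suc n) t)
        \<le> M' * (1/2) ^ Suc n * exp (2 * K * \<bar>t\<bar>)"
    proof (rule norm_le_exp_of_vector_derivative[where T = T and
          f' = "\<lambda>t. F t (picard F x0 (Suc n) t) - F t (picard F x0 n t)"])
      show "((\<lambda>t. picard F x0 (Suc (Suc n)) t - picard F x0 (Suc n) t) has_vector_derivative
          F t (picard F x0 (Suc n) t) - F t (picard F x0 n t)) (at t)" for t
        by (intro derivative_intros picard_derivative)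
      fix s assume s: "\<bar>s\<bar> \<le> T"
      have "norm (F s (picard F x0 (Suc n) s) - F s (picard F x0 n s))
          \<le> K * norm (picard F x0 (Suc n) s - picard F x0 n s)"
        by (rule lip)
      also have "\<dots> \<le> K * (M' * (1/2) ^ n * exp (2 * K * \<bar>s\<bar>))"
        using K_pos by (intro mult_left_mono Suc.IH s) auto
      finally show "norm (F s (picard F x0 (Suc n) s) - F s (picard F x0 n s))
          \<le> M' * (1/2) ^ Suc n * (2 * K) * exp (2 * K * \<bar>s\<bar>)"
        by (simp add: algebra_simps)
    qed (use Suc.prems in \<open>auto simp: M'_def picard_0 simp del: picard.simps\<close>)
    then show ?case .
  qed
  then show ?thesis by (intro that[of M']) (auto simp: M'_def)
qed

lemma picard_uniform_limit:
  "uniform_limit {- T..T} (picard F x0) (\<lambda>t. lim (\<lambda>n. picard F x0 n t)) sequentially"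
proof -
  obtain M where M: "0 \<le> M" "\<And>n t. \<bar>t\<bar> \<le> T \<Longrightarrow>
      norm (picard F x0 (Suc n) t - picard F x0 n t) \<le> M * (1/2) ^ n * exp (2 * K * \<bar>t\<bar>)"
    using picard_step[where T = T and ?x0.0 = x0] by blast
  define B where "B n = M * exp (2 * K * T) * (1/2) ^ n" for n :: nat
  have step: "norm (picard F x0 (Suc n) t - picard F x0 n t) \<le> B n" if "t \<in> {- T..T}" for n t
  proof -
    have "M * (1/2) ^ n * exp (2 * K * \<bar>t\<bar>) \<le> M * (1/2) ^ n * exp (2 * K * T)"
      using that K_pos M(1) by (intro mult_left_mono) auto
    then show ?thesis
      using order_trans[OF M(2)] that by (auto simp: B_def mult_ac abs_le_iff simp del: picard.simps)
  qed
  have "summable B"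
    unfolding B_def by (intro summable_mult summable_geometric) auto
  then have "uniformly_convergent_on {- T..T}
      (\<lambda>n t. \<Sum>i<n. picard F x0 (Suc i) t - picard F x0 i t)"
    by (intro Weierstrass_m_test'[of _ _ B] step)
  then have "uniformly_convergent_on {- T..T} (\<lambda>n t. picard F x0 n t - x0)"
    by (subst (asm) sum_lessThan_telescope) simp
  then obtain l where l: "uniform_limit {- T..T} (\<lambda>n t. picard F x0 n t - x0) l sequentially"
    by (auto simp: uniformly_convergent_on_def)
  have l2: "uniform_limit {- T..T} (\<lambda>n t. (picard F x0 n t - x0) + x0) (\<lambda>t. l t + x0) sequentially"
    by (intro uniform_limit_intros l)
  then have l3: "uniform_limit {- T..T} (picard F x0) (\<lambda>t. l t + x0) sequentially" by simp
  show ?thesis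
    by (rule uniform_limit_cong'[THEN iffD1, OF _ _ l3])
      (auto intro!: limI[symmetric] tendsto_uniform_limitI[OF l3])
qed

lemma picard_tendsto: "(\<lambda>n. picard F x0 n t) \<longlonglongrightarrow> lim (\<lambda>n. picard F x0 n t)"
  by (rule tendsto_uniform_limitI[OF picard_uniform_limit[where T = "\<bar>t\<bar>"]]) auto

text \<open>Termwise differentiation: the derivative of an iterate is F along the preceding one, and
  the Lipschitz bound turns uniform convergence of the iterates into uniform convergence of these
  derivatives. An open interval around t removes the \<open>within\<close>.\<close>

lemma picard_lim_solves:
  "((\<lambda>t. lim (\<lambda>n. picard F x0 n t)) has_vector_derivative F t (lim (\<lambda>n. picard F x0 n t))) (at t)"
proof -
  let ?X = "\<lambda>t. lim (\<lambda>n. picard F x0 n t)"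
  define T where "T = \<bar>t\<bar> + 1"
  let ?S = "{- T<..<T}"
  have t: "t \<in> ?S" by (auto simp: T_def)
  have "\<exists>g. \<forall>x\<in>?S. (\<lambda>n. picard F x0 (Suc n) x) \<longlonglongrightarrow> g x \<and>
      (g has_derivative (\<lambda>h. h *\<^sub>R F x (?X x))) (at x within ?S)"
  proof (rule has_derivative_sequence[where f' = "\<lambda>n s h. h *\<^sub>R F s (picard F x0 n s)"])
    show "(picard F x0 (Suc n) has_derivative (\<lambda>h. h *\<^sub>R F x (picard F x0 n x))) (at x within ?S)" for n x
      using picard_derivative[of x0 n x]
      by (auto simp: has_vector_derivative_def intro: has_derivative_at_withinI simp del: picard.simps)
    show "(\<lambda>n. picard F x0 (Suc n) t) \<longlonglongrightarrow> ?X t"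
      by (rule LIMSEQ_Suc[OF picard_tendsto])
    fix e :: real assume "e > 0"
    then have "e / K > 0" using K_pos by simp
    with picard_uniform_limit[where T = T and ?x0.0 = x0]
    have "\<forall>\<^sub>F n in sequentially. \<forall>s\<in>{- T..T}. dist (picard F x0 n s) (?X s) < e / K"
      by (auto simp: uniform_limit_iff)
    then show "\<forall>\<^sub>F n in sequentially. \<forall>x\<in>?S. \<forall>h.
        norm (h *\<^sub>R F x (picard F x0 n x) - h *\<^sub>R F x (?X x)) \<le> e * norm h"
    proof (rule eventually_mono, intro ballI allI)
      fix n s and h :: real
      assume *: "\<forall>s\<in>{- T..T}. dist (picard F x0 n s) (?X s) < e / K" and s: "s \<in> ?S"
      have "norm (F s (picard F x0 n s) - F s (?X s)) \<le> K * norm (picard F x0 n s - ?X s)"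
        by (rule lip)
      also have "\<dots> \<le> K * (e / K)"
        using * s K_pos by (intro mult_left_mono) (auto simp: dist_norm intro: less_imp_le)
      finally have "norm (F s (picard F x0 n s) - F s (?X s)) \<le> e" using K_pos by simp
      then show "norm (h *\<^sub>R F s (picard F x0 n s) - h *\<^sub>R F s (?X s)) \<le> e * norm h"
        by (simp flip: scaleR_diff_right add: mult.commute[of e] mult_left_mono)
    qed
  qed (use t in auto)
  then obtain g where g: "\<And>x. x \<in> ?S \<Longrightarrow> (\<lambda>n. picard F x0 (Suc n) x) \<longlonglongrightarrow> g x"
    "\<And>x. x \<in> ?S \<Longrightarrow> (g has_derivative (\<lambda>h. h *\<^sub>R F x (?X x))) (at x within ?S)"
    by blast
  have gX: "g s = ?X s" if "s \<in> ?S" for s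
    using LIMSEQ_unique[OF g(1)[OF that] LIMSEQ_Suc[OF picard_tendsto]] .
  have "(g has_vector_derivative F t (?X t)) (at t within ?S)"
    using g(2)[OF t] by (simp add: has_vector_derivative_def)
  then have "(?X has_vector_derivative F t (?X t)) (at t within ?S)"
    by (rule has_vector_derivative_transform[OF t, rotated]) (auto simp: gX)
  then show ?thesis
    using t by (simp add: has_vector_derivative_within_open[of t ?S])
qed

lemma ex1_solution: "\<exists>!x. x 0 = x0 \<and> (\<forall>t. (x has_vector_derivative F t (x t)) (at t))"
proof (rule ex1I)
  show "lim (\<lambda>n. picard F x0 n 0) = x0 \<and> (\<forall>t. ((\<lambda>t. lim (\<lambda>n. picard F x0 n t)) has_vector_derivative
      F t (lim (\<lambda>n. picard F x0 n t))) (at t))"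
    using picard_lim_solves by (auto simp: picard_0)
next
  fix x assume x: "x 0 = x0 \<and> (\<forall>t. (x has_vector_derivative F t (x t)) (at t))"
  show "x = (\<lambda>t. lim (\<lambda>n. picard F x0 n t))"
  proof
    fix t
    have "norm (x t - lim (\<lambda>n. picard F x0 n t))
        \<le> exp (K * \<bar>t\<bar>) * norm (x 0 - lim (\<lambda>n. picard F x0 n 0))"
      by (rule lipschitz_flow_bound[where F = F]) (use x picard_lim_solves lip in auto)
    then show "x t = lim (\<lambda>n. picard F x0 n t)"
      using x by (simp add: picard_0)
  qed
qed

end

section \<open>Scalar equations on the negative half-line and slopes of curves\<close>

lemma abs_sin_diff_le: "\<bar>sin x - sin y\<bar> \<le> \<bar>x - y :: real\<bar>"
  using field_differentiable_bound[of UNIV sin cos 1 x y] by (auto intro!: derivative_eq_intros)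

lemma abs_cos_diff_le: "\<bar>cos x - cos y\<bar> \<le> \<bar>x - y :: real\<bar>"
  using field_differentiable_bound[of UNIV cos "\<lambda>x. - sin x" 1 x y]
  by (auto intro!: derivative_eq_intros)

text \<open>The divided difference of the sine, written as a mean of cosines: this form is defined
  and continuous also at a = b, is bounded by 1 and is Lipschitz in both end points.\<close>

definition sin_slope :: "real \<Rightarrow> real \<Rightarrow> real" where
  "sin_slope a b = integral {0..1} (\<lambda>\<theta>. cos (a + \<theta> * (b - a)))"

lemma cos_segment_integrable: "(\<lambda>\<theta>. cos (a + \<theta> * (b - a))) integrable_on {0..1::real}"
  by (intro integrable_continuous_real continuous_intros)

lemma sin_diff_eq_slope: "sin b - sin a = sin_slope a b * (b - a)"
proof -
  have "((\<lambda>\<theta>. (b - a) * cos (a + \<theta> * (b - a))) has_integral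
      sin (a + 1 * (b - a)) - sin (a + 0 * (b - a))) {0..1}"
    by (intro fundamental_theorem_of_calculus)
      (auto intro!: derivative_eq_intros simp: has_real_derivative_iff_has_vector_derivative[symmetric])
  from integral_unique[OF this] show ?thesis
    by (simp add: sin_slope_def mult.commute)
qed

lemma abs_sin_slope_le_1: "\<bar>sin_slope a b\<bar> \<le> 1"
  using integral_bound[of 0 1 "\<lambda>\<theta>. cos (a + \<theta> * (b - a))" 1]
  by (simp add: sin_slope_def continuous_intros)

lemma sin_slope_lipschitz: "\<bar>sin_slope a b - sin_slope a' b'\<bar> \<le> \<bar>a - a'\<bar> + \<bar>b - b'\<bar>"
proof -
  have "\<bar>cos (a + \<theta> * (b - a)) - cos (a' + \<theta> * (b' - a'))\<bar> \<le> \<bar>a - a'\<bar> + \<bar>b - b'\<bar>"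
    if "\<theta> \<in> {0..1}" for \<theta>
  proof -
    have "\<bar>cos (a + \<theta> * (b - a)) - cos (a' + \<theta> * (b' - a'))\<bar>
        \<le> \<bar>(1 - \<theta>) * (a - a') + \<theta> * (b - b')\<bar>"
      using abs_cos_diff_le[of "a + \<theta> * (b - a)" "a' + \<theta> * (b' - a')"] by (simp add: algebra_simps)
    also have "\<dots> \<le> (1 - \<theta>) * \<bar>a - a'\<bar> + \<theta> * \<bar>b - b'\<bar>"
      using that by (intro order_trans[OF abs_triangle_ineq]) (simp add: abs_mult)
    also have "\<dots> \<le> 1 * \<bar>a - a'\<bar> + 1 * \<bar>b - b'\<bar>"
      using that by (intro add_mono mult_right_mono) auto
    finally show ?thesis by simp
  qed
  then have "norm (integral {0..1} (\<lambda>\<theta>. cos (a + \<theta> * (b - a)) - cos (a' + \<theta> * (b' - a'))))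
      \<le> (\<bar>a - a'\<bar> + \<bar>b - b'\<bar>) * (1 - 0)"
    by (intro integral_bound) (auto intro!: continuous_intros)
  then show ?thesis
    by (simp add: sin_slope_def integral_diff[OF cos_segment_integrable cos_segment_integrable])
qed

lemma continuous_on_sin_slope:
  assumes "continuous_on S f" "continuous_on S g"
  shows "continuous_on S (\<lambda>x. sin_slope (f x) (g x))"
  unfolding continuous_on_def
proof
  fix x assume x: "x \<in> S"
  have "((\<lambda>y. \<bar>f y - f x\<bar> + \<bar>g y - g x\<bar>) \<longlongrightarrow> \<bar>f x - f x\<bar> + \<bar>g x - g x\<bar>) (at x within S)"
    using assms x by (intro tendsto_intros) (auto simp: continuous_on_def)
  then have "((\<lambda>y. \<bar>f y - f x\<bar> + \<bar>g y - g x\<bar>) \<longlongrightarrow> 0) (at x within S)" by simp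
  then have "((\<lambda>y. sin_slope (f y) (g y) - sin_slope (f x) (g x)) \<longlongrightarrow> 0) (at x within S)"
    by (rule Lim_null_comparison[rotated]) (simp add: sin_slope_lipschitz)
  then show "((\<lambda>y. sin_slope (f y) (g y)) \<longlongrightarrow> sin_slope (f x) (g x)) (at x within S)"
    by (simp add: LIM_zero_iff)
qed

section \<open>Linear scalar equations followed backward in time\<close>

lemma antiderivative_abs_le:
  fixes c :: "real \<Rightarrow> real"
  assumes "continuous_on UNIV c" "\<And>t. \<bar>c t\<bar> \<le> 1"
  obtains C where "\<And>t. (C has_real_derivative c t) (at t)" "C 0 = 0" "\<And>t. \<bar>C t\<bar> \<le> \<bar>t\<bar>"
proof -
  define C where "C t = (LBINT s=ereal 0..ereal t. c s)" for t
  have dC: "(C has_real_derivative c t) (at t)" for t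
    using LBINT_has_vector_derivative[OF assms(1)]
    by (simp add: C_def[abs_def] has_real_derivative_iff_has_vector_derivative)
  have C0: "C 0 = 0" by (simp add: C_def interval_integral_endpoints_same)
  have "\<bar>C t\<bar> \<le> \<bar>t\<bar>" for t
    using field_differentiable_bound[of UNIV C c 1 t 0] dC assms(2) C0 by auto
  with dC C0 show ?thesis by (rule that)
qed

text \<open>The integrating factor exp (k t + C t) reduces the equation to E' = exp (k t + C t) f.
  The growth condition at minus infinity forces E to vanish there and thereby excludes the
  homogeneous solutions; this is why no value of D enters the bound.\<close>

lemma backward_decay_bound:
  fixes D c f :: "real \<Rightarrow> real"
  assumes dD: "\<And>t. (D has_real_derivative - (k + c t) * D t + f t) (at t)"
    and c: "continuous_on UNIV c" "\<And>t. \<bar>c t\<bar> \<le> 1"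
    and f: "\<And>t. t \<le> 0 \<Longrightarrow> \<bar>f t\<bar> \<le> F * exp (- l * t)"
    and lim: "((\<lambda>t. exp ((k - 1) * t) * D t) \<longlongrightarrow> 0) at_bot"
    and l: "l < k - 1" and t: "t \<le> 0"
  shows "\<bar>D t\<bar> \<le> F / (k - 1 - l) * exp (- l * t)"
proof -
  obtain C where dC: "\<And>t. (C has_real_derivative c t) (at t)" and C0: "C 0 = 0"
    and C_le: "\<And>t. \<bar>C t\<bar> \<le> \<bar>t\<bar>"
    using antiderivative_abs_le[OF c] by blast
  have F: "F \<ge> 0" using f[of 0] by simp
  define A where "A = F / (k - 1 - l)"
  have A: "A \<ge> 0" "A * (k - 1 - l) = F" using F l by (auto simp: A_def)
  define E where "E t = exp (k * t + C t) * D t" for t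
  \<comment> \<open>G is the asserted bound times the integrating factor. For negative times its
    derivative dominates that of E, as A (k - 1 - l) = F and c is at least -1, so G + E and G - E
    are nondecreasing with limit 0 at minus infinity.\<close>
  define G where "G t = A * exp ((k - l) * t + C t)" for t
  have dE: "(E has_real_derivative exp (k * t + C t) * f t) (at t)" for t
    unfolding E_def by (rule derivative_eq_intros dD dC refl)+ (simp add: algebra_simps)
  have dG: "(G has_real_derivative A * (k - l + c t) * exp ((k - l) * t + C t)) (at t)" for t
    unfolding G_def by (rule derivative_eq_intros dD dC refl)+ (simp add: algebra_simps)
  have E_lim: "(E \<longlongrightarrow> 0) at_bot"
  proof (rule Lim_null_comparison[OF _ tendsto_norm_zero[OF lim]])
    show "\<forall>\<^sub>F t in at_bot. norm (E t) \<le> norm (exp ((k - 1) * t) * D t)"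
      using eventually_le_at_bot[of 0]
    proof eventually_elim
      case (elim t)
      then have "k * t + C t \<le> (k - 1) * t" using C_le[of t] by (simp add: algebra_simps)
      then show ?case by (auto simp: E_def abs_mult intro!: mult_right_mono)
    qed
  qed
  have G_lim: "(G \<longlongrightarrow> 0) at_bot"
  proof (rule Lim_null_comparison)
    show "\<forall>\<^sub>F t in at_bot. norm (G t) \<le> A * exp ((k - 1 - l) * t)"
      using eventually_le_at_bot[of 0]
    proof eventually_elim
      case (elim t)
      then have "(k - l) * t + C t \<le> (k - 1 - l) * t" using C_le[of t] by (simp add: algebra_simps)
      then show ?case using A(1) by (auto simp: G_def abs_mult intro!: mult_left_mono)
    qed
    have "k - 1 - l > 0" using l by simp
    then show "((\<lambda>t. A * exp ((k - 1 - l) * t)) \<longlongrightarrow> 0) at_bot" by real_asymp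
  qed
  have nonneg: "0 \<le> G t + \<sigma> * E t" if \<sigma>: "\<bar>\<sigma>\<bar> = 1" for \<sigma>
  proof -
    have mono: "G s + \<sigma> * E s \<le> G t + \<sigma> * E t" if "s \<le> t" for s
    proof (rule DERIV_nonneg_imp_nondecreasing[OF that, where f = "\<lambda>s. G s + \<sigma> * E s"])
      fix u assume u: "s \<le> u" "u \<le> t"
      have "\<bar>\<sigma> * (exp (k * u + C u) * f u)\<bar> \<le> exp (k * u + C u) * (F * exp (- l * u))"
        using f[of u] u t \<sigma> by (simp add: abs_mult)
      also have "\<dots> = A * (k - l - 1) * exp ((k - l) * u + C u)"
        using A(2) by (simp add: algebra_simps flip: exp_add)
      also have "\<dots> \<le> A * (k - l + c u) * exp ((k - l) * u + C u)"
        using c(2)[of u] A(1) by (intro mult_right_mono mult_left_mono) auto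
      finally have "0 \<le> A * (k - l + c u) * exp ((k - l) * u + C u) + \<sigma> * (exp (k * u + C u) * f u)"
        by linarith
      moreover have "((\<lambda>s. G s + \<sigma> * E s) has_real_derivative
          A * (k - l + c u) * exp ((k - l) * u + C u) + \<sigma> * (exp (k * u + C u) * f u)) (at u)"
        by (intro DERIV_add DERIV_cmult dE dG)
      ultimately show "\<exists>y. ((\<lambda>s. G s + \<sigma> * E s) has_real_derivative y) (at u) \<and> 0 \<le> y"
        by blast
    qed
    have "((\<lambda>s. G s + \<sigma> * E s) \<longlongrightarrow> 0 + \<sigma> * 0) at_bot"
      by (intro tendsto_intros E_lim G_lim)
    then show ?thesis
      using tendsto_upperbound[of "\<lambda>s. G s + \<sigma> * E s" 0 at_bot "G t + \<sigma> * E t"]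
        eventually_mono[OF eventually_le_at_bot[of t] mono] by simp
  qed
  have "\<bar>E t\<bar> \<le> G t"
    using nonneg[of 1] nonneg[of "- 1"] by simp
  then have "exp (k * t + C t) * \<bar>D t\<bar> \<le> exp (k * t + C t) * (A * exp (- l * t))"
    by (simp add: E_def G_def abs_mult algebra_simps flip: exp_add)
  then show ?thesis unfolding A_def[symmetric] by (rule mult_left_le_imp_le) simp
qed

text \<open>The undamped analogue for the head of the chain: backward growth has rate at most 1, and
  the value at 0 has to be kept. The forcing is allowed the rate 2, one more than the homogeneous
  growth, so it contributes with the constant F itself.\<close>

lemma backward_growth_bound:
  fixes D c f :: "real \<Rightarrow> real"
  assumes dD: "\<And>t. (D has_real_derivative - c t * D t + f t) (at t)"
    and c: "continuous_on UNIV c" "\<And>t. \<bar>c t\<bar> \<le> 1"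
    and f: "\<And>t. t \<le> 0 \<Longrightarrow> \<bar>f t\<bar> \<le> F * exp (- 2 * t)"
    and t: "t \<le> 0"
  shows "\<bar>D t\<bar> \<le> \<bar>D 0\<bar> * exp (- t) + F * exp (- 2 * t)"
proof (cases "t = 0")
  case True
  then show ?thesis using f[of 0] by simp
next
  case False
  obtain C where dC: "\<And>t. (C has_real_derivative c t) (at t)" and C0: "C 0 = 0"
    and C_le: "\<And>t. \<bar>C t\<bar> \<le> \<bar>t\<bar>"
    using antiderivative_abs_le[OF c] by blast
  have F: "F \<ge> 0" using f[of 0] by simp
  define E where "E t = exp (C t) * D t" for t
  define G where "G t = - F * exp (C t - 2 * t)" for t
  have dE: "(E has_real_derivative exp (C t) * f t) (at t)" for t
    unfolding E_def by (rule derivative_eq_intros dD dC refl)+ (simp add: algebra_simps)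
  have dG: "(G has_real_derivative F * (2 - c t) * exp (C t - 2 * t)) (at t)" for t
    unfolding G_def by (rule derivative_eq_intros dD dC refl)+ (simp add: algebra_simps)
  have "norm (E 0 - E t) \<le> G 0 - G t"
  proof (rule differentiable_bound_general)
    show "(E has_vector_derivative exp (C t) * f t) (at t)" for t
      using dE by (simp add: has_real_derivative_iff_has_vector_derivative)
    show "(G has_vector_derivative F * (2 - c t) * exp (C t - 2 * t)) (at t)" for t
      using dG by (simp add: has_real_derivative_iff_has_vector_derivative)
    show "continuous_on {t..0} E" "continuous_on {t..0} G"
      using dE dG by (auto intro!: continuous_at_imp_continuous_on DERIV_isCont)
    fix u assume u: "t < u" "u < 0"
    have "norm (exp (C u) * f u) \<le> exp (C u) * (F * exp (- 2 * u))"
      using f[of u] u by (simp add: abs_mult)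
    also have "\<dots> = F * 1 * exp (C u - 2 * u)" by (simp add: exp_diff exp_minus divide_inverse)
    also have "\<dots> \<le> F * (2 - c u) * exp (C u - 2 * u)"
      using c(2)[of u] F by (intro mult_right_mono mult_left_mono) auto
    finally show "norm (exp (C u) * f u) \<le> F * (2 - c u) * exp (C u - 2 * u)" .
  qed (use False t in auto)
  then have "\<bar>E t\<bar> \<le> \<bar>D 0\<bar> + F * exp (C t - 2 * t)"
    using F C0 by (simp add: E_def G_def)
  then have "exp (- C t) * (exp (C t) * \<bar>D t\<bar>) \<le> exp (- C t) * (\<bar>D 0\<bar> + F * exp (C t - 2 * t))"
    by (intro mult_left_mono) (auto simp: E_def abs_mult)
  also have "\<dots> = exp (- C t) * \<bar>D 0\<bar> + F * exp (- 2 * t)"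
    by (simp add: distrib_left flip: exp_add)
  also have "exp (- C t) * \<bar>D 0\<bar> \<le> exp (- t) * \<bar>D 0\<bar>"
    using C_le[of t] t by (intro mult_right_mono) auto
  finally have "exp (- C t) * (exp (C t) * \<bar>D t\<bar>) \<le> exp (- t) * \<bar>D 0\<bar> + F * exp (- 2 * t)"
    by simp
  moreover have cancel: "exp (- C t) * (exp (C t) * \<bar>D t\<bar>) = \<bar>D t\<bar>"
    by (simp add: exp_minus)
  ultimately show ?thesis unfolding cancel by (simp add: mult.commute)
qed

text \<open>The hypothesis says that the divided difference is Lipschitz off the diagonal, jointly
  in both points. It therefore extends to the diagonal; the extension is the derivative and inherits
  Lipschitz continuity.\<close>

lemma C1_of_lipschitz_slopes:
  fixes g :: "real \<Rightarrow> 'b::banach"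
  assumes slopes: "\<And>s s' u u'. s \<noteq> s' \<Longrightarrow> u \<noteq> u' \<Longrightarrow>
    norm ((1 / (s' - s)) *\<^sub>R (g s' - g s) - (1 / (u' - u)) *\<^sub>R (g u' - g u)) \<le> L * (\<bar>s - u\<bar> + \<bar>s' - u'\<bar>)"
  obtains g' where "\<And>s. (g has_vector_derivative g' s) (at s)" "continuous_on UNIV g'"
proof -
  define q where "q s s' = (1 / (s' - s)) *\<^sub>R (g s' - g s)" for s s'
  define h where "h n = inverse (real (Suc n))" for n
  have h: "h n \<noteq> 0" "h \<longlonglongrightarrow> 0" for n
    unfolding h_def[abs_def] using LIMSEQ_inverse_real_of_nat by auto
  have L: "L \<ge> 0"
    using order_trans[OF norm_ge_zero slopes[of 0 1 0 2]] by simp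
  have "Cauchy (\<lambda>n. q s (s + h n))" for s
  proof (rule metric_CauchyI)
    fix e :: real assume e: "e > 0"
    have "Cauchy h" using h(2) by (rule LIMSEQ_imp_Cauchy)
    moreover have "e / (L + 1) > 0" using e L by simp
    ultimately obtain N where N: "\<And>m n. m \<ge> N \<Longrightarrow> n \<ge> N \<Longrightarrow> dist (h m) (h n) < e / (L + 1)"
      by (meson metric_CauchyD)
    have "dist (q s (s + h m)) (q s (s + h n)) < e" if "m \<ge> N" "n \<ge> N" for m n
    proof -
      have "dist (q s (s + h m)) (q s (s + h n)) \<le> L * \<bar>h m - h n\<bar>"
        using slopes[of s "s + h m" s "s + h n"] h by (simp add: q_def dist_norm)
      also have "\<dots> \<le> L * (e / (L + 1))"
        using N[OF that] L by (intro mult_left_mono) (auto simp: dist_real_def)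
      also have "\<dots> < e" using e L by (simp add: field_simps)
      finally show ?thesis .
    qed
    then show "\<exists>M. \<forall>m\<ge>M. \<forall>n\<ge>M. dist (q s (s + h m)) (q s (s + h n)) < e" by blast
  qed
  then have "\<exists>l. (\<lambda>n. q s (s + h n)) \<longlonglongrightarrow> l" for s
    by (simp add: Cauchy_convergent_iff convergent_def)
  then obtain g' where g': "\<And>s. (\<lambda>n. q s (s + h n)) \<longlonglongrightarrow> g' s" by metis
  have q_g': "norm (q s s' - g' s) \<le> L * \<bar>s' - s\<bar>" if "s' \<noteq> s" for s s'
  proof (rule LIMSEQ_le)
    show "(\<lambda>n. norm (q s s' - q s (s + h n))) \<longlonglongrightarrow> norm (q s s' - g' s)"
      by (intro tendsto_intros g')
    show "(\<lambda>n. L * (\<bar>s' - s - h n\<bar>)) \<longlonglongrightarrow> L * \<bar>s' - s\<bar>"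
      using h(2) by (auto intro!: tendsto_eq_intros)
    show "\<exists>N. \<forall>n\<ge>N. norm (q s s' - q s (s + h n)) \<le> L * \<bar>s' - s - h n\<bar>"
      using slopes[of s s' s "s + h _"] h(1) that by (auto simp: q_def algebra_simps)
  qed
  have "(g has_vector_derivative g' s) (at s)" for s
    unfolding has_vector_derivative_def
  proof (rule has_derivativeI_sandwich[where e = 1 and H = "\<lambda>s'. L * \<bar>s' - s\<bar>"])
    fix s' assume s': "s' \<noteq> s"
    then have "g s' - g s - (s' - s) *\<^sub>R g' s = (s' - s) *\<^sub>R (q s s' - g' s)"
      by (simp add: q_def scaleR_diff_right)
    then show "norm (g s' - g s - (s' - s) *\<^sub>R g' s) / norm (s' - s) \<le> L * \<bar>s' - s\<bar>"
      using q_g'[OF s'] s' by simp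
  qed (auto intro!: tendsto_eq_intros bounded_linear_intros)
  moreover have "continuous_on UNIV g'"
  proof (rule lipschitz_on_continuous_on)
    show "(2 * L)-lipschitz_on UNIV g'"
    proof (rule lipschitz_onI)
      fix s u
      show "dist (g' s) (g' u) \<le> 2 * L * dist s u"
      proof (rule LIMSEQ_le_const2)
        show "(\<lambda>n. dist (q s (s + h n)) (q u (u + h n))) \<longlonglongrightarrow> dist (g' s) (g' u)"
          by (intro tendsto_intros g')
        have "dist (q s (s + h n)) (q u (u + h n)) \<le> 2 * L * dist s u" for n
          using slopes[of s "s + h n" u "u + h n"] h(1)[of n] by (simp add: q_def dist_norm)
        then show "\<exists>N. \<forall>n\<ge>N. dist (q s (s + h n)) (q u (u + h n)) \<le> 2 * L * dist s u"
          by blast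
      qed
    qed (use L in auto)
  qed
  ultimately show ?thesis by (rule that)
qed

section \<open>The phase space and closed curves in it\<close>

lemma dist_proj_le: "dist (proj x) (proj y) \<le> norm (x - y)"
  using dist_mod_le[of x y 0] unfolding dist_proj dist_mod_def by (simp add: vec_eq_iff)

text \<open>Closeness in M lifts: the strict inequality selects a deck translate within distance d,
  whether or not the infimum is attained.\<close>

lemma dist_proj_lessE:
  assumes "dist (proj x) q < d"
  obtains y where "proj y = q" "norm (x - y) < d"
proof -
  have "dist_mod x (rep_phase q) < d"
    using assms dist_proj[of x "rep_phase q"] by (simp add: dist_mod_def)
  then obtain m :: int where m: "norm (x - rep_phase q - vec (2 * pi * of_int m)) < d"
    by (rule dist_mod_less)
  have "proj (rep_phase q + vec (2 * pi * of_int m)) = proj (rep_phase q)"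
    unfolding proj_eq_iff by (intro exI[of _ m]) simp
  with m show ?thesis
    by (intro that[of "rep_phase q + vec (2 * pi * of_int m)"]) (auto simp: diff_diff_add)
qed

lemma proj_add_deck [simp]: "proj (x + vec (2 * pi * of_int m)) = proj x"
  unfolding proj_eq_iff by (intro exI[of _ m]) simp

lemma continuous_on_proj [continuous_intros]:
  assumes "continuous_on S f" shows "continuous_on S (\<lambda>x. proj (f x))"
proof -
  have "continuous_on UNIV (proj :: real ^ 'n \<Rightarrow> _)"
    unfolding continuous_on_iff by (metis dist_norm dist_proj_le le_less_trans)
  from continuous_on_compose2[OF this assms] show ?thesis by simp
qed

lemma continuous_on_from_phase:
  fixes g :: "'n::finite phase \<Rightarrow> 'b::metric_space"
  assumes "continuous_on UNIV (\<lambda>x. g (proj x))" shows "continuous_on UNIV g"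
  unfolding continuous_on_iff
proof (intro ballI allI impI)
  fix p :: "'n phase" and e :: real assume e: "e > 0"
  let ?x = "rep_phase p"
  obtain d where d: "d > 0" "\<And>y. dist y ?x < d \<Longrightarrow> dist (g (proj y)) (g (proj ?x)) < e"
    using assms e unfolding continuous_on_iff by blast
  have "dist (g q) (g p) < e" if "dist q p < d" for q
  proof -
    have "dist (proj ?x) q < d" using that by (simp add: dist_commute)
    then obtain y where "proj y = q" "norm (?x - y) < d" by (rule dist_proj_lessE)
    then show ?thesis using d(2)[of y] by (simp add: dist_norm norm_minus_commute)
  qed
  with d(1) show "\<exists>d>0. \<forall>q\<in>UNIV. dist q p < d \<longrightarrow> dist (g q) (g p) < e" by blast
qed

text \<open>Points of a unit ball differ by less than 2 in each component, while a nontrivial deck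
  translation moves every component by at least 2 pi. Unit balls thus serve as chart
  domains.\<close>

lemma inj_on_proj_ball: "inj_on proj (ball (x :: real ^ 'n::finite) 1)"
proof (rule inj_onI)
  fix y z assume yz: "y \<in> ball x 1" "z \<in> ball x 1" "proj y = proj z"
  then obtain m :: int where m: "y - z = vec (2 * pi * of_int m)" by (auto simp: proj_eq_iff)
  have "dist y z < 2"
    using yz(1,2) dist_triangle3[of y z x] by simp
  moreover have "\<bar>2 * pi * of_int m\<bar> \<le> norm (y - z)"
    using component_le_norm_cart[of "y - z" undefined] m by simp
  ultimately have "2 * pi * \<bar>of_int m :: real\<bar> < 2"
    by (simp add: dist_norm abs_mult)
  then have "\<not> 2 * pi * 1 \<le> 2 * pi * \<bar>of_int m :: real\<bar>"
    using pi_gt3 by linarith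
  then have "\<not> 1 \<le> \<bar>of_int m :: real\<bar>"
    by (metis mult_left_mono pi_ge_zero zero_le_mult_iff zero_le_numeral)
  then have "m = 0" by linarith
  then show "y = z" using m by (simp add: vec_eq_iff)
qed

text \<open>Each class meets the slab where a chosen component lies in [0, 2 pi]; this reduces deck
  invariant statements to sets on which compactness is available.\<close>

lemma proj_representative:
  fixes x :: "real ^ 'n::finite"
  obtains y and m :: int where
    "y = x + vec (2 * pi * of_int m)" "0 \<le> y $ i" "y $ i \<le> 2 * pi"
proof -
  define m where "m = \<lfloor>x $ i / (2 * pi)\<rfloor>"
  have "of_int m \<le> x $ i / (2 * pi)" "x $ i / (2 * pi) \<le> of_int m + 1"
    unfolding m_def by linarith+
  then have "of_int m * (2 * pi) \<le> x $ i" "x $ i \<le> (of_int m + 1) * (2 * pi)"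
    by (simp_all only: pos_le_divide_eq pos_divide_le_eq pi_gt_zero zero_less_mult_iff zero_less_numeral simp_thms)
  then show ?thesis
    by (intro that[of "x + vec (2 * pi * of_int (- m))" "- m"]) (simp_all add: algebra_simps)
qed

text \<open>Such maps straighten a graph over one coordinate. The derivative is the identity plus an
  operator of rank at most one, and in finite dimension its continuity may be checked on basis
  vectors.\<close>

lemma C1_on_shear:
  fixes \<beta> :: "real \<Rightarrow> 'n::finite rvec"
  assumes d\<beta>: "\<And>s. (\<beta> has_vector_derivative \<beta>' s) (at s)" and cont: "continuous_on UNIV \<beta>'"
  shows "C1_on (\<lambda>y. y + \<beta> (y $ i)) S"
  unfolding C1_on_def
proof (intro exI conjI ballI)
  let ?f' = "\<lambda>y :: 'n rvec. Blinfun (\<lambda>v. v + (v $ i) *\<^sub>R \<beta>' (y $ i))"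
  have bl: "bounded_linear (\<lambda>v :: 'n rvec. v + (v $ i) *\<^sub>R \<beta>' (y $ i))" for y
    by (intro bounded_linear_add bounded_linear_ident bounded_linear_scaleR_const bounded_linear_vec_nth)
  fix x :: "'n rvec"
  have "((\<lambda>y. \<beta> (y $ i)) has_derivative (\<lambda>v. (v $ i) *\<^sub>R \<beta>' (x $ i))) (at x)"
    using diff_chain_at[OF bounded_linear.has_derivative[OF bounded_linear_vec_nth has_derivative_ident]
        d\<beta>[of "x $ i", unfolded has_vector_derivative_def]]
    by (simp add: o_def)
  then show "((\<lambda>y. y + \<beta> (y $ i)) has_derivative blinfun_apply (?f' x)) (at x)"
    unfolding bounded_linear_Blinfun_apply[OF bl] by (intro has_derivative_add has_derivative_ident)
next
  have bl: "bounded_linear (\<lambda>v :: 'n rvec. v + (v $ i) *\<^sub>R \<beta>' (y $ i))" for y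
    by (intro bounded_linear_add bounded_linear_ident bounded_linear_scaleR_const bounded_linear_vec_nth)
  have "continuous_on S (\<lambda>y. \<beta>' (y $ i))"
    by (rule continuous_on_compose2[OF cont]) (auto intro!: continuous_intros)
  then show "continuous_on S (\<lambda>y :: 'n rvec. Blinfun (\<lambda>v. v + (v $ i) *\<^sub>R \<beta>' (y $ i)))"
    by (intro continuous_on_blinfun_componentwise)
      (auto simp: bounded_linear_Blinfun_apply[OF bl] intro!: continuous_intros)
qed

text \<open>A graph over the first component that is equivariant under the generator of the deck
  group; its image in M therefore closes up after one period.\<close>

locale periodic_curve =
  fixes \<gamma> \<gamma>' :: "real \<Rightarrow> 'n::{finite,linorder} rvec"
  assumes deriv: "(\<gamma> has_vector_derivative \<gamma>' s) (at s)"
    and cont': "continuous_on UNIV \<gamma>'"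
    and idx1: "\<gamma> s $ idx1 = s"
    and periodic: "\<gamma> (s + 2 * pi) = \<gamma> s + vec (2 * pi)"
begin

lemma deck: "\<gamma> (s + 2 * pi * of_int m) = \<gamma> s + vec (2 * pi * of_int m)"
proof (induction m arbitrary: s rule: int_induct[where k = 0])
  case (step1 i)
  have "\<gamma> (s + 2 * pi * of_int (i + 1)) = \<gamma> ((s + 2 * pi * of_int i) + 2 * pi)"
    by (simp add: algebra_simps)
  then show ?case unfolding periodic step1.IH by (simp add: vec_eq_iff algebra_simps)
next
  case (step2 i)
  have "\<gamma> ((s + 2 * pi * of_int (i - 1)) + 2 * pi) = \<gamma> (s + 2 * pi * of_int i)"
    by (simp add: algebra_simps)
  then show ?case unfolding periodic step2.IH by (simp add: vec_eq_iff algebra_simps)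
qed (simp add: vec_eq_iff)

text \<open>Equivariance makes the graph invariant under all deck translations, so the preimage of
  the projected curve is the graph itself. No further sheet has to be avoided in a chart.\<close>

lemma proj_mem_iff: "proj x \<in> proj ` range \<gamma> \<longleftrightarrow> x = \<gamma> (x $ idx1)"
proof
  assume "proj x \<in> proj ` range \<gamma>"
  then obtain s and m :: int where "x - \<gamma> s = vec (2 * pi * of_int m)"
    by (auto simp: proj_eq_iff)
  then have "x = \<gamma> (s + 2 * pi * of_int m)" unfolding deck by (simp add: diff_eq_eq add.commute)
  then show "x = \<gamma> (x $ idx1)" using idx1 by metis
next
  assume "x = \<gamma> (x $ idx1)"
  then have "x \<in> range \<gamma>" by (rule range_eqI)
  then show "proj x \<in> proj ` range \<gamma>" by (rule imageI)
qed

lemma submanifold: "C1_submanifold_1 (proj ` range \<gamma>)"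
  unfolding C1_submanifold_1_def
proof (intro allI impI)
  fix x :: "'n rvec"
  \<comment> \<open>The offset of the curve from the first axis. Its first component is 0, so the
    shears by -\<beta> and \<beta> leave that component alone and are inverse to each other; the
    shear by -\<beta> maps the graph onto the axis.\<close>
  define \<beta> where "\<beta> s = \<gamma> s - axis idx1 s" for s
  have axis_deriv: "((\<lambda>s. axis idx1 s :: 'n rvec) has_vector_derivative axis idx1 1) (at s)" for s
  proof -
    have "((\<lambda>s. s *\<^sub>R axis idx1 1 :: 'n rvec) has_vector_derivative axis idx1 1) (at s)"
      by (auto intro!: derivative_eq_intros)
    moreover have "(\<lambda>s. s *\<^sub>R axis idx1 1 :: 'n rvec) = axis idx1"
      by (auto simp: axis_def vec_eq_iff)
    ultimately show ?thesis by simp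
  qed
  have d\<beta>: "(\<beta> has_vector_derivative (\<gamma>' s - axis idx1 1)) (at s)" for s
    unfolding \<beta>_def by (intro has_vector_derivative_diff deriv axis_deriv)
  have \<beta>0: "\<beta> s $ idx1 = 0" for s by (simp add: \<beta>_def idx1 axis_def)
  define h where "h y = y + - \<beta> (y $ idx1)" for y
  define g where "g w = w + \<beta> (w $ idx1)" for w
  have [simp]: "h y $ idx1 = y $ idx1" "g y $ idx1 = y $ idx1" for y by (auto simp: h_def g_def \<beta>0)
  have gh [simp]: "g (h y) = y" "h (g y) = y" for y
    unfolding g_def[of "h y"] h_def[of "g y"] by (simp_all, simp_all add: g_def h_def)
  have C1: "C1_on h S" "C1_on g S" for S
    unfolding h_def[abs_def] g_def[abs_def]
    by (rule C1_on_shear[OF has_vector_derivative_minus[OF d\<beta>]] C1_on_shear[OF d\<beta>];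
        intro continuous_intros cont')+
  have cont: "continuous_on S h" "continuous_on S g" for S
  proof -
    have "continuous_on S f" if "C1_on f S" for f :: "'n rvec \<Rightarrow> 'n rvec"
      using that unfolding C1_on_def
      by (meson continuous_at_imp_continuous_on has_derivative_continuous)
    with C1 show "continuous_on S h" "continuous_on S g" by blast+
  qed
  define V where "V = ball x 1"
  define W where "W = g -` V"
  have "open W"
    unfolding W_def V_def using cont(2)[of UNIV] by (intro open_vimage) auto
  moreover have "homeomorphism V W h g"
  proof (rule homeomorphismI)
    show "h ` V \<subseteq> W" "g ` W \<subseteq> V" by (simp_all add: W_def image_subset_iff)
  qed (simp_all add: cont)
  moreover have "h ` (V \<inter> proj -` (proj ` range \<gamma>)) = W \<inter> {y. \<forall>i. i \<noteq> idx1 \<longrightarrow> y $ i = 0}"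
  proof (intro equalityI subsetI)
    fix w assume "w \<in> h ` (V \<inter> proj -` (proj ` range \<gamma>))"
    then obtain y where y: "w = h y" "y \<in> V" "proj y \<in> proj ` range \<gamma>"
      by blast
    then have y\<gamma>: "\<gamma> (y $ idx1) = y" using proj_mem_iff by metis
    have "w = axis idx1 (y $ idx1)"
      by (simp add: y(1) h_def \<beta>_def y\<gamma>)
    then have "\<forall>i. i \<noteq> idx1 \<longrightarrow> w $ i = 0" by (simp add: axis_def)
    moreover have "w \<in> W" using y(1,2) by (simp add: W_def)
    ultimately show "w \<in> W \<inter> {y. \<forall>i. i \<noteq> idx1 \<longrightarrow> y $ i = 0}" by blast
  next
    fix w assume w: "w \<in> W \<inter> {y. \<forall>i. i \<noteq> idx1 \<longrightarrow> y $ i = 0}"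
    then have axis: "axis idx1 (w $ idx1) = w" by (auto simp: vec_eq_iff axis_def)
    then have "g w = \<gamma> (g w $ idx1)" by (simp add: \<beta>_def, simp add: g_def \<beta>_def axis)
    then have "proj (g w) \<in> proj ` range \<gamma>" using proj_mem_iff by blast
    moreover have "g w \<in> V" using w by (simp add: W_def)
    ultimately have "g w \<in> V \<inter> proj -` (proj ` range \<gamma>)" by blast
    from imageI[OF this, of h] show "w \<in> h ` (V \<inter> proj -` (proj ` range \<gamma>))" by (simp only: gh)
  qed
  moreover have "open V" "x \<in> V" "inj_on proj V"
    using inj_on_proj_ball by (auto simp: V_def)
  ultimately have "open V \<and> x \<in> V \<and> inj_on proj V \<and> open W \<and>
      homeomorphism V W h g \<and> C1_on h V \<and> C1_on g W \<and>
      h ` (V \<inter> proj -` (proj ` range \<gamma>)) = W \<inter> {y. \<forall>i. i \<noteq> idx1 \<longrightarrow> y $ i = 0}"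
    using C1 by blast
  then show "\<exists>V (W :: 'n rvec set) h g. open V \<and> x \<in> V \<and> inj_on proj V \<and> open W \<and>
      homeomorphism V W h g \<and> C1_on h V \<and> C1_on g W \<and>
      h ` (V \<inter> proj -` (proj ` range \<gamma>)) = W \<inter> {y. \<forall>i. i \<noteq> idx1 \<longrightarrow> y $ i = 0}"
    by (intro exI)
qed

text \<open>The angle \<open>cis\<close> of the first component is unchanged by deck translations
  and so descends to M. On the compact curve it is a continuous bijection onto the circle.\<close>

lemma homeomorphic_circle: "proj ` range \<gamma> homeomorphic sphere (0::complex) 1"
proof -
  define c where "c p = cis (rep_phase p $ idx1)" for p :: "'n phase"
  have c: "c (proj x) = cis (x $ idx1)" for x :: "'n rvec"
  proof -
    have "proj (rep_phase (proj x)) = proj x" by simp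
    then obtain m :: int where m: "rep_phase (proj x) - x = vec (2 * pi * of_int m)"
      unfolding proj_eq_iff by blast
    have "rep_phase (proj x) $ idx1 = x $ idx1 + 2 * pi * of_int m"
      using arg_cong[OF m, of "\<lambda>v. v $ idx1"] by simp
    then show ?thesis by (simp add: c_def flip: cis_mult)
  qed
  have c\<gamma>: "c (proj (\<gamma> s)) = cis s" for s by (simp add: c idx1)
  have cont_c: "continuous_on UNIV c"
    by (rule continuous_on_from_phase) (auto simp: c intro!: continuous_intros)
  have "continuous_on {0..2 * pi} \<gamma>"
    by (intro continuous_at_imp_continuous_on ballI has_vector_derivative_continuous[OF deriv])
  then have "compact (proj ` \<gamma> ` {0..2 * pi})"
    by (intro compact_continuous_image continuous_intros) auto
  moreover have "proj ` \<gamma> ` {0..2 * pi} = proj ` range \<gamma>"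
  proof (intro equalityI subsetI)
    fix p assume "p \<in> proj ` range \<gamma>"
    then obtain s where s: "p = proj (\<gamma> s)" by auto
    obtain y and m :: int where y: "y = \<gamma> s + vec (2 * pi * of_int m)"
      "0 \<le> y $ idx1" "y $ idx1 \<le> 2 * pi"
      using proj_representative[of "\<gamma> s" idx1] by blast
    then have "y = \<gamma> (s + 2 * pi * of_int m)" by (simp add: deck)
    then have "y = \<gamma> (y $ idx1)" using idx1 by metis
    moreover have "p = proj y" using y(1) s by simp
    ultimately show "p \<in> proj ` \<gamma> ` {0..2 * pi}"
      using y(2,3) imageI[of "y $ idx1" "{0..2 * pi}" \<gamma>] by (simp add: image_iff) metis
  qed auto
  ultimately have compact: "compact (proj ` range \<gamma>)" by simp
  have "c ` (proj ` range \<gamma>) = sphere 0 1"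
  proof (intro equalityI subsetI)
    fix z :: complex assume "z \<in> sphere 0 1"
    then have "z = cis (Arg z)" using rcis_cmod_Arg[of z] by (simp add: rcis_def)
    then have "z = c (proj (\<gamma> (Arg z)))" by (simp add: c\<gamma>)
    then show "z \<in> c ` (proj ` range \<gamma>)" by blast
  qed (auto simp: c\<gamma>)
  moreover have "inj_on c (proj ` range \<gamma>)"
  proof (rule inj_onI)
    fix p q assume "p \<in> proj ` range \<gamma>" "q \<in> proj ` range \<gamma>" and eq: "c p = c q"
    then obtain s t where st: "p = proj (\<gamma> s)" "q = proj (\<gamma> t)" by auto
    then have "sin s = sin t \<and> cos s = cos t" using eq by (simp add: c\<gamma> complex_eq_iff)
    then obtain m :: int where "s = t + 2 * pi * of_int m"
      unfolding sin_cos_eq_iff by (auto simp: mult_ac)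
    then show "p = q" using st by (simp add: deck)
  qed
  ultimately show ?thesis
    by (intro homeomorphic_compact[OF compact continuous_on_subset[OF cont_c]]) auto
qed

theorem closed_curve: "C1_closed_curve (proj ` range \<gamma>)"
  using submanifold homeomorphic_circle by (simp add: C1_closed_curve_def)

end

section \<open>The energy of the chain\<close>

definition depth :: "'n::{finite,linorder} \<Rightarrow> nat" where
  "depth i = card {j. j < i}"

lemma idx1_le: "idx1 \<le> (i :: 'n::{finite,linorder})"
  by (rule Min_le) auto

lemma idx_pred_less: "i \<noteq> idx1 \<Longrightarrow> idx_pred i < (i :: 'n::{finite,linorder})"
  unfolding idx_pred_def
  using Max_in[of "{j. j < i}"] idx1_le[of i] by (metis (mono_tags) empty_iff finite mem_Collect_eq order_le_less)

lemma less_iff_le_idx_pred: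
  assumes "i \<noteq> idx1" shows "j < i \<longleftrightarrow> j \<le> idx_pred (i :: 'n::{finite,linorder})"
  using idx_pred_less[OF assms] Max_ge[of "{j. j < i}" j] by (auto simp: idx_pred_def)

lemma depth_idx_pred: "i \<noteq> idx1 \<Longrightarrow> depth i = Suc (depth (idx_pred i))"
proof -
  assume "i \<noteq> idx1"
  then have "{j. j < i} = insert (idx_pred i) {j. j < idx_pred i}"
    by (auto simp: less_iff_le_idx_pred)
  then show ?thesis by (simp add: depth_def)
qed

lemma chain_induct [case_names idx1 pred]:
  assumes "P idx1" "\<And>i. i \<noteq> idx1 \<Longrightarrow> P (idx_pred i) \<Longrightarrow> P i"
  shows "P (i :: 'n::{finite,linorder})"
proof (induction i rule: measure_induct_rule[of depth])
  case (less i)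
  then show ?case using assms depth_idx_pred[of i] by (cases "i = idx1") auto
qed

lemma inj_on_idx_pred: "inj_on idx_pred (- {idx1 :: 'n::{finite,linorder}})"
proof (rule inj_onI)
  fix i j :: 'n assume ij: "i \<in> - {idx1}" "j \<in> - {idx1}" "idx_pred i = idx_pred j"
  then have "l < i \<longleftrightarrow> l < j" for l by (simp add: less_iff_le_idx_pred)
  then show "i = j" by (meson less_irrefl linorder_neqE)
qed

text \<open>Up to sign this is the coupling matrix applied to x, with the entry 0 at the head, where
  the matrix has a zero row. The gaps vanish together exactly on the multiples of
  \<open>vec 1\<close>.\<close>

definition gap :: "'n::{finite,linorder} rvec \<Rightarrow> 'n \<Rightarrow> real" where
  "gap x i = (if i = idx1 then 0 else x $ i - x $ idx_pred i)"

text \<open>A squared seminorm with kernel the multiples of \<open>vec 1\<close>. The factor 1/4 per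
  step makes the weight of a gap small against the weight of the gap that drives it.\<close>

definition energy :: "'n::{finite,linorder} rvec \<Rightarrow> real" where
  "energy x = (\<Sum>i\<in>UNIV. (1/4) ^ depth i * (gap x i)\<^sup>2)"

lemma gap_linear [simp]:
  "gap (x + y) i = gap x i + gap y i" "gap (x - y) i = gap x i - gap y i"
  "gap (c *\<^sub>R x) i = c * gap x i" "gap (vec s) i = 0" "gap 0 i = 0"
  by (auto simp: gap_def algebra_simps)

lemma chain_matrix_mult: "(chain_matrix *v x) $ i = - gap x i"
proof -
  have "(chain_matrix *v x) $ i =
      (\<Sum>j\<in>UNIV. if i = idx1 then 0 else if j = i then - x $ j else if j = idx_pred i then x $ j else 0)"
    unfolding matrix_vector_mult_def chain_matrix_def by (auto intro!: sum.cong)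
  also have "\<dots> = - gap x i"
  proof (cases "i = idx1")
    case False
    have "(\<Sum>j\<in>UNIV. if j = i then - x $ j else if j = idx_pred i then x $ j else 0)
        = (\<Sum>j\<in>UNIV. (if j = i then - x $ j else 0) + (if j = idx_pred i then x $ j else 0))"
      using idx_pred_less[OF False] by (intro sum.cong) auto
    also have "\<dots> = - x $ i + x $ idx_pred i" by (simp add: sum.distrib)
    finally show ?thesis using False by (simp add: gap_def)
  qed (simp add: gap_def)
  finally show ?thesis .
qed

lemma energy_nonneg: "0 \<le> energy x"
  unfolding energy_def by (intro sum_nonneg) auto

lemma energy_add_vec [simp]: "energy (x + vec s) = energy x" "energy (vec s) = 0"
  by (simp_all add: energy_def)

lemma energy_scaleR: "energy (c *\<^sub>R x) = c\<^sup>2 * energy x"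
  by (simp add: energy_def power_mult_distrib sum_distrib_left mult_ac)

lemma energy_add_le: "energy (x + y) \<le> 2 * energy x + 2 * energy y"
proof -
  have "energy (x + y) \<le> (\<Sum>i\<in>UNIV. 2 * ((1/4) ^ depth i * (gap x i)\<^sup>2) + 2 * ((1/4) ^ depth i * (gap y i)\<^sup>2))"
    unfolding energy_def
  proof (rule sum_mono)
    fix i :: 'a
    have "(gap x i + gap y i)\<^sup>2 \<le> 2 * (gap x i)\<^sup>2 + 2 * (gap y i)\<^sup>2"
      using zero_le_power2[of "gap x i - gap y i"] by (simp add: power2_eq_square algebra_simps)
    then have "(1/4) ^ depth i * (gap x i + gap y i)\<^sup>2 \<le> (1/4) ^ depth i * (2 * (gap x i)\<^sup>2 + 2 * (gap y i)\<^sup>2)"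
      by (intro mult_left_mono) auto
    then show "(1/4) ^ depth i * (gap (x + y) i)\<^sup>2
        \<le> 2 * ((1/4) ^ depth i * (gap x i)\<^sup>2) + 2 * ((1/4) ^ depth i * (gap y i)\<^sup>2)"
      by (simp add: algebra_simps)
  qed
  also have "\<dots> = 2 * energy x + 2 * energy y"
    by (simp add: energy_def sum.distrib sum_distrib_left)
  finally show ?thesis .
qed

lemma energy_le_norm: "energy (x :: 'n::{finite,linorder} rvec) \<le> real CARD('n) * (2 * norm x)\<^sup>2"
proof -
  have "energy x \<le> (\<Sum>i\<in>(UNIV :: 'n set). (2 * norm x)\<^sup>2)"
    unfolding energy_def
  proof (rule sum_mono)
    fix i :: 'n
    have "\<bar>gap x i\<bar> \<le> \<bar>2 * norm x\<bar>"
      using component_le_norm_cart[of x i] component_le_norm_cart[of x "idx_pred i"]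
      by (auto simp: gap_def)
    then have "(gap x i)\<^sup>2 \<le> (2 * norm x)\<^sup>2" by (simp only: abs_le_square_iff)
    moreover have "(1/4 :: real) ^ depth i \<le> 1" by (intro power_le_one) auto
    ultimately show "(1/4) ^ depth i * (gap x i)\<^sup>2 \<le> (2 * norm x)\<^sup>2"
      using mult_mono[of "(1/4) ^ depth i" 1 "(gap x i)\<^sup>2" "(2 * norm x)\<^sup>2"] by simp
  qed
  then show ?thesis by simp
qed

lemma gap_le_energy: "\<bar>gap x i\<bar> \<le> 2 ^ depth i * sqrt (energy x)"
proof -
  have "(1/4) ^ depth i * (gap x i)\<^sup>2 \<le> energy x"
    unfolding energy_def by (rule member_le_sum) auto
  then have "(gap x i)\<^sup>2 \<le> 4 ^ depth i * energy x"
    by (simp add: power_divide field_simps)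
  then have "sqrt ((gap x i)\<^sup>2) \<le> sqrt (4 ^ depth i * energy x)" by (rule real_sqrt_le_mono)
  also have "\<dots> = 2 ^ depth i * sqrt (energy x)"
    by (simp add: real_sqrt_mult real_sqrt_power)
  finally show ?thesis by simp
qed

text \<open>Summing the gaps along the chain recovers every component from the first one; the energy
  thus bounds a vector up to its first component, which is what compactness needs.\<close>

lemma norm_le_energy:
  obtains c where "0 < c" "\<And>x :: 'n::{finite,linorder} rvec. norm x \<le> c * (\<bar>x $ idx1\<bar> + sqrt (energy x))"
proof -
  have "\<exists>c\<ge>0. \<forall>x :: 'n rvec. \<bar>x $ i\<bar> \<le> c * (\<bar>x $ idx1\<bar> + sqrt (energy x))" for i
  proof (induction i rule: chain_induct)
    case idx1
    show ?case by (rule exI[of _ 1]) (simp add: energy_nonneg)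
  next
    case (pred i)
    then obtain c where c: "c \<ge> 0"
      "\<And>x :: 'n rvec. \<bar>x $ idx_pred i\<bar> \<le> c * (\<bar>x $ idx1\<bar> + sqrt (energy x))" by blast
    have "\<bar>x $ i\<bar> \<le> (c + 2 ^ depth i) * (\<bar>x $ idx1\<bar> + sqrt (energy x))" for x :: "'n rvec"
    proof -
      have "x $ i = x $ idx_pred i + gap x i" using pred by (simp add: gap_def)
      then have "\<bar>x $ i\<bar> \<le> \<bar>x $ idx_pred i\<bar> + \<bar>gap x i\<bar>" by linarith
      also have "\<dots> \<le> c * (\<bar>x $ idx1\<bar> + sqrt (energy x)) + 2 ^ depth i * (\<bar>x $ idx1\<bar> + sqrt (energy x))"
        by (intro add_mono c order_trans[OF gap_le_energy] mult_left_mono) auto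
      finally show ?thesis by (simp add: algebra_simps)
    qed
    then show ?case using c(1) by (intro exI[of _ "c + 2 ^ depth i"]) auto
  qed
  then obtain c where c: "\<And>i. c i \<ge> 0"
    "\<And>i (x :: 'n rvec). \<bar>x $ i\<bar> \<le> c i * (\<bar>x $ idx1\<bar> + sqrt (energy x))" by metis
  have "norm x \<le> (sum c UNIV + 1) * (\<bar>x $ idx1\<bar> + sqrt (energy x))" for x :: "'n rvec"
  proof -
    have "norm x \<le> (\<Sum>i\<in>UNIV. \<bar>x $ i\<bar>)" by (rule norm_le_l1_cart)
    also have "\<dots> \<le> (\<Sum>i\<in>UNIV. c i * (\<bar>x $ idx1\<bar> + sqrt (energy x)))" by (intro sum_mono c)
    also have "\<dots> \<le> (sum c UNIV + 1) * (\<bar>x $ idx1\<bar> + sqrt (energy x))"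
      unfolding sum_distrib_right[symmetric] by (intro mult_right_mono) (auto simp: energy_nonneg)
    finally show ?thesis .
  qed
  moreover have "sum c UNIV + 1 > 0" using sum_nonneg[of UNIV c] c(1) by simp
  ultimately show ?thesis using that by blast
qed

text \<open>Young's inequality ab <= a^2/4 + b^2 is split unevenly: the square of the predecessor
  gap comes with the weight of i, a quarter of its own, so its coefficient 1 becomes 1/4. As
  \<open>idx_pred\<close> is injective away from the head, each such square is counted at most
  once.\<close>

lemma sum_gap_pred_le:
  "(\<Sum>i\<in>UNIV. (1/4) ^ depth i * (if i = idx1 then 0 else gap x i * gap x (idx_pred i))) \<le> energy x / 2"
    (is "?S \<le> _")
proof -
  let ?e = "\<lambda>i. (1/4) ^ depth i * (gap x i)\<^sup>2"
  have "?S \<le> (\<Sum>i\<in>UNIV. ?e i / 4 + (if i = idx1 then 0 else ?e (idx_pred i) / 4))"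
  proof (rule sum_mono)
    fix i :: 'a
    show "(1/4) ^ depth i * (if i = idx1 then 0 else gap x i * gap x (idx_pred i))
        \<le> ?e i / 4 + (if i = idx1 then 0 else ?e (idx_pred i) / 4)"
    proof (cases "i = idx1")
      case False
      have "4 * (gap x i * gap x (idx_pred i)) \<le> (gap x i)\<^sup>2 + 4 * (gap x (idx_pred i))\<^sup>2"
        using zero_le_power2[of "gap x i - 2 * gap x (idx_pred i)"]
        by (simp add: power2_eq_square algebra_simps)
      then have "(1/4) ^ depth i * (4 * (gap x i * gap x (idx_pred i)))
          \<le> (1/4) ^ depth i * ((gap x i)\<^sup>2 + 4 * (gap x (idx_pred i))\<^sup>2)"
        by (intro mult_left_mono) auto
      then show ?thesis using False by (simp add: depth_idx_pred field_simps)
    qed simp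
  qed
  also have "\<dots> = energy x / 4 + (\<Sum>i\<in>- {idx1}. ?e (idx_pred i) / 4)"
    by (simp add: sum.distrib energy_def sum_divide_distrib sum.If_cases Compl_eq)
  also have "(\<Sum>i\<in>- {idx1}. ?e (idx_pred i) / 4) = (\<Sum>i\<in>idx_pred ` (- {idx1}). ?e i / 4)"
    by (simp add: sum.reindex[OF inj_on_idx_pred])
  also have "\<dots> \<le> (\<Sum>i\<in>UNIV. ?e i / 4)"
    by (intro sum_mono2) auto
  also have "\<dots> = energy x / 4" by (simp add: energy_def sum_divide_distrib)
  finally show ?thesis by simp
qed

text \<open>Of the damping 2 k, the amount k / 2 is spent on completing the square against the
  inhomogeneity and k on the coupling; k / 2 remains. The constant 8 / k is 2 / k times the square
  of 2, since a gap of b is at most 2 B.\<close>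

lemma energy_rate_le:
  fixes x b :: "'n::{finite,linorder} rvec"
  assumes k: "k > 0" and b: "\<And>i. \<bar>b $ i\<bar> \<le> B"
  defines "d \<equiv> k *\<^sub>R (chain_matrix *v x) + b"
  shows "(\<Sum>i\<in>UNIV. (1/4) ^ depth i * (2 * gap x i * gap d i))
    \<le> - (k / 2) * energy x + 8 * real CARD('n) / k * B\<^sup>2"
proof -
  let ?w = "\<lambda>i :: 'n. (1/4) ^ depth i :: real"
  let ?c = "\<lambda>i. if i = idx1 then 0 else gap x i * gap x (idx_pred i)"
  have "(\<Sum>i\<in>UNIV. ?w i * (2 * gap x i * gap d i))
      \<le> (\<Sum>i\<in>UNIV. - (3 * k / 2) * (?w i * (gap x i)\<^sup>2) + 2 * k * (?w i * ?c i) + 8 / k * B\<^sup>2)"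
  proof (rule sum_mono)
    fix i :: 'n
    show "?w i * (2 * gap x i * gap d i)
        \<le> - (3 * k / 2) * (?w i * (gap x i)\<^sup>2) + 2 * k * (?w i * ?c i) + 8 / k * B\<^sup>2"
    proof (cases "i = idx1")
      case True
      then show ?thesis using k by (simp add: gap_def)
    next
      case False
      let ?q = "gap b i"
      \<comment> \<open>Valid also for the immediate successor of the head, as the gap of the head
        is 0 by definition.\<close>
      have gd: "gap d i = - k * gap x i + k * gap x (idx_pred i) + ?q"
        using False by (simp add: d_def) (simp add: gap_def chain_matrix_mult algebra_simps)
      have "\<bar>?q\<bar> \<le> \<bar>2 * B\<bar>" using False b[of i] b[of "idx_pred i"] by (simp add: gap_def)
      then have q: "?q\<^sup>2 \<le> (2 * B)\<^sup>2" by (simp only: abs_le_square_iff)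
      have "0 \<le> (k * gap x i - 2 * ?q)\<^sup>2 / (2 * k)" using k by simp
      also have "\<dots> = k / 2 * (gap x i)\<^sup>2 - 2 * gap x i * ?q + 2 / k * ?q\<^sup>2"
        using k by (simp add: power2_eq_square field_simps)
      finally have "2 * gap x i * ?q \<le> k / 2 * (gap x i)\<^sup>2 + 2 / k * ?q\<^sup>2" by simp
      also have "\<dots> \<le> k / 2 * (gap x i)\<^sup>2 + 2 / k * (2 * B)\<^sup>2"
        using k q by (intro add_left_mono mult_left_mono) auto
      finally have "2 * gap x i * gap d i
          \<le> - (3 * k / 2) * (gap x i)\<^sup>2 + 2 * k * ?c i + 8 / k * B\<^sup>2"
        using False unfolding gd by (simp add: power2_eq_square algebra_simps)
      then have "?w i * (2 * gap x i * gap d i)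
          \<le> ?w i * (- (3 * k / 2) * (gap x i)\<^sup>2 + 2 * k * ?c i + 8 / k * B\<^sup>2)"
        by (intro mult_left_mono) auto
      also have "\<dots> = - (3 * k / 2) * (?w i * (gap x i)\<^sup>2) + 2 * k * (?w i * ?c i) + ?w i * (8 / k * B\<^sup>2)"
        by (simp add: algebra_simps)
      also have "?w i * (8 / k * B\<^sup>2) \<le> 1 * (8 / k * B\<^sup>2)"
        using k by (intro mult_right_mono power_le_one) auto
      finally show ?thesis by simp
    qed
  qed
  also have "\<dots> = - (3 * k / 2) * energy x + 2 * k * (\<Sum>i\<in>UNIV. ?w i * ?c i) + real CARD('n) * (8 / k * B\<^sup>2)"
    by (simp only: sum.distrib energy_def sum_distrib_left sum_constant)
  also have "\<dots> \<le> - (3 * k / 2) * energy x + 2 * k * (energy x / 2) + real CARD('n) * (8 / k * B\<^sup>2)"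
    using k by (intro add_mono order_refl mult_left_mono sum_gap_pred_le) auto
  also have "\<dots> = - (k / 2) * energy x + 8 * real CARD('n) / k * B\<^sup>2"
    by (simp add: field_simps)
  finally show ?thesis .
qed

lemma energy_has_real_derivative:
  assumes "(X has_vector_derivative X') (at t)"
  shows "((\<lambda>t. energy (X t)) has_real_derivative
    (\<Sum>i\<in>UNIV. (1/4) ^ depth i * (2 * gap (X t) i * gap X' i))) (at t)"
proof -
  have comp: "((\<lambda>t. X t $ i) has_real_derivative X' $ i) (at t)" for i
    using bounded_linear.has_vector_derivative[OF bounded_linear_vec_nth assms]
    by (simp add: has_real_derivative_iff_has_vector_derivative)
  have "((\<lambda>t. gap (X t) i) has_real_derivative gap X' i) (at t)" for i
    by (auto simp: gap_def intro!: derivative_eq_intros comp)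
  note gap = this
  show ?thesis
    unfolding energy_def
    by (intro DERIV_sum) (rule derivative_eq_intros gap refl | simp)+
qed

lemma continuous_on_energy [continuous_intros]:
  "continuous_on S f \<Longrightarrow> continuous_on S (\<lambda>x. energy (f x))"
proof -
  assume f: "continuous_on S f"
  have "continuous_on S (\<lambda>x. gap (f x) i)" for i
    by (cases "i = idx1") (auto simp: gap_def intro!: continuous_intros f)
  then show ?thesis unfolding energy_def by (intro continuous_intros)
qed

section \<open>The flow and its absorbing sets\<close>

lemma wiener_shift_shift: "wiener_shift s (wiener_shift t \<omega>) = wiener_shift (s + t) \<omega>"
  by (auto simp: wiener_shift_def add_ac)

lemma square_le_exp:
  fixes a :: real assumes a: "a > 0"
  obtains B where "B \<ge> 0" "\<And>u. (1 + \<bar>u\<bar>)\<^sup>2 \<le> B * exp (a * \<bar>u\<bar>)"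
proof -
  define c where "c = max 1 (2 / a)"
  have "(1 + \<bar>u\<bar>)\<^sup>2 \<le> c\<^sup>2 * exp (a * \<bar>u\<bar>)" for u
  proof -
    have "c * (a * \<bar>u\<bar> / 2) \<ge> 2 / a * (a * \<bar>u\<bar> / 2)"
      unfolding c_def using a by (intro mult_right_mono) auto
    then have "\<bar>u\<bar> \<le> c * (a * \<bar>u\<bar> / 2)" using a by simp
    moreover have "1 \<le> c" by (simp add: c_def)
    ultimately have "1 + \<bar>u\<bar> \<le> c * (1 + a * \<bar>u\<bar> / 2)" unfolding distrib_left by simp
    also have "\<dots> \<le> c * exp (a * \<bar>u\<bar> / 2)"
      by (intro mult_left_mono exp_ge_add_one_self) (auto simp: c_def)
    finally have "(1 + \<bar>u\<bar>)\<^sup>2 \<le> (c * exp (a * \<bar>u\<bar> / 2))\<^sup>2" by (intro power_mono) auto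
    then show ?thesis by (simp add: power_mult_distrib flip: exp_double)
  qed
  then show ?thesis by (intro that[of "c\<^sup>2"]) auto
qed

locale chain_system =
  fixes k :: real and \<alpha> \<epsilon> :: "real ^ 'n::{finite,linorder}"
    and P :: "'n path measure" and \<Omega> :: "'n path set"
  assumes k_pos: "k > 0"
    and wiener: "wiener_measure P"
    and admissible: "admissible_paths P \<epsilon> \<Omega>"
begin

abbreviation z :: "'n \<Rightarrow> 'n path \<Rightarrow> real" where "z \<equiv> ou \<epsilon>"
abbreviation \<theta> :: "real \<Rightarrow> 'n path \<Rightarrow> 'n path" where "\<theta> \<equiv> wiener_shift"
abbreviation \<phi> :: "real \<Rightarrow> 'n rvec \<Rightarrow> 'n path \<Rightarrow> 'n rvec" where "\<phi> \<equiv> phi k \<alpha> \<epsilon>"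
abbreviation vf :: "'n path \<Rightarrow> 'n rvec \<Rightarrow> 'n rvec" where "vf \<equiv> vfield k \<alpha> \<epsilon>"

lemma space_P: "space P = wiener_paths"
proof -
  have "space P = space path_borel"
    using wiener by (auto simp: wiener_measure_def dest: sets_eq_imp_space_eq)
  then show ?thesis by (simp add: path_borel_def space_measure_of_conv)
qed

lemma \<Omega>_sets: "\<Omega> \<in> sets P" and shift_mem: "\<omega> \<in> \<Omega> \<Longrightarrow> \<theta> t \<omega> \<in> \<Omega>"
  using admissible unfolding admissible_paths_def by blast+

lemma \<Omega>_paths: "\<Omega> \<subseteq> wiener_paths"
  using sets.sets_into_space[OF \<Omega>_sets] by (simp add: space_P)

lemma shift_0: "\<omega> \<in> \<Omega> \<Longrightarrow> \<theta> 0 \<omega> = \<omega>"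
  using \<Omega>_paths by (auto simp: wiener_shift_def wiener_paths_def)

lemma z_integrable: "\<omega> \<in> \<Omega> \<Longrightarrow> (\<lambda>\<tau>. exp \<tau> * \<omega> \<tau> $ i) integrable_on {..0}"
  and z_continuous: "\<omega> \<in> \<Omega> \<Longrightarrow> continuous_on UNIV (\<lambda>t. z i (\<theta> t \<omega>))"
  and z_at_top: "\<omega> \<in> \<Omega> \<Longrightarrow> ((\<lambda>t. \<bar>z i (\<theta> t \<omega>)\<bar> / t) \<longlongrightarrow> 0) at_top"
  and z_at_bot: "\<omega> \<in> \<Omega> \<Longrightarrow> ((\<lambda>t. \<bar>z i (\<theta> t \<omega>)\<bar> / t) \<longlongrightarrow> 0) at_bot"
  using admissible unfolding admissible_paths_def by blast+

text \<open>Outside a compact interval the limits give |z| < |t|; inside, continuity gives a bound.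
  Linear growth is all that the later estimates take from the two limits.\<close>

lemma z_growth:
  assumes \<omega>: "\<omega> \<in> \<Omega>"
  obtains C where "C \<ge> 0" "\<And>t. \<bar>z i (\<theta> t \<omega>)\<bar> \<le> C * (1 + \<bar>t\<bar>)"
proof -
  let ?z = "\<lambda>t. z i (\<theta> t \<omega>)"
  obtain b where b: "\<And>t. t \<ge> b \<Longrightarrow> \<bar>\<bar>?z t\<bar> / t\<bar> < 1"
    using tendstoD[OF z_at_top[OF \<omega>, of i] zero_less_one]
    by (auto simp: eventually_at_top_linorder dist_real_def)
  obtain a where a: "\<And>t. t \<le> a \<Longrightarrow> \<bar>\<bar>?z t\<bar> / t\<bar> < 1"
    using tendstoD[OF z_at_bot[OF \<omega>, of i] zero_less_one]
    by (auto simp: eventually_at_bot_linorder dist_real_def)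
  define T where "T = max 1 (max b (- a))"
  have "compact (?z ` {- T..T})"
    by (intro compact_continuous_image continuous_on_subset[OF z_continuous[OF \<omega>]]) auto
  then have "\<exists>M. \<forall>t\<in>{- T..T}. \<bar>?z t\<bar> \<le> M"
    by (auto dest!: compact_imp_bounded simp: bounded_iff)
  then obtain M where M: "\<And>t. t \<in> {- T..T} \<Longrightarrow> \<bar>?z t\<bar> \<le> M" by blast
  have "\<bar>?z t\<bar> \<le> max 1 M * (1 + \<bar>t\<bar>)" for t
  proof (cases "t \<in> {- T..T}")
    case True
    have "\<bar>?z t\<bar> \<le> max 1 M * 1" using M[OF True] by simp
    also have "\<dots> \<le> max 1 M * (1 + \<bar>t\<bar>)" by (intro mult_left_mono) auto
    finally show ?thesis .
  next
    case False
    then have "\<bar>\<bar>?z t\<bar> / t\<bar> < 1" "\<bar>t\<bar> > 0"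
      using a[of t] b[of t] by (auto simp: T_def)
    then have "\<bar>?z t\<bar> < \<bar>t\<bar>" by (simp add: abs_divide)
    also have "\<bar>t\<bar> \<le> 1 * (1 + \<bar>t\<bar>)" by simp
    also have "\<dots> \<le> max 1 M * (1 + \<bar>t\<bar>)" by (intro mult_right_mono) auto
    finally show ?thesis by simp
  qed
  then show ?thesis by (intro that[of "max 1 M"]) auto
qed

section \<open>The vector field and its global flow\<close>

definition drift :: "'n path \<Rightarrow> 'n rvec \<Rightarrow> 'n rvec" where
  "drift \<omega> x = (\<chi> i. \<alpha> $ i - sin (x $ i + z i \<omega>) + forcing k \<epsilon> \<omega> $ i)"

lemma vf_eq: "vf \<omega> x = k *\<^sub>R (chain_matrix *v x) + drift \<omega> x"
  by (simp add: vfield_def drift_def)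

lemma continuous_forcing:
  assumes "\<omega> \<in> \<Omega>" shows "continuous_on S (\<lambda>t. forcing k \<epsilon> (\<theta> t \<omega>))"
proof -
  have z: "continuous_on S (\<lambda>t. z i (\<theta> t \<omega>))" for i
    by (rule continuous_on_subset[OF z_continuous[OF assms]]) auto
  have "continuous_on S (\<lambda>t. if i = idx1 then z i (\<theta> t \<omega>)
          else k * (z (idx_pred i) (\<theta> t \<omega>) - z i (\<theta> t \<omega>)) + z i (\<theta> t \<omega>))" for i
    by (cases "i = idx1") (auto intro!: continuous_intros z)
  then show ?thesis
    unfolding forcing_def by (rule continuous_on_vec_lambda)
qed

lemma vf_lipschitz: "norm (vf \<omega> x - vf \<omega> y) \<le> (k * (2 * real CARD('n)) + 1) * norm (x - y)"
proof -
  have "norm (drift \<omega> x - drift \<omega> y) \<le> norm (x - y)"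
  proof (rule norm_le_componentwise_cart)
    fix i
    have "norm ((drift \<omega> x - drift \<omega> y) $ i) = \<bar>sin (x $ i + z i \<omega>) - sin (y $ i + z i \<omega>)\<bar>"
      by (simp add: drift_def abs_minus_commute)
    also have "\<dots> \<le> norm ((x - y) $ i)"
      using abs_sin_diff_le[of "x $ i + z i \<omega>" "y $ i + z i \<omega>"] by simp
    finally show "norm ((drift \<omega> x - drift \<omega> y) $ i) \<le> norm ((x - y) $ i)" .
  qed
  moreover have "norm (chain_matrix *v (x - y)) \<le> 2 * real CARD('n) * norm (x - y)"
  proof -
    have "norm (chain_matrix *v (x - y)) \<le> (\<Sum>i\<in>(UNIV :: 'n set). 2 * norm (x - y))"
    proof (rule order_trans[OF norm_le_l1_cart sum_mono])
      fix i :: 'n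
      show "\<bar>(chain_matrix *v (x - y)) $ i\<bar> \<le> 2 * norm (x - y)"
        using component_le_norm_cart[of "x - y" i] component_le_norm_cart[of "x - y" "idx_pred i"]
        unfolding chain_matrix_mult by (auto simp: gap_def)
    qed
    then show ?thesis by simp
  qed
  then have "norm (k *\<^sub>R (chain_matrix *v (x - y))) \<le> k * (2 * real CARD('n) * norm (x - y))"
    using k_pos by (simp add: mult_left_mono)
  moreover have "vf \<omega> x - vf \<omega> y = k *\<^sub>R (chain_matrix *v (x - y)) + (drift \<omega> x - drift \<omega> y)"
    by (simp add: vf_eq matrix_vector_mult_diff_distrib algebra_simps)
  ultimately have "norm (vf \<omega> x - vf \<omega> y) \<le> k * (2 * real CARD('n) * norm (x - y)) + norm (x - y)"
    using norm_triangle_ineq[of "k *\<^sub>R (chain_matrix *v (x - y))" "drift \<omega> x - drift \<omega> y"] by simp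
  then show ?thesis by (simp add: algebra_simps)
qed

definition lip :: real where "lip = k * (2 * real CARD('n)) + 1"

lemma lipschitz_field:
  assumes "\<omega> \<in> \<Omega>" shows "lipschitz_field (\<lambda>t. vf (\<theta> t \<omega>)) lip"
proof
  show "lip > 0" using k_pos by (simp add: lip_def add_nonneg_pos)
  show "norm (vf (\<theta> t \<omega>) u - vf (\<theta> t \<omega>) v) \<le> lip * norm (u - v)" for t u v
    unfolding lip_def by (rule vf_lipschitz)
  have z: "continuous_on UNIV (\<lambda>p :: real \<times> 'n rvec. z i (\<theta> (fst p) \<omega>))" for i
    by (rule continuous_on_compose2[OF z_continuous[OF assms]]) (auto intro!: continuous_intros)
  have f: "continuous_on UNIV (\<lambda>p :: real \<times> 'n rvec. forcing k \<epsilon> (\<theta> (fst p) \<omega>))"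
    by (rule continuous_on_compose2[OF continuous_forcing[OF assms, of UNIV]]) (auto intro!: continuous_intros)
  have "continuous_on UNIV (\<lambda>p :: real \<times> 'n rvec. chain_matrix *v snd p)"
    by (intro linear_continuous_on_compose[OF continuous_on_snd[OF continuous_on_id]]
        matrix_vector_mul_linear)
  then have "continuous_on UNIV (\<lambda>p. vf (\<theta> (fst p) \<omega>) (snd p))"
    unfolding vfield_def by (intro continuous_intros continuous_on_vec_lambda z f)
  then show "continuous_on UNIV (\<lambda>(t, x). vf (\<theta> t \<omega>) x)"
    by (simp add: case_prod_beta)
qed

context
  fixes \<omega> assumes \<omega>: "\<omega> \<in> \<Omega>"
begin

interpretation lipschitz_field "\<lambda>t. vf (\<theta> t \<omega>)" lip
  by (rule lipschitz_field[OF \<omega>])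

lemma \<phi>_solution: "\<phi> 0 x \<omega> = x \<and>
    (\<forall>s. ((\<lambda>t. \<phi> t x \<omega>) has_vector_derivative vf (\<theta> s \<omega>) (\<phi> s x \<omega>)) (at s))"
  using theI'[OF ex1_solution[of x]] unfolding phi_def .

lemma \<phi>_0 [simp]: "\<phi> 0 x \<omega> = x"
  using \<phi>_solution by simp

lemma \<phi>_derivative: "((\<lambda>t. \<phi> t x \<omega>) has_vector_derivative vf (\<theta> s \<omega>) (\<phi> s x \<omega>)) (at s)"
  using \<phi>_solution by simp

lemma \<phi>_unique:
  assumes "\<And>s. (X has_vector_derivative vf (\<theta> s \<omega>) (X s)) (at s)" "X 0 = x"
  shows "\<phi> t x \<omega> = X t"
  using ex1_solution[of x] \<phi>_solution assms by metis

text \<open>\<open>phi\<close> is a description by uniqueness and shows nothing of its dependence on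
  the path; the Picard limit gives access to it for measurability.\<close>

lemma \<phi>_picard: "(\<lambda>n. picard (\<lambda>t. vf (\<theta> t \<omega>)) x n t) \<longlonglongrightarrow> \<phi> t x \<omega>"
proof -
  have "\<phi> t x \<omega> = lim (\<lambda>n. picard (\<lambda>t. vf (\<theta> t \<omega>)) x n t)"
    by (rule \<phi>_unique[OF picard_lim_solves]) (simp add: picard_0)
  then show ?thesis using picard_tendsto by simp
qed

lemma \<phi>_lipschitz: "norm (\<phi> t x \<omega> - \<phi> t y \<omega>) \<le> exp (lip * \<bar>t\<bar>) * norm (x - y)"
  using lipschitz_flow_bound[OF \<phi>_derivative \<phi>_derivative lip, of t x y] by simp

lemma continuous_on_\<phi>:
  assumes "continuous_on S f" shows "continuous_on S (\<lambda>u. \<phi> t (f u) \<omega>)"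
proof -
  have "(exp (lip * \<bar>t\<bar>))-lipschitz_on UNIV (\<lambda>x. \<phi> t x \<omega>)"
    by (rule lipschitz_onI) (auto simp: dist_norm \<phi>_lipschitz)
  from continuous_on_compose2[OF lipschitz_on_continuous_on[OF this] assms] show ?thesis by simp
qed

lemma continuous_on_\<phi>_time: "continuous_on S (\<lambda>t. \<phi> t x \<omega>)"
  by (intro continuous_at_imp_continuous_on ballI has_vector_derivative_continuous[OF \<phi>_derivative])

end

lemma \<phi>_component_derivative:
  assumes "\<omega> \<in> \<Omega>"
  shows "((\<lambda>t. \<phi> t x \<omega> $ i) has_real_derivative
    - k * gap (\<phi> s x \<omega>) i + \<alpha> $ i - sin (\<phi> s x \<omega> $ i + z i (\<theta> s \<omega>)) + forcing k \<epsilon> (\<theta> s \<omega>) $ i) (at s)"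
  using bounded_linear.has_vector_derivative[OF bounded_linear_vec_nth \<phi>_derivative[OF assms]]
  by (simp add: has_real_derivative_iff_has_vector_derivative vf_eq drift_def chain_matrix_mult algebra_simps)

lemma \<phi>_cocycle:
  assumes "\<omega> \<in> \<Omega>" shows "\<phi> (s + t) x \<omega> = \<phi> s (\<phi> t x \<omega>) (\<theta> t \<omega>)"
proof (rule \<phi>_unique[OF shift_mem[OF assms], symmetric])
  fix u
  have "((\<lambda>s. \<phi> (s + t) x \<omega>) has_vector_derivative (1 :: real) *\<^sub>R vf (\<theta> (u + t) \<omega>) (\<phi> (u + t) x \<omega>)) (at u)"
  proof -
    have "((\<lambda>s. s + t) has_vector_derivative 1) (at u)"
      by (auto intro!: derivative_eq_intros)
    from vector_diff_chain_at[OF this \<phi>_derivative[OF assms]] show ?thesis by (simp add: o_def)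
  qed
  then show "((\<lambda>s. \<phi> (s + t) x \<omega>) has_vector_derivative vf (\<theta> u (\<theta> t \<omega>)) (\<phi> (u + t) x \<omega>)) (at u)"
    by (simp add: wiener_shift_shift)
qed simp

lemma \<phi>_inverse:
  assumes "\<omega> \<in> \<Omega>" shows "\<phi> (- t) (\<phi> t x \<omega>) (\<theta> t \<omega>) = x" "\<phi> t (\<phi> (- t) x \<omega>) (\<theta> (- t) \<omega>) = x"
  using \<phi>_cocycle[OF assms, of "- t" t x] \<phi>_cocycle[OF assms, of t "- t" x] assms by simp_all

lemma \<phi>_deck:
  assumes "\<omega> \<in> \<Omega>"
  shows "\<phi> t (x + vec (2 * pi * of_int m)) \<omega> = \<phi> t x \<omega> + vec (2 * pi * of_int m)"
proof (rule \<phi>_unique[OF assms])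
  fix s
  let ?v = "vec (2 * pi * of_int m) :: 'n rvec"
  have "sin (a + 2 * pi * of_int m + b) = sin (a + b)" for a b :: real
    using sin_cos_eq_iff[of "a + 2 * pi * of_int m + b" "a + b"] by (auto simp: algebra_simps)
  then have "vf \<omega>' (y + ?v) = vf \<omega>' y" for \<omega>' y
    by (simp add: vec_eq_iff vf_eq chain_matrix_mult drift_def)
  then show "((\<lambda>t. \<phi> t x \<omega> + ?v) has_vector_derivative vf (\<theta> s \<omega>) (\<phi> s x \<omega> + ?v)) (at s)"
    using \<phi>_derivative[OF assms] by (auto intro!: derivative_eq_intros)
qed (use assms in simp)

lemma Phi_proj:
  assumes "\<omega> \<in> \<Omega>" shows "Phi k \<alpha> \<epsilon> t (proj x) \<omega> = proj (\<phi> t x \<omega>)"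
proof -
  have "proj (rep_phase (proj x)) = proj x" by simp
  then obtain m :: int where "rep_phase (proj x) - x = vec (2 * pi * of_int m)"
    unfolding proj_eq_iff by blast
  then have "rep_phase (proj x) = x + vec (2 * pi * of_int m)" by (simp add: diff_eq_eq add.commute)
  then show ?thesis by (simp add: Phi_def \<phi>_deck[OF assms])
qed

text \<open>The equation of the first component is autonomous.\<close>

lemma \<phi>_idx1_cong:
  assumes \<omega>: "\<omega> \<in> \<Omega>" and "x $ idx1 = y $ idx1"
  shows "\<phi> t x \<omega> $ idx1 = \<phi> t y \<omega> $ idx1"
proof -
  let ?F = "\<lambda>s u. \<alpha> $ idx1 - sin (u + z idx1 (\<theta> s \<omega>)) + forcing k \<epsilon> (\<theta> s \<omega>) $ idx1"
  have d: "((\<lambda>t. \<phi> t x \<omega> $ idx1) has_vector_derivative ?F s (\<phi> s x \<omega> $ idx1)) (at s)" for x s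
    using \<phi>_component_derivative[OF \<omega>, of x idx1 s]
    by (simp add: gap_def has_real_derivative_iff_has_vector_derivative)
  have "norm (?F s u - ?F s v) \<le> 1 * norm (u - v)" for s u v
    using abs_sin_diff_le[of "u + z idx1 (\<theta> s \<omega>)" "v + z idx1 (\<theta> s \<omega>)"] by (simp add: abs_minus_commute)
  then have "norm (\<phi> t x \<omega> $ idx1 - \<phi> t y \<omega> $ idx1)
      \<le> exp (1 * \<bar>t\<bar>) * norm (\<phi> 0 x \<omega> $ idx1 - \<phi> 0 y \<omega> $ idx1)"
    by (intro lipschitz_flow_bound[where F = ?F and x = "\<lambda>t. \<phi> t x \<omega> $ idx1"] d)
  then show ?thesis using assms by simp
qed

section \<open>The random radius and the absorption of energy\<close>

definition \<kappa> :: real where "\<kappa> = k / 4"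

lemma \<kappa>_pos: "\<kappa> > 0" using k_pos by (simp add: \<kappa>_def)

definition load :: "'n path \<Rightarrow> real" where
  "load \<omega> = norm \<alpha> + 1 + norm (forcing k \<epsilon> \<omega>)"

text \<open>Normalised so that \<kappa> times \<open>source - 1\<close> is exactly the inhomogeneity
  of the energy inequality with B = \<open>load\<close>. The summand 1 makes the later radius at
  least 1.\<close>

definition source :: "'n path \<Rightarrow> real" where
  "source \<omega> = 1 + 32 * real CARD('n) / k\<^sup>2 * (load \<omega>)\<^sup>2"

text \<open>A supremum over the past, discounted at rate \<kappa>, half the decay rate of the
  energy. Being a supremum, it bounds \<open>source\<close> pointwise at every earlier time; the
  absolute values let it run over all reals, so that a supremum over the rationals computes
  it.\<close>

definition \<rho> :: "'n path \<Rightarrow> real" where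
  "\<rho> \<omega> = (SUP u. exp (- \<kappa> * \<bar>u\<bar>) * source (\<theta> (- \<bar>u\<bar>) \<omega>))"

lemma drift_le_load: "\<bar>drift \<omega> x $ i\<bar> \<le> load \<omega>"
proof -
  have "\<bar>drift \<omega> x $ i\<bar> \<le> \<bar>\<alpha> $ i\<bar> + \<bar>sin (x $ i + z i \<omega>)\<bar> + \<bar>forcing k \<epsilon> \<omega> $ i\<bar>"
    by (simp add: drift_def)
  also have "\<dots> \<le> load \<omega>"
    unfolding load_def by (intro add_mono component_le_norm_cart abs_sin_le_one)
  finally show ?thesis .
qed

lemma source_ge_1: "1 \<le> source \<omega>"
  by (simp add: source_def)

lemma continuous_source:
  assumes "\<omega> \<in> \<Omega>" shows "continuous_on S (\<lambda>t. source (\<theta> t \<omega>))"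
  unfolding source_def load_def by (intro continuous_intros continuous_forcing assms)

lemma source_growth:
  assumes \<omega>: "\<omega> \<in> \<Omega>"
  obtains C where "C \<ge> 0" "\<And>t. source (\<theta> t \<omega>) \<le> C * (1 + \<bar>t\<bar>)\<^sup>2"
proof -
  have "\<exists>C\<ge>0. \<forall>t. \<bar>z i (\<theta> t \<omega>)\<bar> \<le> C * (1 + \<bar>t\<bar>)" for i
    using z_growth[OF \<omega>, of i] by metis
  then obtain C where C: "\<And>i. C i \<ge> 0" "\<And>i t. \<bar>z i (\<theta> t \<omega>)\<bar> \<le> C i * (1 + \<bar>t\<bar>)" by metis
  define D where "D i = (if i = idx1 then C i else k * (C (idx_pred i) + C i) + C i)" for i
  have D: "D i \<ge> 0" for i using C(1) k_pos by (auto simp: D_def)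
  define B where "B = norm \<alpha> + 1 + sum D UNIV"
  have "load (\<theta> t \<omega>) \<le> B * (1 + \<bar>t\<bar>)" for t
  proof -
    have "\<bar>forcing k \<epsilon> (\<theta> t \<omega>) $ i\<bar> \<le> D i * (1 + \<bar>t\<bar>)" for i
    proof (cases "i = idx1")
      case True
      then show ?thesis using C(2) by (simp add: forcing_def D_def)
    next
      case False
      have "\<bar>k * (z (idx_pred i) (\<theta> t \<omega>) - z i (\<theta> t \<omega>)) + z i (\<theta> t \<omega>)\<bar>
          \<le> k * (\<bar>z (idx_pred i) (\<theta> t \<omega>)\<bar> + \<bar>z i (\<theta> t \<omega>)\<bar>) + \<bar>z i (\<theta> t \<omega>)\<bar>"
        using k_pos by (intro order_trans[OF abs_triangle_ineq] add_mono) (auto simp: abs_mult)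
      also have "\<dots> \<le> k * (C (idx_pred i) * (1 + \<bar>t\<bar>) + C i * (1 + \<bar>t\<bar>)) + C i * (1 + \<bar>t\<bar>)"
        using k_pos by (intro add_mono mult_left_mono C(2)) auto
      finally show ?thesis using False by (simp add: forcing_def D_def algebra_simps)
    qed
    then have "norm (forcing k \<epsilon> (\<theta> t \<omega>)) \<le> (\<Sum>i\<in>UNIV. D i * (1 + \<bar>t\<bar>))"
      by (intro order_trans[OF norm_le_l1_cart sum_mono])
    moreover have "(norm \<alpha> + 1) * 1 \<le> (norm \<alpha> + 1) * (1 + \<bar>t\<bar>)"
      by (intro mult_left_mono) auto
    ultimately have "load (\<theta> t \<omega>) \<le> (norm \<alpha> + 1) * (1 + \<bar>t\<bar>) + sum D UNIV * (1 + \<bar>t\<bar>)"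
      unfolding load_def sum_distrib_right by simp
    then show ?thesis by (simp add: B_def distrib_right)
  qed
  moreover have "0 \<le> load \<omega>'" for \<omega>' by (simp add: load_def)
  ultimately have l2: "(load (\<theta> t \<omega>))\<^sup>2 \<le> (B * (1 + \<bar>t\<bar>))\<^sup>2" for t
    by (intro power_mono) auto
  let ?c = "32 * real CARD('n) / k\<^sup>2"
  have "source (\<theta> t \<omega>) \<le> (1 + ?c * B\<^sup>2) * (1 + \<bar>t\<bar>)\<^sup>2" for t
  proof -
    have "source (\<theta> t \<omega>) \<le> 1 + ?c * (B * (1 + \<bar>t\<bar>))\<^sup>2"
      unfolding source_def by (intro add_left_mono mult_left_mono l2) auto
    moreover have "1 \<le> (1 + \<bar>t\<bar>)\<^sup>2" by (rule one_le_power) simp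
    ultimately show ?thesis by (simp only: power_mult_distrib distrib_right mult.assoc)
  qed
  then show ?thesis by (intro that[of "1 + ?c * B\<^sup>2"]) auto
qed

text \<open>The lag u separates from t by 1 + |t - |u|| <= (1 + |u|) (1 + |t|), and its quadratic
  growth is beaten by the discount. This makes \<rho> finite and quadratically bounded along each
  path.\<close>

lemma exp_source_bound:
  assumes \<omega>: "\<omega> \<in> \<Omega>"
  obtains C where "C \<ge> 0" "\<And>t u. exp (- \<kappa> * \<bar>u\<bar>) * source (\<theta> (- \<bar>u\<bar>) (\<theta> t \<omega>)) \<le> C * (1 + \<bar>t\<bar>)\<^sup>2"
proof -
  obtain C where C: "C \<ge> 0" "\<And>t. source (\<theta> t \<omega>) \<le> C * (1 + \<bar>t\<bar>)\<^sup>2"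
    using source_growth[OF \<omega>] by blast
  obtain c where c: "c \<ge> 0" "\<And>u. (1 + \<bar>u\<bar>)\<^sup>2 \<le> c * exp (\<kappa> * \<bar>u\<bar>)"
    using square_le_exp[OF \<kappa>_pos] by blast
  have "exp (- \<kappa> * \<bar>u\<bar>) * source (\<theta> (- \<bar>u\<bar>) (\<theta> t \<omega>)) \<le> C * c * (1 + \<bar>t\<bar>)\<^sup>2" for t u
  proof -
    have "1 + \<bar>- \<bar>u\<bar> + t\<bar> \<le> (1 + \<bar>u\<bar>) * (1 + \<bar>t\<bar>)"
      by (simp add: algebra_simps) (smt (verit) mult_nonneg_nonneg)
    then have "(1 + \<bar>- \<bar>u\<bar> + t\<bar>)\<^sup>2 \<le> ((1 + \<bar>u\<bar>) * (1 + \<bar>t\<bar>))\<^sup>2" by (intro power_mono) auto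
    also have "\<dots> \<le> c * exp (\<kappa> * \<bar>u\<bar>) * (1 + \<bar>t\<bar>)\<^sup>2"
      unfolding power_mult_distrib by (intro mult_right_mono c) auto
    finally have "C * (1 + \<bar>- \<bar>u\<bar> + t\<bar>)\<^sup>2 \<le> C * (c * exp (\<kappa> * \<bar>u\<bar>) * (1 + \<bar>t\<bar>)\<^sup>2)"
      by (intro mult_left_mono C(1))
    then have "source (\<theta> (- \<bar>u\<bar>) (\<theta> t \<omega>)) \<le> C * (c * exp (\<kappa> * \<bar>u\<bar>) * (1 + \<bar>t\<bar>)\<^sup>2)"
      unfolding wiener_shift_shift by (intro order_trans[OF C(2)])
    then have "exp (- \<kappa> * \<bar>u\<bar>) * source (\<theta> (- \<bar>u\<bar>) (\<theta> t \<omega>))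
        \<le> exp (- \<kappa> * \<bar>u\<bar>) * (C * (c * exp (\<kappa> * \<bar>u\<bar>) * (1 + \<bar>t\<bar>)\<^sup>2))"
      by (intro mult_left_mono) auto
    then show ?thesis by (simp add: exp_minus field_simps)
  qed
  then show ?thesis using C(1) c(1) by (intro that[of "C * c"]) auto
qed

lemma \<rho>_growth:
  assumes "\<omega> \<in> \<Omega>"
  obtains C where "C \<ge> 0" "\<And>t. \<rho> (\<theta> t \<omega>) \<le> C * (1 + \<bar>t\<bar>)\<^sup>2"
proof -
  obtain C where C: "C \<ge> 0" "\<And>t u. exp (- \<kappa> * \<bar>u\<bar>) * source (\<theta> (- \<bar>u\<bar>) (\<theta> t \<omega>)) \<le> C * (1 + \<bar>t\<bar>)\<^sup>2"
    using exp_source_bound[OF assms] by blast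
  then have "\<rho> (\<theta> t \<omega>) \<le> C * (1 + \<bar>t\<bar>)\<^sup>2" for t
    unfolding \<rho>_def by (intro cSUP_least) auto
  with C(1) show ?thesis by (rule that)
qed

lemma bdd_above_\<rho>:
  assumes "\<omega> \<in> \<Omega>" shows "bdd_above (range (\<lambda>u. exp (- \<kappa> * \<bar>u\<bar>) * source (\<theta> (- \<bar>u\<bar>) \<omega>)))"
proof -
  obtain C where C: "C \<ge> 0" "\<And>t u. exp (- \<kappa> * \<bar>u\<bar>) * source (\<theta> (- \<bar>u\<bar>) (\<theta> t \<omega>)) \<le> C * (1 + \<bar>t\<bar>)\<^sup>2"
    using exp_source_bound[OF assms] by blast
  show ?thesis using C(2)[of _ 0] by (intro bdd_aboveI) (auto simp: shift_0[OF assms])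
qed

text \<open>The term with lag t - s of the supremum. The energy estimates use the supremum in this
  form: seen from t, the source at time s is at most the radius inflated at rate \<kappa>.\<close>

lemma source_le_\<rho>:
  assumes \<omega>: "\<omega> \<in> \<Omega>" and "s \<le> t"
  shows "source (\<theta> s \<omega>) \<le> exp (\<kappa> * (t - s)) * \<rho> (\<theta> t \<omega>)"
proof -
  have "exp (- \<kappa> * \<bar>t - s\<bar>) * source (\<theta> (- \<bar>t - s\<bar>) (\<theta> t \<omega>)) \<le> \<rho> (\<theta> t \<omega>)"
    unfolding \<rho>_def by (rule cSUP_upper[OF UNIV_I bdd_above_\<rho>[OF shift_mem[OF \<omega>]]])
  then have "exp (- (\<kappa> * (t - s))) * source (\<theta> s \<omega>) \<le> \<rho> (\<theta> t \<omega>)"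
    using assms(2) by (simp add: wiener_shift_shift)
  then have "exp (\<kappa> * (t - s)) * (exp (- (\<kappa> * (t - s))) * source (\<theta> s \<omega>)) \<le> exp (\<kappa> * (t - s)) * \<rho> (\<theta> t \<omega>)"
    by (intro mult_left_mono) auto
  then show ?thesis by (simp flip: mult.assoc exp_add)
qed

lemma \<rho>_ge_1: "\<omega> \<in> \<Omega> \<Longrightarrow> 1 \<le> \<rho> \<omega>"
  using source_le_\<rho>[of \<omega> 0 0] source_ge_1[of "\<theta> 0 \<omega>"] by (simp add: shift_0)

text \<open>The energy decays at rate 2 \<kappa>, whereas the bound on the forcing, measured by the
  radius at the final time, decreases only at rate \<kappa>. Integration therefore leaves the factor
  1 - exp (- \<kappa> t) in place of 1; that deficit is what absorption exploits.\<close>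

lemma energy_decay:
  assumes \<omega>: "\<omega> \<in> \<Omega>" and t: "t \<ge> 0"
  shows "energy (\<phi> t x \<omega>) \<le> exp (- 2 * \<kappa> * t) * energy x + (1 - exp (- \<kappa> * t)) * \<rho> (\<theta> t \<omega>)"
proof -
  define r where "r = \<rho> (\<theta> t \<omega>)"
  define E where "E s = energy (\<phi> s x \<omega>)" for s
  define E' where "E' s = (\<Sum>i\<in>UNIV. (1/4) ^ depth i * (2 * gap (\<phi> s x \<omega>) i * gap (vf (\<theta> s \<omega>) (\<phi> s x \<omega>)) i))" for s
  have dE: "(E has_real_derivative E' s) (at s)" for s
    unfolding E_def E'_def by (rule energy_has_real_derivative[OF \<phi>_derivative[OF \<omega>]])
  have E': "E' s \<le> - 2 * \<kappa> * E s + \<kappa> * (exp (\<kappa> * (t - s)) * r)" if "s \<le> t" for s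
  proof -
    have "E' s \<le> - (k / 2) * E s + 8 * real CARD('n) / k * (load (\<theta> s \<omega>))\<^sup>2"
      unfolding E'_def E_def vf_eq by (rule energy_rate_le[OF k_pos drift_le_load])
    also have "8 * real CARD('n) / k * (load (\<theta> s \<omega>))\<^sup>2 = \<kappa> * (source (\<theta> s \<omega>) - 1)"
      using k_pos by (simp add: \<kappa>_def source_def power2_eq_square field_simps)
    also have "\<dots> \<le> \<kappa> * (exp (\<kappa> * (t - s)) * r)"
      using source_le_\<rho>[OF \<omega> that] \<kappa>_pos by (intro mult_left_mono) (auto simp: r_def)
    finally show ?thesis by (simp add: \<kappa>_def)
  qed
  \<comment> \<open>The subtracted term has as its derivative exactly the integrating factor exp (2
    \<kappa> s) times the bound on the forcing.\<close>
  let ?f = "\<lambda>s. exp (2 * \<kappa> * s) * E s - r * exp (\<kappa> * (t + s))"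
  have "?f t \<le> ?f 0"
  proof (rule DERIV_nonpos_imp_nonincreasing[OF t, where f = ?f])
    fix s assume s: "0 \<le> s" "s \<le> t"
    let ?d = "exp (2 * \<kappa> * s) * (E' s + 2 * \<kappa> * E s) - r * (exp (\<kappa> * (t + s)) * \<kappa>)"
    have "(?f has_real_derivative ?d) (at s)"
      by (rule derivative_eq_intros dE refl)+ (simp add: algebra_simps)
    moreover have "exp (2 * \<kappa> * s) * (E' s + 2 * \<kappa> * E s) \<le> exp (2 * \<kappa> * s) * (\<kappa> * (exp (\<kappa> * (t - s)) * r))"
      using E'[OF s(2)] by (intro mult_left_mono) auto
    then have "?d \<le> 0"
      by (simp add: algebra_simps flip: exp_add)
    ultimately show "\<exists>y. (?f has_real_derivative y) (at s) \<and> y \<le> 0" by blast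
  qed
  then have "exp (2 * \<kappa> * t) * E t \<le> energy x + r * (exp (2 * \<kappa> * t) - exp (\<kappa> * t))"
    using \<omega> by (simp add: E_def algebra_simps)
  then have "exp (- 2 * \<kappa> * t) * (exp (2 * \<kappa> * t) * E t)
      \<le> exp (- 2 * \<kappa> * t) * (energy x + r * (exp (2 * \<kappa> * t) - exp (\<kappa> * t)))"
    by (intro mult_left_mono) auto
  also have "\<dots> = exp (- 2 * \<kappa> * t) * energy x
      + r * (exp (- 2 * \<kappa> * t) * exp (2 * \<kappa> * t) - exp (- 2 * \<kappa> * t) * exp (\<kappa> * t))"
    by (simp add: algebra_simps)
  also have "exp (- 2 * \<kappa> * t) * exp (2 * \<kappa> * t) = 1"
    by (simp flip: exp_add)
  also have "exp (- 2 * \<kappa> * t) * exp (\<kappa> * t) = exp (- \<kappa> * t)"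
    by (simp flip: exp_add)
  finally show ?thesis
    using exp_minus_inverse[of "2 * \<kappa> * t"]
    by (simp add: E_def r_def mult.commute[of "\<rho> _"] flip: mult.assoc exp_add)
qed

text \<open>The initial energy arrives multiplied by exp (- 2 \<kappa> t); under the hypothesis it
  fits into the deficit exp (- \<kappa> t) \<rho> left by the decay estimate. Invariance and
  absorption are both instances.\<close>

lemma energy_absorbed:
  assumes "\<omega> \<in> \<Omega>" "t \<ge> 0" "exp (- \<kappa> * t) * energy x \<le> \<rho> (\<theta> t \<omega>)"
  shows "energy (\<phi> t x \<omega>) \<le> \<rho> (\<theta> t \<omega>)"
proof -
  have "exp (- 2 * \<kappa> * t) * energy x = exp (- \<kappa> * t) * (exp (- \<kappa> * t) * energy x)"
    by (simp flip: exp_add mult.assoc)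
  also have "\<dots> \<le> exp (- \<kappa> * t) * \<rho> (\<theta> t \<omega>)"
    using assms(3) by (intro mult_left_mono) auto
  finally show ?thesis
    using energy_decay[OF assms(1,2), of x] by (simp add: algebra_simps)
qed

text \<open>The past of time 0 is part of the past of t, so along a path the radius shrinks at most
  at rate \<kappa>. The energy is damped faster, which is why the absorbing sets are forward
  invariant.\<close>

lemma \<rho>_decay: "\<omega> \<in> \<Omega> \<Longrightarrow> t \<ge> 0 \<Longrightarrow> exp (- \<kappa> * t) * \<rho> \<omega> \<le> \<rho> (\<theta> t \<omega>)"
proof -
  assume \<omega>: "\<omega> \<in> \<Omega>" and t: "t \<ge> 0"
  have "\<rho> \<omega> \<le> exp (\<kappa> * t) * \<rho> (\<theta> t \<omega>)"
  proof (subst \<rho>_def, rule cSUP_least)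
    fix u
    have "source (\<theta> (- \<bar>u\<bar>) \<omega>) \<le> exp (\<kappa> * (t - - \<bar>u\<bar>)) * \<rho> (\<theta> t \<omega>)"
      using t by (intro source_le_\<rho>[OF \<omega>]) auto
    then have "exp (- \<kappa> * \<bar>u\<bar>) * source (\<theta> (- \<bar>u\<bar>) \<omega>) \<le> exp (- \<kappa> * \<bar>u\<bar>) * (exp (\<kappa> * (t - - \<bar>u\<bar>)) * \<rho> (\<theta> t \<omega>))"
      by (intro mult_left_mono) auto
    also have "\<dots> = exp (- \<kappa> * \<bar>u\<bar> + \<kappa> * (t - - \<bar>u\<bar>)) * \<rho> (\<theta> t \<omega>)"
      by (simp only: exp_add mult.assoc)
    also have "- \<kappa> * \<bar>u\<bar> + \<kappa> * (t - - \<bar>u\<bar>) = \<kappa> * t"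
      by (simp add: algebra_simps)
    finally show "exp (- \<kappa> * \<bar>u\<bar>) * source (\<theta> (- \<bar>u\<bar>) \<omega>) \<le> exp (\<kappa> * t) * \<rho> (\<theta> t \<omega>)" .
  qed auto
  then show ?thesis by (simp add: exp_minus field_simps)
qed

lemma energy_invariant:
  assumes "\<omega> \<in> \<Omega>" "t \<ge> 0" "energy x \<le> \<rho> \<omega>"
  shows "energy (\<phi> t x \<omega>) \<le> \<rho> (\<theta> t \<omega>)"
proof (rule energy_absorbed[OF assms(1,2)])
  have "exp (- \<kappa> * t) * energy x \<le> exp (- \<kappa> * t) * \<rho> \<omega>"
    by (intro mult_left_mono assms) auto
  also note \<rho>_decay[OF assms(1,2)]
  finally show "exp (- \<kappa> * t) * energy x \<le> \<rho> (\<theta> t \<omega>)" .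
qed

end

section \<open>Measurability\<close>

text \<open>A Caratheodory function is jointly measurable: rounding s down to the grid of mesh
  1/(n+1) leaves countably many measurable pieces, and continuity in s gives the limit.\<close>

lemma borel_measurable_pair_of_continuous:
  fixes f :: "'a \<Rightarrow> real \<Rightarrow> 'b::metric_space"
  assumes meas: "\<And>s. (\<lambda>\<omega>. f \<omega> s) \<in> borel_measurable M"
    and cont: "\<And>\<omega>. \<omega> \<in> space M \<Longrightarrow> continuous_on UNIV (f \<omega>)"
  shows "(\<lambda>p. f (fst p) (snd p)) \<in> borel_measurable (M \<Otimes>\<^sub>M lborel)"
proof (rule borel_measurable_LIMSEQ_metric)
  fix n :: nat
  have "(\<lambda>p :: 'a \<times> real. \<lfloor>real (Suc n) * snd p\<rfloor>) \<in> measurable (M \<Otimes>\<^sub>M lborel) (count_space UNIV)"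
    by measurable
  moreover have "(\<lambda>p. f (fst p) (of_int i / real (Suc n))) \<in> borel_measurable (M \<Otimes>\<^sub>M lborel)" for i :: int
    by (rule measurable_compose[OF measurable_fst meas])
  ultimately show "(\<lambda>p. f (fst p) (of_int \<lfloor>real (Suc n) * snd p\<rfloor> / real (Suc n)))
      \<in> borel_measurable (M \<Otimes>\<^sub>M lborel)"
    by (rule measurable_compose_countable[rotated])
next
  fix p :: "'a \<times> real" assume "p \<in> space (M \<Otimes>\<^sub>M lborel)"
  then have p: "fst p \<in> space M" by (auto simp: space_pair_measure)
  let ?s = "\<lambda>n. of_int \<lfloor>real (Suc n) * snd p\<rfloor> / real (Suc n)"
  have "?s \<longlonglongrightarrow> snd p"
  proof (rule LIMSEQ_I)
    fix e :: real assume "e > 0"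
    then obtain N where N: "inverse (real (Suc N)) < e" using reals_Archimedean by blast
    have "norm (?s n - snd p) < e" if "n \<ge> N" for n
    proof -
      have "\<bar>of_int \<lfloor>real (Suc n) * snd p\<rfloor> - real (Suc n) * snd p\<bar> \<le> 1" by linarith
      then have "\<bar>(of_int \<lfloor>real (Suc n) * snd p\<rfloor> - real (Suc n) * snd p) / real (Suc n)\<bar> \<le> inverse (real (Suc n))"
        by (simp add: abs_divide divide_right_mono inverse_eq_divide del: of_nat_Suc)
      also have "\<dots> \<le> inverse (real (Suc N))" using that by simp
      finally show ?thesis using N by (simp add: diff_divide_distrib del: of_nat_Suc)
    qed
    then show "\<exists>no. \<forall>n\<ge>no. norm (?s n - snd p) < e" by blast
  qed
  then show "(\<lambda>n. f (fst p) (?s n)) \<longlonglongrightarrow> f (fst p) (snd p)"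
    by (intro continuous_on_tendsto_compose[OF cont[OF p]]) auto
qed

lemma borel_measurable_parametric_LBINT:
  fixes f :: "'a \<Rightarrow> real \<Rightarrow> 'b::euclidean_space"
  assumes "\<And>s. (\<lambda>\<omega>. f \<omega> s) \<in> borel_measurable M"
    and "\<And>\<omega>. \<omega> \<in> space M \<Longrightarrow> continuous_on UNIV (f \<omega>)"
  shows "(\<lambda>\<omega>. LBINT s=ereal a..ereal b. f \<omega> s) \<in> borel_measurable M"
proof -
  note [measurable] = borel_measurable_pair_of_continuous[OF assms]
  have "(\<lambda>\<omega>. LBINT s:A. f \<omega> s) \<in> borel_measurable M" if [measurable]: "A \<in> sets lborel" for A
    unfolding set_lebesgue_integral_def
  proof (rule lborel.borel_measurable_lebesgue_integral)
    show "(\<lambda>(\<omega>, s). indicator A s *\<^sub>R f \<omega> s) \<in> borel_measurable (M \<Otimes>\<^sub>M lborel)"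
      unfolding case_prod_beta by measurable
  qed
  then show ?thesis
    unfolding interval_lebesgue_integral_def by (cases "ereal a \<le> ereal b") auto
qed

lemma integral_atMost_tendsto:
  fixes f :: "real \<Rightarrow> 'a::banach"
  assumes "f integrable_on {..0}"
  shows "(\<lambda>n. integral {- real n..0} f) \<longlonglongrightarrow> integral {..0} f"
proof (rule LIMSEQ_I)
  fix e :: real assume "e > 0"
  moreover have "(f has_integral integral {..0} f) {..0}" using assms by (rule integrable_integral)
  ultimately obtain B where B: "\<And>a b. ball 0 B \<subseteq> cbox a b \<Longrightarrow>
      norm (integral (cbox a b) (\<lambda>x. if x \<in> {..0} then f x else 0) - integral {..0} f) < e"
    unfolding has_integral_alt'[of f] by blast
  have "norm (integral {- real n..0} f - integral {..0} f) < e" if n: "n \<ge> nat \<lceil>B\<rceil>" for n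
  proof -
    have "B \<le> real n" using n by linarith
    then have "ball 0 B \<subseteq> cbox (- real n) (real n)" by (auto simp: dist_real_def)
    then show ?thesis
    proof -
      have "{..0} \<inter> cbox (- real n) (real n) = {- real n..0}" by auto
      then show ?thesis
        using B[OF \<open>ball 0 B \<subseteq> cbox (- real n) (real n)\<close>] unfolding integral_restrict_Int by simp
    qed
  qed
  then show "\<exists>no. \<forall>n\<ge>no. norm (integral {- real n..0} f - integral {..0} f) < e" by blast
qed

lemma borel_measurable_vecI:
  fixes f :: "'a \<Rightarrow> real ^ 'n::finite"
  assumes "\<And>i. (\<lambda>x. f x $ i) \<in> borel_measurable M"
  shows "f \<in> borel_measurable M"
  using assms by (subst borel_measurable_euclidean_space) (auto simp: Basis_vec_def inner_axis)

lemma borel_measurable_vec_nth_comp [measurable (raw)]: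
  "f \<in> borel_measurable M \<Longrightarrow> (\<lambda>x. (f x :: real ^ 'n::finite) $ i) \<in> borel_measurable M"
  by (rule measurable_compose[OF _ borel_measurable_nth])

lemma SUP_eq_SUP_Rats:
  fixes F :: "real \<Rightarrow> real"
  assumes "continuous_on UNIV F" "bdd_above (range F)"
  shows "(SUP u. F u) = (SUP u\<in>\<rat>. F u)"
proof (rule antisym)
  have bdd: "bdd_above (F ` \<rat>)" using assms(2) by (rule bdd_above_mono) auto
  show "(SUP u. F u) \<le> (SUP u\<in>\<rat>. F u)"
  proof (rule cSUP_least)
    fix u
    show "F u \<le> (SUP u\<in>\<rat>. F u)"
      by (rule continuous_le_on_closure[of \<rat>]) (auto simp: Rats_closure_real assms(1) intro!: cSUP_upper bdd)
  qed auto
  show "(SUP u\<in>\<rat>. F u) \<le> (SUP u. F u)"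
    by (rule cSUP_subset_mono[OF _ assms(2)]) auto
qed

section \<open>Measurable dependence of noise, flow and radius on the path\<close>

context chain_system
begin

abbreviation M :: "'n path measure" where "M \<equiv> restrict_space P \<Omega>"

lemma space_M [simp]: "space M = \<Omega>"
  using \<Omega>_paths by (auto simp: space_restrict_space space_P)

text \<open>The preimage of an open set is a subbasic set of the compact-open topology, with the
  compact set {t}.\<close>

lemma eval_measurable: "(\<lambda>\<omega>. \<omega> t) \<in> borel_measurable M"
proof (rule measurable_restrict_space1, rule borel_measurableI)
  fix S :: "'n rvec set" assume S: "open S"
  let ?K = "{{\<omega> \<in> wiener_paths. \<omega> ` K \<subseteq> U} | K (U :: 'n rvec set). compact K \<and> open U}"
  have "{\<omega> \<in> wiener_paths. \<omega> ` {t} \<subseteq> S} \<in> ?K"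
    using S by (intro CollectI exI[of _ "{t}"] exI[of _ S]) auto
  then have "openin compact_open_topology {\<omega> \<in> wiener_paths. \<omega> ` {t} \<subseteq> S}"
    unfolding compact_open_topology_def by (rule topology_generated_by_Basis)
  moreover have "topspace compact_open_topology \<subseteq> (wiener_paths :: 'n path set)"
    unfolding compact_open_topology_def topology_generated_by_topspace by auto
  then have "{U. openin compact_open_topology U} \<subseteq> Pow (wiener_paths :: 'n path set)"
    using openin_subset by blast
  ultimately have "{\<omega> \<in> wiener_paths. \<omega> ` {t} \<subseteq> S} \<in> sets path_borel"
    unfolding path_borel_def by (simp add: sets_measure_of)
  moreover have "(\<lambda>\<omega>. \<omega> t) -` S \<inter> space P = {\<omega> \<in> wiener_paths. \<omega> ` {t} \<subseteq> S}"
    by (auto simp: space_P)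
  ultimately show "(\<lambda>\<omega>. \<omega> t) -` S \<inter> space P \<in> sets P"
    using wiener by (simp add: wiener_measure_def)
qed

lemma z_measurable: "(\<lambda>\<omega>. z i (\<theta> t \<omega>)) \<in> borel_measurable M"
proof -
  let ?f = "\<lambda>\<omega> \<tau>. exp \<tau> * \<theta> t \<omega> \<tau> $ i"
  have cont: "continuous_on UNIV (?f \<omega>)" if "\<omega> \<in> \<Omega>" for \<omega>
  proof -
    have c: "continuous_on UNIV \<omega>" using that \<Omega>_paths by (auto simp: wiener_paths_def)
    show ?thesis unfolding wiener_shift_def
      by (intro continuous_intros continuous_on_compose2[OF c]) auto
  qed
  have meas: "(\<lambda>\<omega>. LBINT \<tau>=ereal (- real n)..ereal 0. ?f \<omega> \<tau>) \<in> borel_measurable M" for n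
  proof (rule borel_measurable_parametric_LBINT)
    note [measurable] = eval_measurable
    show "(\<lambda>\<omega>. ?f \<omega> \<tau>) \<in> borel_measurable M" for \<tau>
      unfolding wiener_shift_def by measurable
  qed (simp add: cont)
  have "(\<lambda>\<omega>. integral {..0} (?f \<omega>)) \<in> borel_measurable M"
  proof (rule borel_measurable_LIMSEQ_metric[OF meas])
    fix \<omega> assume "\<omega> \<in> space M"
    then have \<omega>: "\<omega> \<in> \<Omega>" by simp
    have "(LBINT \<tau>=ereal (- real n)..ereal 0. ?f \<omega> \<tau>) = integral {- real n..0} (?f \<omega>)" for n
      by (rule interval_integral_eq_integral)
        (auto intro!: borel_integrable_atLeastAtMost' continuous_on_subset[OF cont[OF \<omega>]])
    then show "(\<lambda>n. LBINT \<tau>=ereal (- real n)..ereal 0. ?f \<omega> \<tau>) \<longlonglongrightarrow> integral {..0} (?f \<omega>)"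
      using integral_atMost_tendsto[OF z_integrable[OF shift_mem[OF \<omega>]]] by simp
  qed
  then show ?thesis unfolding ou_def by simp
qed

lemma forcing_measurable: "(\<lambda>\<omega>. forcing k \<epsilon> (\<theta> t \<omega>)) \<in> borel_measurable M"
proof (rule borel_measurable_vecI)
  note [measurable] = z_measurable
  show "(\<lambda>\<omega>. forcing k \<epsilon> (\<theta> t \<omega>) $ i) \<in> borel_measurable M" for i
    by (cases "i = idx1") (simp_all add: forcing_def)
qed

lemma vf_measurable:
  assumes [measurable]: "u \<in> borel_measurable M"
  shows "(\<lambda>\<omega>. vf (\<theta> t \<omega>) (u \<omega>)) \<in> borel_measurable M"
proof (rule borel_measurable_vecI)
  note [measurable] = z_measurable forcing_measurable
  show "(\<lambda>\<omega>. vf (\<theta> t \<omega>) (u \<omega>) $ i) \<in> borel_measurable M" for i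
    by (cases "i = idx1") (simp_all add: vf_eq chain_matrix_mult drift_def gap_def)
qed

text \<open>Induction over the Picard iterates; the claim is made for all times at once because the
  next iterate integrates over them. The start value may depend on the path, since the radius enters
  it later, and the shift by r allows a start in the past.\<close>

lemma \<phi>_measurable:
  assumes u: "u \<in> borel_measurable M"
  shows "(\<lambda>\<omega>. \<phi> t (u \<omega>) (\<theta> r \<omega>)) \<in> borel_measurable M"
proof (rule borel_measurable_LIMSEQ_metric)
  show "(\<lambda>\<omega>. picard (\<lambda>t. vf (\<theta> t (\<theta> r \<omega>))) (u \<omega>) n t) \<in> borel_measurable M" for n
  proof (induction n arbitrary: t)
    case 0
    then show ?case using u by simp
  next
    case (Suc n)
    have "(\<lambda>\<omega>. LBINT s=ereal 0..ereal t. vf (\<theta> s (\<theta> r \<omega>)) (picard (\<lambda>t. vf (\<theta> t (\<theta> r \<omega>))) (u \<omega>) n s))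
        \<in> borel_measurable M"
    proof (rule borel_measurable_parametric_LBINT)
      show "(\<lambda>\<omega>. vf (\<theta> s (\<theta> r \<omega>)) (picard (\<lambda>t. vf (\<theta> t (\<theta> r \<omega>))) (u \<omega>) n s)) \<in> borel_measurable M" for s
        using vf_measurable[OF Suc[of s], of "s + r"] by (simp add: wiener_shift_shift)
      fix \<omega> assume "\<omega> \<in> space M"
      then interpret lipschitz_field "\<lambda>t. vf (\<theta> t (\<theta> r \<omega>))" lip
        by (intro lipschitz_field shift_mem) simp
      show "continuous_on UNIV (\<lambda>s. vf (\<theta> s (\<theta> r \<omega>)) (picard (\<lambda>t. vf (\<theta> t (\<theta> r \<omega>))) (u \<omega>) n s))"
        by (rule continuous_along[OF continuous_picard])
    qed
    then show ?case using u by simp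
  qed
  fix \<omega> assume "\<omega> \<in> space M"
  then show "(\<lambda>n. picard (\<lambda>t. vf (\<theta> t (\<theta> r \<omega>))) (u \<omega>) n t) \<longlonglongrightarrow> \<phi> t (u \<omega>) (\<theta> r \<omega>)"
    by (intro \<phi>_picard shift_mem) simp
qed

lemma \<rho>_measurable: "(\<lambda>\<omega>. \<rho> (\<theta> t \<omega>)) \<in> borel_measurable M"
proof -
  let ?F = "\<lambda>\<omega> u. exp (- \<kappa> * \<bar>u\<bar>) * source (\<theta> (- \<bar>u\<bar>) (\<theta> t \<omega>))"
  note [measurable] = forcing_measurable
  have "(\<lambda>\<omega>. SUP u\<in>\<rat>. ?F \<omega> u) \<in> borel_measurable M"
  proof (rule borel_measurable_cSUP)
    show "(\<lambda>\<omega>. ?F \<omega> u) \<in> borel_measurable M" for u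
      unfolding source_def load_def wiener_shift_shift by measurable
    show "bdd_above ((\<lambda>u. ?F \<omega> u) ` \<rat>)" if "\<omega> \<in> space M" for \<omega>
      by (rule bdd_above_mono[OF bdd_above_\<rho>[OF shift_mem]]) (use that in auto)
  qed (rule countable_rat)
  moreover have "\<rho> (\<theta> t \<omega>) = (SUP u\<in>\<rat>. ?F \<omega> u)" if "\<omega> \<in> space M" for \<omega>
  proof -
    have \<omega>: "\<theta> t \<omega> \<in> \<Omega>" using that shift_mem by simp
    have "continuous_on UNIV (\<lambda>u :: real. source (\<theta> (- \<bar>u\<bar>) (\<theta> t \<omega>)))"
      by (rule continuous_on_compose2[OF continuous_source[OF \<omega>, of UNIV]]) (auto intro!: continuous_intros)
    then have "continuous_on UNIV (?F \<omega>)" by (intro continuous_intros)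
    then show ?thesis unfolding \<rho>_def by (rule SUP_eq_SUP_Rats[OF _ bdd_above_\<rho>[OF \<omega>]])
  qed
  ultimately show ?thesis by (subst measurable_cong) auto
qed

end

section \<open>The attractor\<close>

lemma semidist_le:
  assumes "\<And>x. x \<in> B1 \<Longrightarrow> infdist x B2 < e" "B2 \<noteq> {}"
  shows "semidist B1 B2 \<le> ennreal e"
  unfolding semidist_def
proof (rule SUP_least)
  fix x assume "x \<in> B1"
  then have "(INF y\<in>B2. dist x y) < e" using assms by (simp add: infdist_def)
  then obtain y where y: "y \<in> B2" "dist x y < e"
    using assms(2) cInf_lessD[of "dist x ` B2" e] by auto
  then have "(INF y\<in>B2. ennreal (dist x y)) \<le> ennreal (dist x y)" by (intro INF_lower)
  also have "\<dots> \<le> ennreal e" using y by (intro ennreal_leI) simp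
  finally show "(INF y\<in>B2. ennreal (dist x y)) \<le> ennreal e" .
qed

lemma nested_compact_subset_open:
  fixes K :: "nat \<Rightarrow> 'a::heine_borel set"
  assumes "\<And>n. compact (K n)" "\<And>m n. m \<le> n \<Longrightarrow> K n \<subseteq> K m" "open U" "\<Inter>(range K) \<subseteq> U"
  obtains n where "K n \<subseteq> U"
proof (rule ccontr)
  assume "\<not> thesis"
  then have "K n - U \<noteq> {}" for n using that by blast
  moreover have "K n - U \<subseteq> K m - U" if "m \<le> n" for m n
    using assms(2)[OF that] by blast
  ultimately have "\<Inter>(range (\<lambda>n. K n - U)) \<noteq> {}"
    using assms(1,3) by (intro compact_nest compact_diff)
  then show False using assms(4) by auto
qed

lemma infdist_image_dense:
  fixes f :: "'a::metric_space \<Rightarrow> 'b::metric_space"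
  assumes "continuous_on (closure S) f" "S \<subseteq> W" "W \<subseteq> closure S" "S \<noteq> {}"
  shows "infdist p (f ` W) = (INF w\<in>S. dist p (f w))"
proof (rule antisym)
  show "infdist p (f ` W) \<le> (INF w\<in>S. dist p (f w))"
    using assms by (intro cINF_greatest infdist_le) auto
  have "(INF w\<in>S. dist p (f w)) \<le> dist p (f w)" if "w \<in> W" for w
  proof (rule continuous_ge_on_closure[where S = S and f = "\<lambda>w. dist p (f w)"])
    show "(INF w\<in>S. dist p (f w)) \<le> dist p (f w)" if "w \<in> S" for w
      using that by (intro cINF_lower) (auto intro!: bdd_belowI[of _ 0])
  qed (use that assms in \<open>auto intro!: continuous_intros\<close>)
  then show "(INF w\<in>S. dist p (f w)) \<le> infdist p (f ` W)"
    using assms(2,4) unfolding infdist_def by (auto simp: image_image intro!: cINF_greatest)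
qed

text \<open>A radius growing like exp (s t / 4) enters the energy squared, hence with rate s / 2,
  which the discount s still beats. The parameter d accounts for stopping d before the final
  time.\<close>

lemma exp_decay_dominates:
  fixes a b c d s :: real assumes "s > 0"
  shows "((\<lambda>t. exp (- s * (t - d)) * (2 * a + 2 * (b * (2 * (c * exp (s * t / 4)))\<^sup>2))) \<longlongrightarrow> 0) at_top"
proof -
  have "((\<lambda>t. exp (- s * t)) \<longlongrightarrow> 0) at_top" "((\<lambda>t. exp (- s * t / 2)) \<longlongrightarrow> 0) at_top"
    using assms by real_asymp+
  then have "((\<lambda>t. 2 * a * exp (s * d) * exp (- s * t) + 8 * b * c\<^sup>2 * exp (s * d) * exp (- s * t / 2))
      \<longlongrightarrow> 2 * a * exp (s * d) * 0 + 8 * b * c\<^sup>2 * exp (s * d) * 0) at_top"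
    by (intro tendsto_intros)
  moreover have "exp (- s * (t - d)) * (2 * a + 2 * (b * (2 * (c * exp (s * t / 4)))\<^sup>2))
      = 2 * a * exp (s * d) * exp (- s * t) + 8 * b * c\<^sup>2 * exp (s * d) * exp (- s * t / 2)" for t
  proof -
    have "exp (- s * (t - d)) = exp (s * d) * exp (- s * t)"
      by (simp add: algebra_simps flip: exp_add)
    moreover have "exp (- s * t) * (exp (s * t / 4))\<^sup>2 = exp (- s * t / 2)"
      by (simp flip: exp_double exp_add)
    ultimately have "exp (- s * (t - d)) * (2 * a + 8 * b * c\<^sup>2 * (exp (s * t / 4))\<^sup>2)
        = 2 * a * exp (s * d) * exp (- s * t) + 8 * b * c\<^sup>2 * exp (s * d) * exp (- s * t / 2)"
      by algebra
    then show ?thesis by (simp add: power_mult_distrib mult.assoc)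
  qed
  ultimately show ?thesis by simp
qed

section \<open>Pullback layers and the attractor cut out by them\<close>

context chain_system
begin

text \<open>The image under the flow of the absorbing set that sits n time units in the past,
  expressed through the backward flow so that membership is one inequality. Integer times give a
  countable nested family.\<close>

definition layer :: "nat \<Rightarrow> 'n path \<Rightarrow> 'n rvec set" where
  "layer n \<omega> = {x. energy (\<phi> (- real n) x \<omega>) \<le> \<rho> (\<theta> (- real n) \<omega>)}"

text \<open>For paths in \<Omega> this is the full preimage of the attractor in
  \<open>real ^ 'n\<close>. Quantifying over all times makes invariance under the flow
  immediate.\<close>

definition lift :: "'n path \<Rightarrow> 'n rvec set" where
  "lift \<omega> = {x. \<forall>t. energy (\<phi> t x \<omega>) \<le> \<rho> (\<theta> t \<omega>)}"

definition attractor :: "'n path \<Rightarrow> 'n phase set" where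
  "attractor \<omega> = proj ` lift \<omega>"

lemma energy_forward:
  assumes \<omega>: "\<omega> \<in> \<Omega>" and "s \<le> t" "energy (\<phi> s x \<omega>) \<le> \<rho> (\<theta> s \<omega>)"
  shows "energy (\<phi> t x \<omega>) \<le> \<rho> (\<theta> t \<omega>)"
  using energy_invariant[OF shift_mem[OF \<omega>, of s], of "t - s" "\<phi> s x \<omega>"] assms(2,3)
    \<phi>_cocycle[OF \<omega>, of "t - s" s x]
  by (simp add: wiener_shift_shift)

lemma layer_mono: "\<omega> \<in> \<Omega> \<Longrightarrow> m \<le> n \<Longrightarrow> layer n \<omega> \<subseteq> layer m \<omega>"
  unfolding layer_def using energy_forward[of \<omega> "- real n" "- real m"] by auto

text \<open>Forward invariance of the absorbing sets carries the condition from a nonpositive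
  integer time below t to t itself, so these integer times already imply all times.\<close>

lemma lift_eq: "\<omega> \<in> \<Omega> \<Longrightarrow> lift \<omega> = (\<Inter>n. layer n \<omega>)"
proof (intro equalityI subsetI)
  fix x assume \<omega>: "\<omega> \<in> \<Omega>" and x: "x \<in> (\<Inter>n. layer n \<omega>)"
  have "energy (\<phi> t x \<omega>) \<le> \<rho> (\<theta> t \<omega>)" for t
  proof (rule energy_forward[OF \<omega>])
    show "- real (nat \<lceil>- t\<rceil>) \<le> t" by linarith
    show "energy (\<phi> (- real (nat \<lceil>- t\<rceil>)) x \<omega>) \<le> \<rho> (\<theta> (- real (nat \<lceil>- t\<rceil>)) \<omega>)"
      using x unfolding layer_def by blast
  qed
  then show "x \<in> lift \<omega>" by (simp add: lift_def)
qed (auto simp: lift_def layer_def)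

lemma lift_image: "\<omega> \<in> \<Omega> \<Longrightarrow> (\<lambda>x. \<phi> t x \<omega>) ` lift \<omega> = lift (\<theta> t \<omega>)"
proof -
  assume \<omega>: "\<omega> \<in> \<Omega>"
  have sub: "\<phi> t x \<omega> \<in> lift (\<theta> t \<omega>)" if "x \<in> lift \<omega>" "\<omega> \<in> \<Omega>" for x t \<omega>
    using that by (simp add: lift_def wiener_shift_shift flip: \<phi>_cocycle)
  have "y \<in> (\<lambda>x. \<phi> t x \<omega>) ` lift \<omega>" if "y \<in> lift (\<theta> t \<omega>)" for y
  proof (rule image_eqI)
    show "\<phi> (- t) y (\<theta> t \<omega>) \<in> lift \<omega>"
      using sub[OF that shift_mem[OF \<omega>], of "- t"] \<omega> by (simp add: wiener_shift_shift shift_0)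
    show "y = \<phi> t (\<phi> (- t) y (\<theta> t \<omega>)) \<omega>"
      using \<phi>_inverse(2)[OF shift_mem[OF \<omega>, of t], of t y] \<omega> by (simp add: wiener_shift_shift shift_0)
  qed
  with sub[OF _ \<omega>] show ?thesis by blast
qed

lemma layer_deck: "\<omega> \<in> \<Omega> \<Longrightarrow> x \<in> layer n \<omega> \<Longrightarrow> x + vec (2 * pi * of_int m) \<in> layer n \<omega>"
  unfolding layer_def by (simp add: \<phi>_deck)

lemma lift_deck: "\<omega> \<in> \<Omega> \<Longrightarrow> x \<in> lift \<omega> \<Longrightarrow> x + vec (2 * pi * of_int m) \<in> lift \<omega>"
  by (simp add: lift_eq layer_deck)

text \<open>Layers are invariant under deck translations and so never compact; confining the first
  component to a compact set makes them so. The slab [0, 2 pi] represents all classes, and a single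
  value gives a fibre.\<close>

definition core :: "real set \<Rightarrow> nat \<Rightarrow> 'n path \<Rightarrow> 'n rvec set" where
  "core S n \<omega> = {x \<in> layer n \<omega>. x $ idx1 \<in> S}"

lemma layer_energy_le: "\<omega> \<in> \<Omega> \<Longrightarrow> x \<in> layer n \<omega> \<Longrightarrow> energy x \<le> \<rho> \<omega>"
  using layer_mono[of \<omega> 0 n] by (auto simp: layer_def shift_0)

lemma compact_core:
  assumes \<omega>: "\<omega> \<in> \<Omega>" and S: "compact S"
  shows "compact (core S n \<omega>)"
  unfolding compact_eq_bounded_closed
proof
  obtain c where c: "0 < c" "\<And>x :: 'n rvec. norm x \<le> c * (\<bar>x $ idx1\<bar> + sqrt (energy x))"
    using norm_le_energy by blast
  obtain b where b: "\<And>s. s \<in> S \<Longrightarrow> \<bar>s\<bar> \<le> b"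
    using compact_imp_bounded[OF S] by (auto simp: bounded_iff)
  show "bounded (core S n \<omega>)"
    unfolding bounded_iff
  proof (intro exI ballI)
    fix x assume x: "x \<in> core S n \<omega>"
    have "norm x \<le> c * (\<bar>x $ idx1\<bar> + sqrt (energy x))" by (rule c)
    also have "\<dots> \<le> c * (b + sqrt (\<rho> \<omega>))"
      using x c(1) layer_energy_le[OF \<omega>, of x n] b
      by (intro mult_left_mono add_mono real_sqrt_le_mono) (auto simp: core_def)
    finally show "norm x \<le> c * (b + sqrt (\<rho> \<omega>))" .
  qed
  have "closed {x. energy (\<phi> (- real n) x \<omega>) \<le> \<rho> (\<theta> (- real n) \<omega>)}"
    by (intro closed_Collect_le continuous_intros continuous_on_\<phi>[OF \<omega>])
  moreover have "closed ((\<lambda>x :: 'n rvec. x $ idx1) -` S)"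
    by (intro closed_vimage compact_imp_closed S continuous_intros)
  ultimately show "closed (core S n \<omega>)"
    unfolding core_def layer_def by (simp add: Collect_conj_eq vimage_def closed_Int)
qed

text \<open>A vector with equal components has energy 0 and lies in the absorbing set at time -n.
  Its value is the first component reached by flowing back from s; as the first component evolves
  autonomously, flowing forward returns to s.\<close>

lemma core_nonempty:
  assumes \<omega>: "\<omega> \<in> \<Omega>" and s: "s \<in> S" shows "core S n \<omega> \<noteq> {}"
proof -
  let ?\<omega> = "\<theta> (- real n) \<omega>"
  let ?w = "vec (\<phi> (- real n) (vec s) \<omega> $ idx1) :: 'n rvec"
  have \<omega>': "?\<omega> \<in> \<Omega>" by (rule shift_mem[OF \<omega>])
  have shift_back: "\<theta> (real n) ?\<omega> = \<omega>" by (simp add: wiener_shift_shift shift_0[OF \<omega>])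
  let ?x = "\<phi> (real n) ?w ?\<omega>"
  have "?x $ idx1 = \<phi> (real n) (\<phi> (- real n) (vec s) \<omega>) ?\<omega> $ idx1"
    by (rule \<phi>_idx1_cong[OF \<omega>']) simp
  also have "\<dots> = s"
    using \<phi>_inverse(2)[OF \<omega>, of "real n" "vec s"] by simp
  finally have "?x $ idx1 \<in> S" using s by simp
  moreover have "\<phi> (- real n) ?x \<omega> = ?w"
    using \<phi>_inverse(1)[OF \<omega>', of "real n" ?w] by (simp add: shift_back)
  then have "?x \<in> layer n \<omega>"
    using \<rho>_ge_1[OF \<omega>'] by (simp add: layer_def)
  ultimately show ?thesis by (auto simp: core_def)
qed

lemma lift_slice: "\<omega> \<in> \<Omega> \<Longrightarrow> (\<Inter>n. core S n \<omega>) = {x \<in> lift \<omega>. x $ idx1 \<in> S}"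
  by (auto simp: core_def lift_eq)

lemma core_mono: "\<omega> \<in> \<Omega> \<Longrightarrow> m \<le> n \<Longrightarrow> core S n \<omega> \<subseteq> core S m \<omega>"
  using layer_mono by (auto simp: core_def)

lemma lift_slice_nonempty:
  assumes \<omega>: "\<omega> \<in> \<Omega>" obtains x where "x \<in> lift \<omega>" "x $ idx1 = s"
proof -
  have "(\<Inter>n. core {s} n \<omega>) \<noteq> {}"
    by (intro compact_nest compact_core core_nonempty core_mono \<omega>) auto
  then show ?thesis using that unfolding lift_slice[OF \<omega>] by auto
qed

lemma attractor_nonempty: "\<omega> \<in> \<Omega> \<Longrightarrow> attractor \<omega> \<noteq> {}"
  using lift_slice_nonempty by (auto simp: attractor_def)

lemma attractor_eq_slice: "\<omega> \<in> \<Omega> \<Longrightarrow> attractor \<omega> = proj ` {x \<in> lift \<omega>. x $ idx1 \<in> {0..2 * pi}}"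
proof (intro equalityI subsetI)
  fix p assume \<omega>: "\<omega> \<in> \<Omega>" and "p \<in> attractor \<omega>"
  then obtain x where x: "x \<in> lift \<omega>" "p = proj x" by (auto simp: attractor_def)
  obtain y and m :: int where y: "y = x + vec (2 * pi * of_int m)" "0 \<le> y $ idx1" "y $ idx1 \<le> 2 * pi"
    by (rule proj_representative)
  then have "y \<in> {x \<in> lift \<omega>. x $ idx1 \<in> {0..2 * pi}}" using lift_deck[OF \<omega> x(1)] by simp
  moreover have "p = proj y" using x y by simp
  ultimately show "p \<in> proj ` {x \<in> lift \<omega>. x $ idx1 \<in> {0..2 * pi}}" by blast
qed (auto simp: attractor_def)

lemma compact_attractor:
  assumes \<omega>: "\<omega> \<in> \<Omega>" shows "compact (attractor \<omega>)"
proof -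
  have "compact (\<Inter>n. core {0..2 * pi} n \<omega>)"
    by (intro compact_Inter) (auto intro: compact_core[OF \<omega>])
  then show ?thesis
    unfolding attractor_eq_slice[OF \<omega>] lift_slice[OF \<omega>, symmetric]
    by (intro compact_continuous_image continuous_intros)
qed

lemma Phi_attractor:
  assumes \<omega>: "\<omega> \<in> \<Omega>" shows "(\<lambda>p. Phi k \<alpha> \<epsilon> t p \<omega>) ` attractor \<omega> = attractor (\<theta> t \<omega>)"
  unfolding attractor_def lift_image[OF \<omega>, symmetric] by (simp add: image_image Phi_proj[OF \<omega>])

text \<open>Nested compact slices eventually enter an open neighbourhood of their intersection; deck
  invariance extends this from the slab to the whole layer.\<close>

lemma layer_near_attractor:
  assumes \<omega>: "\<omega> \<in> \<Omega>" and e: "e > 0"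
  obtains n where "\<And>x. x \<in> layer n \<omega> \<Longrightarrow> infdist (proj x) (attractor \<omega>) < e"
proof -
  let ?U = "{x. infdist (proj x) (attractor \<omega>) < e}"
  obtain n where n: "core {0..2 * pi} n \<omega> \<subseteq> ?U"
  proof (rule nested_compact_subset_open)
    show "open ?U" by (intro open_Collect_less continuous_intros)
    show "(\<Inter>n. core {0..2 * pi} n \<omega>) \<subseteq> ?U"
      unfolding lift_slice[OF \<omega>] using e by (auto simp: attractor_def)
  qed (auto intro: compact_core[OF \<omega>] dest: subsetD[OF core_mono[OF \<omega>]])
  have "infdist (proj x) (attractor \<omega>) < e" if x: "x \<in> layer n \<omega>" for x
  proof -
    obtain y and m :: int where y: "y = x + vec (2 * pi * of_int m)" "0 \<le> y $ idx1" "y $ idx1 \<le> 2 * pi"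
      by (rule proj_representative)
    then have "y \<in> core {0..2 * pi} n \<omega>" using layer_deck[OF \<omega> x] by (simp add: core_def)
    then show ?thesis using n y(1) by auto
  qed
  then show ?thesis by (rule that)
qed

text \<open>Absorption is demanded by time -n, not by time 0: an orbit in the absorbing set at time
  -n ends in layer n, and layers are close to the attractor for large n. The available time t - n
  still grows without bound.\<close>

lemma tempered_absorbed:
  assumes D: "tempered P \<Omega> D" and \<omega>: "\<omega> \<in> \<Omega>"
  shows "\<forall>\<^sub>F t in at_top. \<forall>p\<in>D (\<theta> (- t) \<omega>). \<exists>x\<in>layer n \<omega>. Phi k \<alpha> \<epsilon> t p (\<theta> (- t) \<omega>) = proj x"
proof -
  from D obtain q r where qr: "\<forall>\<omega>\<in>\<Omega>. 0 \<le> r \<omega> \<and> D \<omega> \<subseteq> cball q (r \<omega>)"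
    and bdd: "\<forall>c>0. \<forall>\<omega>\<in>\<Omega>. bdd_above (range (\<lambda>t. exp (- c * \<bar>t\<bar>) * r (\<theta> t \<omega>)))"
    unfolding tempered_def by (elim exE conjE)
  \<comment> \<open>The energy is quadratic in the radius of D, so it grows at most at rate \<kappa>
    / 2 and loses against the discount \<kappa>.\<close>
  let ?c = "\<kappa> / 4"
  obtain B where B: "\<And>t. exp (- ?c * \<bar>t\<bar>) * r (\<theta> t \<omega>) \<le> B"
  proof -
    have "?c > 0" using \<kappa>_pos by simp
    from bdd[rule_format, OF this \<omega>] have "bdd_above (range (\<lambda>t. exp (- ?c * \<bar>t\<bar>) * r (\<theta> t \<omega>)))" .
    then show thesis using that unfolding bdd_above_def by blast
  qed
  let ?x = "rep_phase q"
  define E where "E t = 2 * energy ?x + 2 * (real CARD('n) * (2 * ((B + 1) * exp (\<kappa> * t / 4)))\<^sup>2)" for t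
  have en: "\<exists>y. p = proj y \<and> energy y \<le> E t" if t: "t \<ge> 0" and p: "p \<in> D (\<theta> (- t) \<omega>)" for t p
  proof -
    have "r (\<theta> (- t) \<omega>) \<le> B * exp (\<kappa> * t / 4)"
    proof -
      have "exp (- (\<kappa> * t / 4)) * r (\<theta> (- t) \<omega>) \<le> B"
        using B[of "- t"] t by simp
      then have "exp (\<kappa> * t / 4) * (exp (- (\<kappa> * t / 4)) * r (\<theta> (- t) \<omega>)) \<le> exp (\<kappa> * t / 4) * B"
        by (intro mult_left_mono) auto
      also have "exp (\<kappa> * t / 4) * (exp (- (\<kappa> * t / 4)) * r (\<theta> (- t) \<omega>)) = r (\<theta> (- t) \<omega>)"
        by (simp flip: mult.assoc exp_add)
      finally show ?thesis by (simp only: mult.commute)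
    qed
    moreover have "1 \<le> exp (\<kappa> * t / 4)" using t \<kappa>_pos by simp
    ultimately have rB: "r (\<theta> (- t) \<omega>) + 1 \<le> (B + 1) * exp (\<kappa> * t / 4)"
      unfolding distrib_right by linarith
    \<comment> \<open>The ball around q is closed; the extra 1 gives the strict inequality needed to
      lift p.\<close>
    have "dist (proj ?x) p < r (\<theta> (- t) \<omega>) + 1"
      using qr shift_mem[OF \<omega>, of "- t"] p by force
    then obtain y where y: "proj y = p" "norm (?x - y) < r (\<theta> (- t) \<omega>) + 1"
      by (rule dist_proj_lessE)
    have "energy y = energy (?x + (y - ?x))" by simp
    also have "\<dots> \<le> 2 * energy ?x + 2 * energy (y - ?x)" by (rule energy_add_le)
    finally have "energy y \<le> 2 * energy ?x + 2 * energy (y - ?x)" .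
    moreover have "energy (y - ?x) \<le> real CARD('n) * (2 * norm (y - ?x))\<^sup>2" by (rule energy_le_norm)
    moreover have "real CARD('n) * (2 * norm (y - ?x))\<^sup>2 \<le> real CARD('n) * (2 * ((B + 1) * exp (\<kappa> * t / 4)))\<^sup>2"
      using y(2) rB by (intro mult_left_mono power_mono) (auto simp: norm_minus_commute)
    ultimately have "energy y \<le> E t" unfolding E_def by linarith
    then show ?thesis using y(1) by blast
  qed
  have "((\<lambda>t. exp (- \<kappa> * (t - real n)) * E t) \<longlongrightarrow> 0) at_top"
    unfolding E_def by (rule exp_decay_dominates[OF \<kappa>_pos])
  then have "\<forall>\<^sub>F t in at_top. exp (- \<kappa> * (t - real n)) * E t < 1"
    by (rule order_tendstoD) simp
  then show ?thesis
    using eventually_ge_at_top[of "real n"]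
  proof eventually_elim
    case (elim t)
    show ?case
    proof
      fix p assume "p \<in> D (\<theta> (- t) \<omega>)"
      then obtain y where y: "p = proj y" "energy y \<le> E t" using en[of t p] elim by auto
      let ?\<omega> = "\<theta> (- t) \<omega>"
      have \<omega>': "?\<omega> \<in> \<Omega>" by (rule shift_mem[OF \<omega>])
      have shift_back: "\<theta> s ?\<omega> = \<theta> (s - t) \<omega>" for s by (simp add: wiener_shift_shift)
      \<comment> \<open>The right-hand side is below 1, which suffices because the radius is at
        least 1.\<close>
      have "exp (- \<kappa> * (t - real n)) * energy y \<le> exp (- \<kappa> * (t - real n)) * E t"
        by (intro mult_left_mono y) auto
      also have "\<dots> \<le> \<rho> (\<theta> (- real n) \<omega>)"
        using elim \<rho>_ge_1[OF shift_mem[OF \<omega>, of "- real n"]] by simp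
      finally have "energy (\<phi> (t - real n) y ?\<omega>) \<le> \<rho> (\<theta> (- real n) \<omega>)"
        using energy_absorbed[OF \<omega>', of "t - real n" y] elim by (simp add: shift_back)
      moreover have "\<phi> (t - real n) y ?\<omega> = \<phi> (- real n) (\<phi> t y ?\<omega>) \<omega>"
        using \<phi>_cocycle[OF \<omega>', of "- real n" t y] by (simp add: shift_back shift_0[OF \<omega>])
      ultimately have "\<phi> t y ?\<omega> \<in> layer n \<omega>" by (simp add: layer_def)
      moreover have "Phi k \<alpha> \<epsilon> t p ?\<omega> = proj (\<phi> t y ?\<omega>)"
        unfolding y(1) by (rule Phi_proj[OF \<omega>'])
      ultimately show "\<exists>x\<in>layer n \<omega>. Phi k \<alpha> \<epsilon> t p ?\<omega> = proj x" by blast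
    qed
  qed
qed

lemma attracts_tempered:
  assumes D: "tempered P \<Omega> D" shows "attracts \<Omega> (Phi k \<alpha> \<epsilon>) attractor D"
  unfolding attracts_def
proof (intro ballI order_tendstoI)
  fix \<omega> and a :: ennreal assume \<omega>: "\<omega> \<in> \<Omega>" and "0 < a"
  then obtain b where b: "0 < b" "b < a" using dense by blast
  then obtain e where e: "b = ennreal e" "e > 0"
    by (cases b) auto
  obtain n where n: "\<And>x. x \<in> layer n \<omega> \<Longrightarrow> infdist (proj x) (attractor \<omega>) < e"
    using layer_near_attractor[OF \<omega> e(2)] by blast
  from tempered_absorbed[OF D \<omega>, of n]
  show "\<forall>\<^sub>F t in at_top. semidist ((\<lambda>p. Phi k \<alpha> \<epsilon> t p (\<theta> (- t) \<omega>)) ` D (\<theta> (- t) \<omega>)) (attractor \<omega>) < a"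
  proof eventually_elim
    case (elim t)
    have "semidist ((\<lambda>p. Phi k \<alpha> \<epsilon> t p (\<theta> (- t) \<omega>)) ` D (\<theta> (- t) \<omega>)) (attractor \<omega>) \<le> ennreal e"
    proof (rule semidist_le)
      fix p assume "p \<in> (\<lambda>p. Phi k \<alpha> \<epsilon> t p (\<theta> (- t) \<omega>)) ` D (\<theta> (- t) \<omega>)"
      then obtain x where "x \<in> layer n \<omega>" "p = proj x" using elim by auto
      then show "infdist p (attractor \<omega>) < e" using n by simp
    qed (rule attractor_nonempty[OF \<omega>])
    then show ?case using b(2) e(1) by simp
  qed
qed simp

text \<open>Rescaling by the square root of the radius moves all dependence on the path into the
  map, while the parameter set, where the energy is at most 1, is fixed. A single countable dense
  subset then serves all paths.\<close>

lemma layer_eq_image: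
  assumes \<omega>: "\<omega> \<in> \<Omega>"
  shows "layer n \<omega> = (\<lambda>w. \<phi> (real n) (sqrt (\<rho> (\<theta> (- real n) \<omega>)) *\<^sub>R w) (\<theta> (- real n) \<omega>)) ` {w. energy w \<le> 1}"
    (is "_ = ?f ` _")
proof (intro equalityI subsetI)
  let ?\<omega> = "\<theta> (- real n) \<omega>"
  let ?s = "sqrt (\<rho> ?\<omega>)"
  have \<omega>': "?\<omega> \<in> \<Omega>" by (rule shift_mem[OF \<omega>])
  have shift_back: "\<theta> (real n) ?\<omega> = \<omega>" by (simp add: wiener_shift_shift shift_0[OF \<omega>])
  have \<rho>: "\<rho> ?\<omega> \<ge> 1" by (rule \<rho>_ge_1[OF \<omega>'])
  {
    fix x assume "x \<in> layer n \<omega>"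
    then have x: "energy (\<phi> (- real n) x \<omega>) \<le> \<rho> ?\<omega>" by (simp add: layer_def)
    let ?w = "(1 / ?s) *\<^sub>R \<phi> (- real n) x \<omega>"
    have "x = ?f ?w"
      using \<rho> \<phi>_inverse(2)[OF \<omega>, of "real n" x] by simp
    moreover have "energy ?w \<le> 1"
      using \<rho> x by (simp add: energy_scaleR power_divide)
    ultimately show "x \<in> ?f ` {w. energy w \<le> 1}" by blast
  next
    fix x assume "x \<in> ?f ` {w. energy w \<le> 1}"
    then obtain w where w: "energy w \<le> 1" "x = ?f w" by auto
    have "\<phi> (- real n) x \<omega> = ?s *\<^sub>R w"
      using \<phi>_inverse(1)[OF \<omega>', of "real n" "?s *\<^sub>R w"] by (simp add: w(2) shift_back)
    moreover have "energy (?s *\<^sub>R w) \<le> \<rho> ?\<omega>"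
      using \<rho> w(1) by (simp add: energy_scaleR mult_left_le)
    ultimately show "x \<in> layer n \<omega>" by (simp add: layer_def)
  }
qed

lemma infdist_layer_measurable: "(\<lambda>\<omega>. infdist p (proj ` layer n \<omega>)) \<in> borel_measurable M"
proof -
  obtain S :: "'n rvec set" where S: "countable S" "S \<subseteq> {w. energy w \<le> 1}" "{w. energy w \<le> 1} \<subseteq> closure S"
    using separable by blast
  have "0 \<in> {w :: 'n rvec. energy w \<le> 1}" by (simp add: energy_def)
  then have "S \<noteq> {}" using S(3) by auto
  let ?f = "\<lambda>\<omega> w. proj (\<phi> (real n) (sqrt (\<rho> (\<theta> (- real n) \<omega>)) *\<^sub>R w) (\<theta> (- real n) \<omega>))"
  have "(\<lambda>\<omega>. INF w\<in>S. dist p (?f \<omega> w)) \<in> borel_measurable M"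
  proof (rule borel_measurable_cINF[OF S(1)])
    note [measurable] = \<rho>_measurable
    have "(\<lambda>\<omega>. \<phi> (real n) (sqrt (\<rho> (\<theta> (- real n) \<omega>)) *\<^sub>R w) (\<theta> (- real n) \<omega>)) \<in> borel_measurable M" for w
      by (rule \<phi>_measurable) measurable
    then show "(\<lambda>\<omega>. dist p (?f \<omega> w)) \<in> borel_measurable M" for w
      by (rule measurable_compose) (intro borel_measurable_continuous_onI continuous_intros)
  qed (auto intro!: bdd_belowI[of _ 0])
  moreover have "infdist p (proj ` layer n \<omega>) = (INF w\<in>S. dist p (?f \<omega> w))" if "\<omega> \<in> space M" for \<omega>
    unfolding layer_eq_image[OF that[unfolded space_M]] image_image
    by (intro infdist_image_dense S \<open>S \<noteq> {}\<close> continuous_intros continuous_on_\<phi> shift_mem)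
      (use that in simp)
  ultimately show ?thesis by (subst measurable_cong) auto
qed

text \<open>Layers contain the attractor and eventually lie in any given neighbourhood of it, so the
  distances converge and measurability passes to the limit.\<close>

lemma infdist_layer_tendsto:
  assumes \<omega>: "\<omega> \<in> \<Omega>"
  shows "(\<lambda>n. infdist p (proj ` layer n \<omega>)) \<longlonglongrightarrow> infdist p (attractor \<omega>)"
proof (rule LIMSEQ_I)
  fix e :: real assume e: "e > 0"
  obtain N where N: "\<And>x. x \<in> layer N \<omega> \<Longrightarrow> infdist (proj x) (attractor \<omega>) < e / 2"
    using layer_near_attractor[OF \<omega>, of "e / 2"] e by auto
  have "norm (infdist p (proj ` layer n \<omega>) - infdist p (attractor \<omega>)) < e" if n: "n \<ge> N" for n
  proof -
    have sub: "attractor \<omega> \<subseteq> proj ` layer n \<omega>"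
      unfolding attractor_def lift_eq[OF \<omega>] by auto
    then have ne: "proj ` layer n \<omega> \<noteq> {}" using attractor_nonempty[OF \<omega>] by auto
    have "infdist p (proj ` layer n \<omega>) \<le> infdist p (attractor \<omega>)"
      by (rule infdist_mono[OF sub attractor_nonempty[OF \<omega>]])
    moreover have "infdist p (attractor \<omega>) - e / 2 \<le> infdist p (proj ` layer n \<omega>)"
      unfolding infdist_def[of p "proj ` layer n \<omega>"] if_not_P[OF ne]
    proof (rule cINF_greatest[OF ne])
      fix q assume "q \<in> proj ` layer n \<omega>"
      then have "infdist q (attractor \<omega>) < e / 2" using N layer_mono[OF \<omega> n] by auto
      then show "infdist p (attractor \<omega>) - e / 2 \<le> dist p q"
        using infdist_triangle[of p "attractor \<omega>" q] by simp
    qed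
    ultimately show ?thesis using e by simp
  qed
  then show "\<exists>no. \<forall>n\<ge>no. norm (infdist p (proj ` layer n \<omega>) - infdist p (attractor \<omega>)) < e" by blast
qed

lemma random_set_attractor: "random_set P \<Omega> attractor"
  unfolding random_set_def
proof (intro conjI ballI allI)
  show "(\<lambda>\<omega>. infdist p (attractor \<omega>)) \<in> borel_measurable M" for p
    by (rule borel_measurable_LIMSEQ_metric[OF infdist_layer_measurable infdist_layer_tendsto]) simp
qed (rule attractor_nonempty)

lemma tempered_attractor: "tempered P \<Omega> attractor"
proof -
  obtain c where c: "0 < c" "\<And>x :: 'n rvec. norm x \<le> c * (\<bar>x $ idx1\<bar> + sqrt (energy x))"
    using norm_le_energy by blast
  \<comment> \<open>Written with the trivial shift by 0 so that measurability of the radius, which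
    is stated along shifts, applies literally.\<close>
  define R where "R \<omega> = c * (2 * pi + \<rho> (\<theta> 0 \<omega>))" for \<omega>
  have R0: "R \<omega> = c * (2 * pi + \<rho> \<omega>)" if "\<omega> \<in> \<Omega>" for \<omega>
    using that by (simp add: R_def shift_0)
  show ?thesis
    unfolding tempered_def
  proof (intro exI[of _ "proj 0"] exI[of _ R] conjI ballI allI impI)
    note [measurable] = \<rho>_measurable
    show "R \<in> borel_measurable M" unfolding R_def by measurable
  next
    fix \<omega> assume \<omega>: "\<omega> \<in> \<Omega>"
    note \<rho> = \<rho>_ge_1[OF \<omega>]
    show "0 \<le> R \<omega>" using \<rho> c(1) by (simp add: R0[OF \<omega>])
    show "attractor \<omega> \<subseteq> cball (proj 0) (R \<omega>)"
      unfolding attractor_eq_slice[OF \<omega>]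
    proof clarify
      fix x assume x: "x \<in> lift \<omega>" "x $ idx1 \<in> {0..2 * pi}"
      have "dist (proj 0) (proj x) \<le> norm x" using dist_proj_le[of 0 x] by simp
      also have "norm x \<le> c * (\<bar>x $ idx1\<bar> + sqrt (energy x))" by (rule c)
      also have "\<dots> \<le> c * (2 * pi + \<rho> \<omega>)"
      proof (intro mult_left_mono add_mono)
        have "energy x \<le> \<rho> \<omega>" using x(1) layer_energy_le[OF \<omega>, of x 0] by (simp add: lift_eq[OF \<omega>])
        also have "\<rho> \<omega> \<le> \<rho> \<omega> * \<rho> \<omega>" using \<rho> by simp
        finally show "sqrt (energy x) \<le> \<rho> \<omega>" using \<rho> by (intro real_le_lsqrt) (auto simp: power2_eq_square)
      qed (use x c in auto)
      finally show "proj x \<in> cball (proj 0) (R \<omega>)" by (simp add: R0[OF \<omega>])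
    qed
  next
    fix a :: real and \<omega> assume a: "a > 0" and \<omega>: "\<omega> \<in> \<Omega>"
    obtain C where C: "C \<ge> 0" "\<And>t. \<rho> (\<theta> t \<omega>) \<le> C * (1 + \<bar>t\<bar>)\<^sup>2"
      using \<rho>_growth[OF \<omega>] by blast
    obtain B where B: "B \<ge> 0" "\<And>u. (1 + \<bar>u\<bar>)\<^sup>2 \<le> B * exp (a * \<bar>u\<bar>)"
      using square_le_exp[OF a] by blast
    show "bdd_above (range (\<lambda>t. exp (- a * \<bar>t\<bar>) * R (\<theta> t \<omega>)))"
    proof (rule bdd_aboveI)
      fix u assume "u \<in> range (\<lambda>t. exp (- a * \<bar>t\<bar>) * R (\<theta> t \<omega>))"
      then obtain t where u: "u = exp (- a * \<bar>t\<bar>) * (c * (2 * pi + \<rho> (\<theta> t \<omega>)))"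
        by (auto simp: R0[OF shift_mem[OF \<omega>]])
      have "1 \<le> exp (a * \<bar>t\<bar>)" using a by simp
      moreover have "\<rho> (\<theta> t \<omega>) \<le> C * (B * exp (a * \<bar>t\<bar>))"
        by (rule order_trans[OF C(2)]) (intro mult_left_mono B C)
      ultimately have "2 * pi + \<rho> (\<theta> t \<omega>) \<le> 2 * pi * exp (a * \<bar>t\<bar>) + C * (B * exp (a * \<bar>t\<bar>))"
        by (intro add_mono) auto
      also have "\<dots> = exp (a * \<bar>t\<bar>) * (2 * pi + C * B)" by (simp add: algebra_simps)
      finally have "u \<le> exp (- a * \<bar>t\<bar>) * (c * (exp (a * \<bar>t\<bar>) * (2 * pi + C * B)))"
        unfolding u using c(1) by (intro mult_left_mono) auto
      also have "\<dots> = c * (2 * pi + C * B)" by (simp add: exp_minus)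
      finally show "u \<le> c * (2 * pi + C * B)" .
    qed
  qed
qed

theorem global_attractor: "global_random_attractor P \<Omega> (Phi k \<alpha> \<epsilon>) attractor"
  unfolding global_random_attractor_def
  using random_set_attractor compact_attractor tempered_attractor Phi_attractor attracts_tempered by blast

end

section \<open>Smoothness of the attractor for strong coupling\<close>

context chain_system
begin

context
  fixes \<omega> assumes \<omega>: "\<omega> \<in> \<Omega>" and k: "k > 3"
begin

private definition \<delta> :: "'n rvec \<Rightarrow> 'n rvec \<Rightarrow> 'n \<Rightarrow> real \<Rightarrow> real" where
  "\<delta> a b i t = \<phi> t b \<omega> $ i - \<phi> t a \<omega> $ i"

text \<open>The mean slope of the sine between two orbits at the same time; with it the difference
  of the orbits solves a linear equation exactly, without remainder.\<close>

private definition slope :: "'n rvec \<Rightarrow> 'n rvec \<Rightarrow> 'n \<Rightarrow> real \<Rightarrow> real" where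
  "slope a b i t = sin_slope (\<phi> t a \<omega> $ i + z i (\<theta> t \<omega>)) (\<phi> t b \<omega> $ i + z i (\<theta> t \<omega>))"

private lemma \<delta>_derivative:
  "(\<delta> a b i has_real_derivative
    (if i = idx1 then 0 else - k * (\<delta> a b i t - \<delta> a b (idx_pred i) t)) - slope a b i t * \<delta> a b i t) (at t)"
proof -
  have "(\<delta> a b i has_real_derivative
      (- k * gap (\<phi> t b \<omega>) i + \<alpha> $ i - sin (\<phi> t b \<omega> $ i + z i (\<theta> t \<omega>)) + forcing k \<epsilon> (\<theta> t \<omega>) $ i)
      - (- k * gap (\<phi> t a \<omega>) i + \<alpha> $ i - sin (\<phi> t a \<omega> $ i + z i (\<theta> t \<omega>)) + forcing k \<epsilon> (\<theta> t \<omega>) $ i)) (at t)"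
    unfolding \<delta>_def[abs_def] by (rule DERIV_diff[OF \<phi>_component_derivative[OF \<omega>] \<phi>_component_derivative[OF \<omega>]])
  moreover have "sin (\<phi> t b \<omega> $ i + z i (\<theta> t \<omega>)) - sin (\<phi> t a \<omega> $ i + z i (\<theta> t \<omega>)) = slope a b i t * \<delta> a b i t"
    unfolding sin_diff_eq_slope slope_def \<delta>_def by simp
  ultimately show ?thesis
    by (elim DERIV_cong) (auto simp: gap_def \<delta>_def right_diff_distrib)
qed

private lemma continuous_slope: "continuous_on UNIV (slope a b i)"
proof -
  have z: "continuous_on UNIV (\<lambda>t. z i (\<theta> t \<omega>))" by (rule z_continuous[OF \<omega>])
  have "continuous_on UNIV (\<lambda>t. \<phi> t x \<omega> $ i + z i (\<theta> t \<omega>))" for x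
    by (intro continuous_intros continuous_on_\<phi>_time \<omega> z)
  then show ?thesis unfolding slope_def[abs_def] by (intro continuous_on_sin_slope)
qed

private lemma abs_slope_le_1: "\<bar>slope a b i t\<bar> \<le> 1"
  unfolding slope_def by (rule abs_sin_slope_le_1)

private lemma slope_lipschitz: "\<bar>slope a b i t - slope a' b' i t\<bar> \<le> \<bar>\<delta> a a' i t\<bar> + \<bar>\<delta> b b' i t\<bar>"
  unfolding slope_def \<delta>_def
  by (rule order_trans[OF sin_slope_lipschitz]) (simp add: abs_minus_commute)

private lemma exp_null:
  assumes "l < k - 1" and "\<And>t. t \<le> 0 \<Longrightarrow> \<bar>D t\<bar> \<le> B * exp (- l * t)"
  shows "((\<lambda>t. exp ((k - 1) * t) * D t) \<longlongrightarrow> 0) at_bot"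
proof (rule Lim_null_comparison)
  show "\<forall>\<^sub>F t in at_bot. norm (exp ((k - 1) * t) * D t) \<le> B * exp ((k - 1 - l) * t)"
    using eventually_le_at_bot[of 0]
  proof eventually_elim
    case (elim t)
    have "exp ((k - 1) * t) * \<bar>D t\<bar> \<le> exp ((k - 1) * t) * (B * exp (- l * t))"
      using assms(2)[OF elim] by (intro mult_left_mono) auto
    also have "\<dots> = B * exp ((k - 1 - l) * t)"
      by (simp add: algebra_simps flip: exp_add)
    finally show ?case by (simp add: abs_mult)
  qed
  have "k - 1 - l > 0" using assms(1) by simp
  then show "((\<lambda>t. B * exp ((k - 1 - l) * t)) \<longlongrightarrow> 0) at_bot" by real_asymp
qed

text \<open>Membership in the lift enters here: the gaps of an orbit on the attractor grow at most
  quadratically backward in time, whereas the radius does not control the first component.\<close>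

private lemma gap_null:
  assumes a: "a \<in> lift \<omega>"
  shows "((\<lambda>t. exp ((k - 1) * t) * gap (\<phi> t a \<omega>) i) \<longlongrightarrow> 0) at_bot"
proof -
  obtain C where C: "C \<ge> 0" "\<And>t. \<rho> (\<theta> t \<omega>) \<le> C * (1 + \<bar>t\<bar>)\<^sup>2"
    using \<rho>_growth[OF \<omega>] by blast
  obtain B :: real where B: "B \<ge> 0" "\<And>u. (1 + \<bar>u\<bar>)\<^sup>2 \<le> B * exp (1 * \<bar>u\<bar>)"
    using square_le_exp[OF zero_less_one] by blast
  have "\<bar>gap (\<phi> t a \<omega>) i\<bar> \<le> 2 ^ depth i * (C * B) * exp (- 1 * t)" if "t \<le> 0" for t
  proof -
    have \<rho>: "1 \<le> \<rho> (\<theta> t \<omega>)" by (rule \<rho>_ge_1[OF shift_mem[OF \<omega>]])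
    have "energy (\<phi> t a \<omega>) \<le> \<rho> (\<theta> t \<omega>)" using a by (simp add: lift_def)
    also have "\<dots> \<le> (\<rho> (\<theta> t \<omega>))\<^sup>2" using \<rho> by (simp add: power2_eq_square)
    finally have "sqrt (energy (\<phi> t a \<omega>)) \<le> \<rho> (\<theta> t \<omega>)"
      using \<rho> by (intro real_le_lsqrt) auto
    also have "\<dots> \<le> C * (B * exp (1 * \<bar>t\<bar>))"
      by (rule order_trans[OF C(2)]) (intro mult_left_mono B C)
    finally have "2 ^ depth i * sqrt (energy (\<phi> t a \<omega>)) \<le> 2 ^ depth i * (C * (B * exp (1 * \<bar>t\<bar>)))"
      by (intro mult_left_mono) auto
    then have "\<bar>gap (\<phi> t a \<omega>) i\<bar> \<le> 2 ^ depth i * (C * (B * exp (1 * \<bar>t\<bar>)))"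
      by (rule order_trans[OF gap_le_energy])
    then show ?thesis using that by (simp add: mult.assoc)
  qed
  then show ?thesis using k by (intro exp_null[where l = 1]) auto
qed

text \<open>Along the chain the bound on the predecessor is the forcing of the next difference, and
  the constant picks up the factor k / (k - 2). The condition at minus infinity follows from the
  predecessor bound and the two gaps; it is qualitative, yet the backward estimate turns it into a
  bound linear in the distance of the first components.\<close>

private lemma \<delta>_bound:
  "\<exists>C\<ge>0. \<forall>a\<in>lift \<omega>. \<forall>b\<in>lift \<omega>. \<forall>t\<le>0. \<bar>\<delta> a b i t\<bar> \<le> C * \<bar>b $ idx1 - a $ idx1\<bar> * exp (- t)"
proof (induction i rule: chain_induct)
  case idx1
  have "\<bar>\<delta> a b idx1 t\<bar> \<le> 1 * \<bar>b $ idx1 - a $ idx1\<bar> * exp (- t)" if "t \<le> 0" for a b t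
  proof -
    have "\<bar>\<delta> a b idx1 t\<bar> \<le> \<bar>\<delta> a b idx1 0\<bar> * exp (- t) + 0 * exp (- 2 * t)"
    proof (rule backward_growth_bound[where f = "\<lambda>_. 0" and c = "slope a b idx1"])
      show "(\<delta> a b idx1 has_real_derivative - slope a b idx1 t * \<delta> a b idx1 t + 0) (at t)" for t
        using \<delta>_derivative[of a b idx1 t] by simp
    qed (use that in \<open>simp_all add: continuous_slope abs_slope_le_1\<close>)
    then show ?thesis by (simp add: \<delta>_def \<omega>)
  qed
  then show ?case by (intro exI[of _ 1]) auto
next
  case (pred i)
  then obtain C where C: "C \<ge> 0"
    "\<And>a b t. a \<in> lift \<omega> \<Longrightarrow> b \<in> lift \<omega> \<Longrightarrow> t \<le> 0 \<Longrightarrow>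
      \<bar>\<delta> a b (idx_pred i) t\<bar> \<le> C * \<bar>b $ idx1 - a $ idx1\<bar> * exp (- t)" by blast
  have "\<bar>\<delta> a b i t\<bar> \<le> k * C / (k - 2) * \<bar>b $ idx1 - a $ idx1\<bar> * exp (- t)"
    if a: "a \<in> lift \<omega>" and b: "b \<in> lift \<omega>" and t: "t \<le> 0" for a b t
  proof -
    have "\<bar>\<delta> a b i t\<bar> \<le> k * C * \<bar>b $ idx1 - a $ idx1\<bar> / (k - 1 - 1) * exp (- 1 * t)"
    proof (rule backward_decay_bound[where f = "\<lambda>t. k * \<delta> a b (idx_pred i) t" and c = "slope a b i"])
      show "(\<delta> a b i has_real_derivative - (k + slope a b i t) * \<delta> a b i t + k * \<delta> a b (idx_pred i) t) (at t)" for t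
        using \<delta>_derivative[of a b i t] pred by (simp add: algebra_simps)
      show "\<bar>k * \<delta> a b (idx_pred i) t\<bar> \<le> k * C * \<bar>b $ idx1 - a $ idx1\<bar> * exp (- 1 * t)" if "t \<le> 0" for t
        using mult_left_mono[OF C(2)[OF a b that], of k] k by (simp add: abs_mult mult.assoc)
      have "((\<lambda>t. exp ((k - 1) * t) * \<delta> a b (idx_pred i) t) \<longlongrightarrow> 0) at_bot"
        by (rule exp_null[of 1 _ "C * \<bar>b $ idx1 - a $ idx1\<bar>"]) (use k C(2)[OF a b] in auto)
      then have "((\<lambda>t. exp ((k - 1) * t) * \<delta> a b (idx_pred i) t + exp ((k - 1) * t) * gap (\<phi> t b \<omega>) i
          - exp ((k - 1) * t) * gap (\<phi> t a \<omega>) i) \<longlongrightarrow> 0 + 0 - 0) at_bot"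
        by (intro tendsto_intros gap_null a b)
      then show "((\<lambda>t. exp ((k - 1) * t) * \<delta> a b i t) \<longlongrightarrow> 0) at_bot"
        using pred(1) by (simp add: \<delta>_def gap_def algebra_simps)
    qed (use k t in \<open>simp_all add: continuous_slope abs_slope_le_1\<close>)
    then show ?thesis by simp
  qed
  moreover have "k * C / (k - 2) \<ge> 0" using k C by simp
  ultimately show ?case by blast
qed

lemma lift_determined_by_idx1:
  assumes "a \<in> lift \<omega>" "b \<in> lift \<omega>" "a $ idx1 = b $ idx1" shows "a = b"
proof -
  have "b $ i = a $ i" for i
    using \<delta>_bound[of i] assms \<omega> by (force simp: \<delta>_def)
  then show ?thesis by (simp add: vec_eq_iff)
qed

text \<open>The difference of two orbits, scaled by their separation in the first component at time
  0. It solves the same linear equations as the difference itself; at time 0 it is the slope of a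
  chord of the graph, and its first component is 1 there if the base points differ.\<close>

private definition quot :: "'n rvec \<Rightarrow> 'n rvec \<Rightarrow> 'n \<Rightarrow> real \<Rightarrow> real" where
  "quot a b i t = \<delta> a b i t / (b $ idx1 - a $ idx1)"

private lemma quot_derivative:
  "(quot a b i has_real_derivative
    (if i = idx1 then 0 else - k * (quot a b i t - quot a b (idx_pred i) t)) - slope a b i t * quot a b i t) (at t)"
  using DERIV_cdivide[OF \<delta>_derivative[of a b i t], of "b $ idx1 - a $ idx1"]
  unfolding quot_def[abs_def] by (elim DERIV_cong) (auto simp: diff_divide_distrib algebra_simps)

private definition offset :: "'n rvec \<Rightarrow> 'n rvec \<Rightarrow> 'n rvec \<Rightarrow> 'n rvec \<Rightarrow> real" where
  "offset a b a' b' = \<bar>a $ idx1 - a' $ idx1\<bar> + \<bar>b $ idx1 - b' $ idx1\<bar>"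

text \<open>The last estimate prepares for subtracting the quotients of two pairs: a slope mismatch,
  of order exp (- t) times the distance of the pairs, is multiplied by a quotient of order exp (-
  t).\<close>

private lemma quot_bound:
  obtains C where "\<And>i. C i \<ge> 0"
    "\<And>i a b t. a \<in> lift \<omega> \<Longrightarrow> b \<in> lift \<omega> \<Longrightarrow> a $ idx1 \<noteq> b $ idx1 \<Longrightarrow> t \<le> 0 \<Longrightarrow> \<bar>quot a b i t\<bar> \<le> C i * exp (- t)"
    "\<And>i a b a' b' t. a \<in> lift \<omega> \<Longrightarrow> b \<in> lift \<omega> \<Longrightarrow> a' \<in> lift \<omega> \<Longrightarrow> b' \<in> lift \<omega> \<Longrightarrow>
      a' $ idx1 \<noteq> b' $ idx1 \<Longrightarrow> t \<le> 0 \<Longrightarrow>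
      \<bar>(slope a b i t - slope a' b' i t) * quot a' b' i t\<bar> \<le> (C i)\<^sup>2 * offset a b a' b' * exp (- 2 * t)"
proof -
  have "\<exists>C. \<forall>i. C i \<ge> 0 \<and>
      (\<forall>a\<in>lift \<omega>. \<forall>b\<in>lift \<omega>. \<forall>t\<le>0. \<bar>\<delta> a b i t\<bar> \<le> C i * \<bar>b $ idx1 - a $ idx1\<bar> * exp (- t))"
    by (rule choice, rule allI, rule \<delta>_bound)
  then obtain C where C': "\<forall>i. C i \<ge> 0 \<and>
      (\<forall>a\<in>lift \<omega>. \<forall>b\<in>lift \<omega>. \<forall>t\<le>0. \<bar>\<delta> a b i t\<bar> \<le> C i * \<bar>b $ idx1 - a $ idx1\<bar> * exp (- t))"
    by (elim exE)
  have C: "C i \<ge> 0" "a \<in> lift \<omega> \<Longrightarrow> b \<in> lift \<omega> \<Longrightarrow> t \<le> 0 \<Longrightarrow>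
      \<bar>\<delta> a b i t\<bar> \<le> C i * \<bar>b $ idx1 - a $ idx1\<bar> * exp (- t)" for i a b t
    using C' by simp_all
  have q: "\<bar>quot a b i t\<bar> \<le> C i * exp (- t)"
    if "a \<in> lift \<omega>" "b \<in> lift \<omega>" "a $ idx1 \<noteq> b $ idx1" "t \<le> 0" for i a b t
    using C(2)[OF that(1,2,4), of i] that(3)
    by (simp add: quot_def abs_divide pos_divide_le_eq mult_ac)
  have "\<bar>(slope a b i t - slope a' b' i t) * quot a' b' i t\<bar> \<le> (C i)\<^sup>2 * offset a b a' b' * exp (- 2 * t)"
    if "a \<in> lift \<omega>" "b \<in> lift \<omega>" "a' \<in> lift \<omega>" "b' \<in> lift \<omega>" "a' $ idx1 \<noteq> b' $ idx1" "t \<le> 0"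
    for i a b a' b' t
  proof -
    have "\<bar>slope a b i t - slope a' b' i t\<bar> \<le> \<bar>\<delta> a a' i t\<bar> + \<bar>\<delta> b b' i t\<bar>"
      by (rule slope_lipschitz)
    also have "\<dots> \<le> C i * \<bar>a' $ idx1 - a $ idx1\<bar> * exp (- t) + C i * \<bar>b' $ idx1 - b $ idx1\<bar> * exp (- t)"
      by (intro add_mono C that)
    also have "\<dots> = C i * offset a b a' b' * exp (- t)"
      by (simp add: offset_def distrib_left distrib_right abs_minus_commute[of "a' $ idx1"] abs_minus_commute[of "b' $ idx1"])
    finally have "\<bar>slope a b i t - slope a' b' i t\<bar> * \<bar>quot a' b' i t\<bar>
        \<le> C i * offset a b a' b' * exp (- t) * (C i * exp (- t))"
      using C(1) by (intro mult_mono q that) (auto simp: offset_def)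
    also have "\<dots> = (C i)\<^sup>2 * offset a b a' b' * exp (- 2 * t)"
    proof -
      have "exp (- 2 * t) = exp (- t) * exp (- t)" by (simp flip: exp_add)
      then show ?thesis by (simp add: power2_eq_square mult_ac)
    qed
    finally show ?thesis by (simp add: abs_mult)
  qed
  from that[of C, OF C(1) q this] show ?thesis .
qed

private lemma quot_lipschitz:
  "\<exists>K\<ge>0. \<forall>a\<in>lift \<omega>. \<forall>b\<in>lift \<omega>. \<forall>a'\<in>lift \<omega>. \<forall>b'\<in>lift \<omega>. \<forall>t\<le>0.
    a $ idx1 \<noteq> b $ idx1 \<longrightarrow> a' $ idx1 \<noteq> b' $ idx1 \<longrightarrow>
    \<bar>quot a b i t - quot a' b' i t\<bar> \<le> K * offset a b a' b' * exp (- 2 * t)"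
proof (rule quot_bound)
  fix C assume C: "\<And>i. C i \<ge> 0"
    "\<And>i a b t. a \<in> lift \<omega> \<Longrightarrow> b \<in> lift \<omega> \<Longrightarrow> a $ idx1 \<noteq> b $ idx1 \<Longrightarrow> t \<le> 0 \<Longrightarrow> \<bar>quot a b i t\<bar> \<le> C i * exp (- t)"
    "\<And>i a b a' b' t. a \<in> lift \<omega> \<Longrightarrow> b \<in> lift \<omega> \<Longrightarrow> a' \<in> lift \<omega> \<Longrightarrow> b' \<in> lift \<omega> \<Longrightarrow>
      a' $ idx1 \<noteq> b' $ idx1 \<Longrightarrow> t \<le> 0 \<Longrightarrow>
      \<bar>(slope a b i t - slope a' b' i t) * quot a' b' i t\<bar> \<le> (C i)\<^sup>2 * offset a b a' b' * exp (- 2 * t)"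
  show ?thesis
  proof (induction i rule: chain_induct)
    case idx1
    have "\<bar>quot a b idx1 t - quot a' b' idx1 t\<bar> \<le> (C idx1)\<^sup>2 * offset a b a' b' * exp (- 2 * t)"
      if *: "a \<in> lift \<omega>" "b \<in> lift \<omega>" "a' \<in> lift \<omega>" "b' \<in> lift \<omega>" "t \<le> 0"
        "a $ idx1 \<noteq> b $ idx1" "a' $ idx1 \<noteq> b' $ idx1" for a b a' b' t
    proof -
      \<comment> \<open>Subtracting the two linear equations keeps the coefficient of the first pair
        and puts the mismatch of the coefficients into the forcing.\<close>
      let ?f = "\<lambda>t. - ((slope a b idx1 t - slope a' b' idx1 t) * quot a' b' idx1 t)"
      have "\<bar>quot a b idx1 t - quot a' b' idx1 t\<bar> \<le> \<bar>quot a b idx1 0 - quot a' b' idx1 0\<bar> * exp (- t)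
          + (C idx1)\<^sup>2 * offset a b a' b' * exp (- 2 * t)"
      proof (rule backward_growth_bound[where f = ?f and c = "slope a b idx1"])
        show "((\<lambda>t. quot a b idx1 t - quot a' b' idx1 t) has_real_derivative
            - slope a b idx1 t * (quot a b idx1 t - quot a' b' idx1 t) + ?f t) (at t)" for t
          using DERIV_diff[OF quot_derivative[of a b idx1 t] quot_derivative[of a' b' idx1 t]]
          by (elim DERIV_cong) (simp add: algebra_simps)
        show "\<bar>?f t\<bar> \<le> (C idx1)\<^sup>2 * offset a b a' b' * exp (- 2 * t)" if "t \<le> 0" for t
          using C(3)[OF *(1-4,7) that] by simp
      qed (use * in \<open>simp_all add: continuous_slope abs_slope_le_1\<close>)
      \<comment> \<open>Both quotients start from 1, so the initial term of the growth bound
        vanishes.\<close>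
      moreover have "quot a b idx1 0 = 1" "quot a' b' idx1 0 = 1"
        using * by (simp_all add: quot_def \<delta>_def \<omega>)
      ultimately show ?thesis by simp
    qed
    then show ?case by (intro exI[of _ "(C idx1)\<^sup>2"]) auto
  next
    case (pred i)
    then obtain K where K0: "K \<ge> 0"
      and K: "\<forall>a\<in>lift \<omega>. \<forall>b\<in>lift \<omega>. \<forall>a'\<in>lift \<omega>. \<forall>b'\<in>lift \<omega>. \<forall>t\<le>0.
        a $ idx1 \<noteq> b $ idx1 \<longrightarrow> a' $ idx1 \<noteq> b' $ idx1 \<longrightarrow>
        \<bar>quot a b (idx_pred i) t - quot a' b' (idx_pred i) t\<bar> \<le> K * offset a b a' b' * exp (- 2 * t)"
      by (elim exE conjE)
    let ?K = "(k * K + (C i)\<^sup>2) / (k - 3)"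
    have "\<bar>quot a b i t - quot a' b' i t\<bar> \<le> ?K * offset a b a' b' * exp (- 2 * t)"
      if *: "a \<in> lift \<omega>" "b \<in> lift \<omega>" "a' \<in> lift \<omega>" "b' \<in> lift \<omega>" "t \<le> 0"
        "a $ idx1 \<noteq> b $ idx1" "a' $ idx1 \<noteq> b' $ idx1" for a b a' b' t
    proof -
      let ?e = "\<lambda>t. k * (quot a b (idx_pred i) t - quot a' b' (idx_pred i) t)"
      let ?g = "\<lambda>t. (slope a b i t - slope a' b' i t) * quot a' b' i t"
      have "\<bar>quot a b i t - quot a' b' i t\<bar>
          \<le> (k * K + (C i)\<^sup>2) * offset a b a' b' / (k - 1 - 2) * exp (- 2 * t)"
      \<comment> \<open>The forcing now has rate 2, which needs k - 1 > 2; for the condition at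
        minus infinity the cruder individual bounds of rate 1 are enough.\<close>
      proof (rule backward_decay_bound[where f = "\<lambda>t. ?e t - ?g t" and c = "slope a b i"])
        show "((\<lambda>t. quot a b i t - quot a' b' i t) has_real_derivative
            - (k + slope a b i t) * (quot a b i t - quot a' b' i t) + (?e t - ?g t)) (at t)" for t
          using DERIV_diff[OF quot_derivative[of a b i t] quot_derivative[of a' b' i t]] pred(1)
          by (elim DERIV_cong) (simp add: algebra_simps)
        show "\<bar>?e t - ?g t\<bar> \<le> (k * K + (C i)\<^sup>2) * offset a b a' b' * exp (- 2 * t)" if t: "t \<le> 0" for t
        proof -
          have "\<bar>?e t\<bar> \<le> k * (K * offset a b a' b' * exp (- 2 * t))"
            unfolding abs_mult using k K[rule_format, OF *(1-4) t *(6,7)] by (intro mult_mono) auto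
          moreover have "\<bar>?g t\<bar> \<le> (C i)\<^sup>2 * offset a b a' b' * exp (- 2 * t)"
            by (rule C(3)[OF *(1-4,7) t])
          ultimately have "\<bar>?e t - ?g t\<bar>
              \<le> k * (K * offset a b a' b' * exp (- 2 * t)) + (C i)\<^sup>2 * offset a b a' b' * exp (- 2 * t)"
            by linarith
          then show ?thesis by (simp add: algebra_simps)
        qed
        show "((\<lambda>t. exp ((k - 1) * t) * (quot a b i t - quot a' b' i t)) \<longlongrightarrow> 0) at_bot"
        proof (rule exp_null[of 1 _ "2 * C i"])
          show "\<bar>quot a b i t - quot a' b' i t\<bar> \<le> 2 * C i * exp (- 1 * t)" if "t \<le> 0" for t
            using C(2)[OF *(1,2,6) that, of i] C(2)[OF *(3,4,7) that, of i] by simp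
        qed (use k in simp)
      qed (use k * in \<open>simp_all add: continuous_slope abs_slope_le_1\<close>)
      then show ?thesis by simp
    qed
    moreover have "?K \<ge> 0" using k K0 by (intro divide_nonneg_nonneg add_nonneg_nonneg mult_nonneg_nonneg) auto
    ultimately show ?case by blast
  qed
qed

text \<open>Fibres over the first component are nonempty and, for this k, singletons, so the lift is
  the graph of a function. Its chord slopes are the quotients at time 0, whose Lipschitz dependence
  on the pair of base points gives a continuous derivative.\<close>

theorem attractor_closed_curve: "C1_closed_curve (attractor \<omega>)"
proof -
  have "\<exists>x. x \<in> lift \<omega> \<and> x $ idx1 = s" for s
    by (rule lift_slice_nonempty[OF \<omega>, of s]) blast
  then obtain \<gamma> where \<gamma>: "\<And>s. \<gamma> s \<in> lift \<omega>" "\<And>s. \<gamma> s $ idx1 = s" by metis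
  have "x = \<gamma> (x $ idx1)" if "x \<in> lift \<omega>" for x
    using that \<gamma> by (intro lift_determined_by_idx1) auto
  then have lift_eq: "lift \<omega> = range \<gamma>"
    using \<gamma>(1) by blast
  have "\<exists>K. \<forall>i. K i \<ge> 0 \<and> (\<forall>a\<in>lift \<omega>. \<forall>b\<in>lift \<omega>. \<forall>a'\<in>lift \<omega>. \<forall>b'\<in>lift \<omega>. \<forall>t\<le>0.
      a $ idx1 \<noteq> b $ idx1 \<longrightarrow> a' $ idx1 \<noteq> b' $ idx1 \<longrightarrow>
      \<bar>quot a b i t - quot a' b' i t\<bar> \<le> K i * offset a b a' b' * exp (- 2 * t))"
    by (rule choice, rule allI, rule quot_lipschitz)
  then obtain K where K: "\<forall>i. K i \<ge> 0 \<and> (\<forall>a\<in>lift \<omega>. \<forall>b\<in>lift \<omega>. \<forall>a'\<in>lift \<omega>. \<forall>b'\<in>lift \<omega>. \<forall>t\<le>0.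
      a $ idx1 \<noteq> b $ idx1 \<longrightarrow> a' $ idx1 \<noteq> b' $ idx1 \<longrightarrow>
      \<bar>quot a b i t - quot a' b' i t\<bar> \<le> K i * offset a b a' b' * exp (- 2 * t))"
    by (elim exE)
  obtain \<gamma>' where \<gamma>': "\<And>s. (\<gamma> has_vector_derivative \<gamma>' s) (at s)" "continuous_on UNIV \<gamma>'"
  proof (rule C1_of_lipschitz_slopes)
    fix s s' u u' :: real assume ne: "s \<noteq> s'" "u \<noteq> u'"
    let ?d = "(1 / (s' - s)) *\<^sub>R (\<gamma> s' - \<gamma> s) - (1 / (u' - u)) *\<^sub>R (\<gamma> u' - \<gamma> u)"
    have "\<bar>?d $ i\<bar> \<le> K i * (\<bar>s - u\<bar> + \<bar>s' - u'\<bar>)" for i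
    proof -
      have "?d $ i = quot (\<gamma> s) (\<gamma> s') i 0 - quot (\<gamma> u) (\<gamma> u') i 0"
        by (simp add: quot_def \<delta>_def \<omega> \<gamma>)
      then show ?thesis
        using K[THEN spec[of _ i], THEN conjunct2, rule_format,
            OF \<gamma>(1)[of s] \<gamma>(1)[of s'] \<gamma>(1)[of u] \<gamma>(1)[of u'], of 0] ne
        by (simp add: offset_def \<gamma>)
    qed
    then have "norm ?d \<le> (\<Sum>i\<in>UNIV. K i * (\<bar>s - u\<bar> + \<bar>s' - u'\<bar>))"
      by (intro order_trans[OF norm_le_l1_cart sum_mono])
    then show "norm ?d \<le> sum K UNIV * (\<bar>s - u\<bar> + \<bar>s' - u'\<bar>)"
      by (simp only: sum_distrib_right)
  next
    fix g' assume "\<And>s. (\<gamma> has_vector_derivative g' s) (at s)" "continuous_on UNIV g'"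
    then show thesis by (rule that[of g'])
  qed
  have "periodic_curve \<gamma> \<gamma>'"
  proof
    show "\<gamma> (s + 2 * pi) = \<gamma> s + vec (2 * pi)" for s
      using lift_deck[OF \<omega> \<gamma>(1), of s 1] \<gamma> by (intro lift_determined_by_idx1) auto
  qed (use \<gamma> \<gamma>' in auto)
  then show ?thesis
    unfolding attractor_def lift_eq by (rule periodic_curve.closed_curve)
qed

end

end

theorem theorem3p1:
  fixes \<alpha> \<epsilon> :: "real ^ 'n::{finite,linorder}"
    and P :: "'n path measure" and \<Omega> :: "'n path set"
  assumes "CARD('n) \<ge> 2"
    and "\<forall>i. \<epsilon> $ i > 0"
    and "wiener_measure P"
    and "admissible_paths P \<epsilon> \<Omega>"
  shows "\<exists>A :: real \<Rightarrow> 'n path \<Rightarrow> 'n phase set.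
    (\<forall>k>0. global_random_attractor P \<Omega> (Phi k \<alpha> \<epsilon>) (A k) \<and>
       (\<forall>D. random_set P \<Omega> D \<and> tempered P \<Omega> D \<longrightarrow>
          (\<forall>\<omega>\<in>\<Omega>. ((\<lambda>t. semidist ((\<lambda>p. Phi k \<alpha> \<epsilon> t p (wiener_shift (- t) \<omega>)) ` D (wiener_shift (- t) \<omega>))
                              (A k \<omega>)) \<longlongrightarrow> 0) at_top))) \<and>
    (\<exists>k0>0. \<forall>k\<ge>k0. \<forall>\<omega>\<in>\<Omega>. C1_closed_curve (A k \<omega>))"
proof -
  have system: "chain_system k \<epsilon> P \<Omega>" if "k > 0" for k
    using that assms(3,4) by unfold_locales
  let ?A = "\<lambda>k. chain_system.attractor k \<alpha> \<epsilon>"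
  have "global_random_attractor P \<Omega> (Phi k \<alpha> \<epsilon>) (?A k)" if "k > 0" for k
    by (rule chain_system.global_attractor[OF system[OF that]])
  moreover from this have "attracts \<Omega> (Phi k \<alpha> \<epsilon>) (?A k) D"
    if "k > 0" "random_set P \<Omega> D" "tempered P \<Omega> D" for k D
    using that unfolding global_random_attractor_def by blast
  \<comment> \<open>Any number above 3 would do as threshold; it depends neither on the path nor on
    \<alpha> and \<epsilon>.\<close>
  moreover have "C1_closed_curve (?A k \<omega>)" if "k \<ge> 4" "\<omega> \<in> \<Omega>" for k \<omega>
    using that by (intro chain_system.attractor_closed_curve[OF system]) auto
  ultimately show ?thesis
    unfolding attracts_def
    by (intro exI[of _ ?A] conjI exI[of _ "4 :: real"] allI impI ballI) simp_all
qed

end
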